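(* Let $m,n\ge 2$ be integers. The complex $\mathrm{Hom}(C_m,C_n)$ is described as follows. (1) If $n=4$ and $m=2k$ is even, $\mathrm{Hom}(C_m,C_4)$ is homotopy equivalent to $S^0$. (2) If $n=2l$ with $l\neq 2$ and $m=2sl$ for an integer $s\ge 1$, the connected components of $\mathrm{Hom}(C_m,C_n)$ are $2n$ points and $4s-2$ connected components which are homotopy equivalent to $S^1$, namely $\Delta_r^1$ and $\Delta_r^2$ for $r\in\{l,2l,\dots,(2s-1)l\}$. (3) If $n=2l$ with $l\neq 2$, $m=2k$ and $l\nmid k$, then $\mathrm{Hom}(C_m,C_n)$ has $2(2\lfloor k/l\rfloor+1)$ connected components, all homotopy equivalent to $S^1$, namely $\Delta_r^1$ and $\Delta_r^2$ for $r=k+tl$, $t\in\mathbb{Z}$, $|t|\le\lfloor k/l\rfloor$. (4) If $n=2l$ is even and $m=2k+1$ is odd, $\mathrm{Hom}(C_m,C_n)=\emptyset$. (5) If $n=2l+1$ is odd and $m=sn$ for an integer $s\ge 1$, the connected components of $\mathrm{Hom}(C_m,C_n)$ are $2n$ points and $s-1$ connected components homotopy equivalent to $S^1$, namely $\Delta_r$ for $r\in\{n,2n,\dots,(s-1)n\}$. (6) If $n=2l+1$ is odd, $m=2k+1$ is odd and $n\nmid m$, then $\mathrm{Hom}(C_m,C_n)$ has $[m/n]_{odd}+1$ connected components, all homotopy equivalent to $S^1$, namely $\Delta_r$ for $r=(m+tn)/2$ with $t$ an odd integer, $|t|\le[m/n]_{odd}$. (7) If $n=2l+1$ is odd, $m=2k$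 is even and $n\nmid m$, then $\mathrm{Hom}(C_m,C_n)$ has $[m/n]_{even}+1$ connected components, all homotopy equivalent to $S^1$, namely $\Delta_r$ for $r=k+\frac{tn}{2}$ with $t$ an even integer, $|t|\le[m/n]_{even}$.
   Context: Graphs are finite and undirected. For an integer $n\ge 2$, $C_n$ is the graph with vertex set $\{1,\dots,n\}$, identified with $\mathbb{Z}_n$, and edge set $\{(x,x+1),(x+1,x) : x\in\mathbb{Z}_n\}$. For graphs $G,H$, $\mathrm{Hom}(G,H)$ is the polyhedral complex whose cells are indexed by all functions $\eta:V(G)\to 2^{V(H)}\setminus\{\emptyset\}$ such that whenever $(x,y)\in E(G)$, $\tilde x\in\eta(x)$ and $\tilde y\in\eta(y)$, one has $(\tilde x,\tilde y)\in E(H)$; the cell $\eta$ is the product over $x\in V(G)$ of the simplices with vertex sets $\eta(x)$, and its closure consists of all cells $\tilde\eta$ with $\tilde\eta(x)\subseteq\eta(x)$ for all $x$. Its vertices are the graph homomorphisms $G\to H$; a vertex of $\mathrm{Hom}(C_m,C_n)$ is written as an $m$-tuple $(a_1,\dots,a_m)$. For an integer $i$, $[i]_m$ denotes the unique integer in $\{1,\dots,m\}$ congruent to $i$ modulo $m$. An index $i\in\{1,\dots,m\}$ is a returning point of the vertex $(a_1,\dots,a_m)$ if $[a_i-a_{[i+1]_m}]_n=1$. When $n\ne 4$ all vertices in a connected component have the same number $r$ of returning points. Let $r\neq 0,m$. For $n$ even, $n\neq 4$, $\Delta_r^i$ ($i\in\{1,2\}$) denotes the connected component in which all vertices have $r$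 returning points and some vertex has $a_1=i$; for $n$ odd, $\Delta_r$ denotes the connected component all of whose vertices have $r$ returning points. For a real number $x$, $\lfloor x\rfloor$, $[x]_{odd}$ and $[x]_{even}$ denote the largest integer, the largest odd integer and the largest even integer, respectively, less than or equal to $x$.
   Formalization: Part (2) is stated with the extra hypothesis l ≠ 1 (n ≠ 2), since for n = 2 and m = 2s the complex Hom(C_m, C_2) is just 2 points, not 2n = 4 points and 4s−2 circles. *)

theory Defs
  imports "HOL-Analysis.Analysis" "HOL-Number_Theory.Cong" "Graph_Theory.Pair_Digraph"
begin

section \<open>Hom complexes\<close>

definition graph_homs :: "'a pair_pre_digraph \<Rightarrow> 'b pair_pre_digraph \<Rightarrow> ('a \<Rightarrow> 'b) set" where
  "graph_homs G H =
     {a \<in> pverts G \<rightarrow>\<^sub>E pverts H. \<forall>(x, y) \<in> parcs G. (a x, a y) \<in> parcs H}"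

text \<open>The index set of the cells.\<close>

definition hom_cells :: "'a pair_pre_digraph \<Rightarrow> 'b pair_pre_digraph \<Rightarrow> ('a \<Rightarrow> 'b set) set" where
  "hom_cells G H =
     {\<eta> \<in> pverts G \<rightarrow>\<^sub>E (Pow (pverts H) - {{}}).
        \<forall>(x, y) \<in> parcs G. \<forall>x' \<in> \<eta> x. \<forall>y' \<in> \<eta> y. (x', y') \<in> parcs H}"

text \<open>The closed simplex with (finite) vertex set \<open>A\<close>, in barycentric coordinates.\<close>

definition vertex_simplex :: "'b set \<Rightarrow> ('b \<Rightarrow> real) set" where
  "vertex_simplex A =
     {w. (\<forall>v. 0 \<le> w v) \<and> (\<forall>v. v \<notin> A \<longrightarrow> w v = 0) \<and> sum w A = 1}"

text \<open>The closed cell, a product of closed simplices. The coordinates outside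
  \<open>pverts G\<close> are dummies, fixed to zero.\<close>

definition closed_cell :: "'a pair_pre_digraph \<Rightarrow> ('a \<Rightarrow> 'b set) \<Rightarrow> ('a \<Rightarrow> 'b \<Rightarrow> real) set" where
  "closed_cell G \<eta> =
     {p. (\<forall>x \<in> pverts G. p x \<in> vertex_simplex (\<eta> x)) \<and> (\<forall>x. x \<notin> pverts G \<longrightarrow> p x = (\<lambda>_. 0))}"

text \<open>The underlying space. For finite graphs there are finitely many cells, so that
  the subspace topology (of the product topology) is the topology of the complex.\<close>

definition hom_complex ::
    "'a pair_pre_digraph \<Rightarrow> 'b pair_pre_digraph \<Rightarrow> ('a \<Rightarrow> 'b \<Rightarrow> real) topology" where
  "hom_complex G H = top_of_set (\<Union>\<eta> \<in> hom_cells G H. closed_cell G \<eta>)"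

text \<open>The vertices lying in a subset \<open>C\<close> of the complex; the vertex \<open>a\<close> is the
  cell all of whose simplices are the single points \<open>a x\<close>.\<close>

definition vertices_in ::
    "'a pair_pre_digraph \<Rightarrow> 'b pair_pre_digraph \<Rightarrow> ('a \<Rightarrow> 'b \<Rightarrow> real) set \<Rightarrow> ('a \<Rightarrow> 'b) set" where
  "vertices_in G H C =
     {a \<in> graph_homs G H. closed_cell G (\<lambda>x \<in> pverts G. {a x}) \<subseteq> C}"

section \<open>Cycles\<close>

definition rep :: "int \<Rightarrow> int \<Rightarrow> int" where
  "rep m i = (THE j. j \<in> {1..m} \<and> [j = i] (mod m))"

lemma rep_eq:
  assumes "1 \<le> m"
  shows "rep m i = (i - 1) mod m + 1"
  unfolding rep_def
proof (rule the_equality)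
  have "0 \<le> (i - 1) mod m" "(i - 1) mod m < m"
    using assms by auto
  moreover have "[(i - 1) mod m + 1 = i] (mod m)"
    by (simp add: cong_def mod_simps)
  ultimately show "(i - 1) mod m + 1 \<in> {1..m} \<and> [(i - 1) mod m + 1 = i] (mod m)"
    by simp
next
  fix j assume j: "j \<in> {1..m} \<and> [j = i] (mod m)"
  then have "[j - 1 = i - 1] (mod m)"
    by (intro cong_diff) auto
  then have "(j - 1) mod m = (i - 1) mod m"
    by (simp add: cong_def)
  moreover have "(j - 1) mod m = j - 1"
    using j by (intro mod_pos_pos_trivial) auto
  ultimately show "j = (i - 1) mod m + 1"
    by simp
qed

definition cycle_graph :: "int \<Rightarrow> int pair_pre_digraph" where
  "cycle_graph n =
     \<lparr> pverts = {1..n},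
       parcs = {(x, rep n (x + 1)) | x. x \<in> {1..n}} \<union> {(rep n (x + 1), x) | x. x \<in> {1..n}} \<rparr>"

abbreviation Hom_cycles :: "int \<Rightarrow> int \<Rightarrow> (int \<Rightarrow> int \<Rightarrow> real) topology" where
  "Hom_cycles m n \<equiv> hom_complex (cycle_graph m) (cycle_graph n)"

definition returning_points :: "int \<Rightarrow> int \<Rightarrow> (int \<Rightarrow> int) \<Rightarrow> int set" where
  "returning_points m n a = {i \<in> {1..m}. rep n (a i - a (rep m (i + 1))) = 1}"

section \<open>Named connected components\<close>

definition all_returning :: "int \<Rightarrow> int \<Rightarrow> int \<Rightarrow> (int \<Rightarrow> int \<Rightarrow> real) set \<Rightarrow> bool" where
  "all_returning m n r C \<longleftrightarrow>
     (\<forall>a \<in> vertices_in (cycle_graph m) (cycle_graph n) C. int (card (returning_points m n a)) = r)"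

text \<open>\<open>is_Delta_even\<close> (for \<open>n\<close> even) and \<open>is_Delta_odd\<close> (for \<open>n\<close> odd) are the properties
  describing the components; that exactly one component has them is not built into
  \<open>Delta_even\<close>, \<open>Delta_odd\<close> and has to be stated where these are used.\<close>

definition is_Delta_even :: "int \<Rightarrow> int \<Rightarrow> int \<Rightarrow> int \<Rightarrow> (int \<Rightarrow> int \<Rightarrow> real) set \<Rightarrow> bool" where
  "is_Delta_even m n r i C \<longleftrightarrow>
     C \<in> connected_components_of (Hom_cycles m n) \<and> all_returning m n r C \<and>
     (\<exists>a \<in> vertices_in (cycle_graph m) (cycle_graph n) C. a 1 = i)"

definition is_Delta_odd :: "int \<Rightarrow> int \<Rightarrow> int \<Rightarrow> (int \<Rightarrow> int \<Rightarrow> real) set \<Rightarrow> bool" where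
  "is_Delta_odd m n r C \<longleftrightarrow>
     C \<in> connected_components_of (Hom_cycles m n) \<and> all_returning m n r C"

definition Delta_even :: "int \<Rightarrow> int \<Rightarrow> int \<Rightarrow> int \<Rightarrow> (int \<Rightarrow> int \<Rightarrow> real) set" where
  "Delta_even m n r i = (THE C. is_Delta_even m n r i C)"

definition Delta_odd :: "int \<Rightarrow> int \<Rightarrow> int \<Rightarrow> (int \<Rightarrow> int \<Rightarrow> real) set" where
  "Delta_odd m n r = (THE C. is_Delta_odd m n r C)"

abbreviation homotopy_circle :: "'a topology \<Rightarrow> bool" where
  "homotopy_circle X \<equiv> X homotopy_equivalent_space nsphere 1"

section \<open>Largest odd and even integers below a real number\<close>

definition odd_floor :: "real \<Rightarrow> int" where
  "odd_floor x = (GREATEST j :: int. odd j \<and> real_of_int j \<le> x)"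

definition even_floor :: "real \<Rightarrow> int" where
  "even_floor x = (GREATEST j :: int. even j \<and> real_of_int j \<le> x)"

end

theory Submission
  imports Defs
begin

text \<open>
  For \<open>n \<ge> 3\<close>, \<open>n \<noteq> 4\<close>, two vertices of \<open>C\<^sub>n\<close> have at most one common neighbour, so every simplex of a
  cell is a point or an edge \<open>{c, c - 2}\<close>, and of two adjacent coordinates one is a vertex. Unrolling
  these edges, a point of \<open>Hom(C\<^sub>m, C\<^sub>n)\<close> lifts to a function \<open>q\<close> from the integers to the reals whose
  increments \<open>q (i + 1) - q i\<close> lie in \<open>[0, 1]\<close>, with \<open>q i\<close> or \<open>q (i + 1)\<close> an integer, and with
  \<open>q (i + m) = q i + r\<close>, where \<open>r\<close> is the number of returning points. The lift is unique up to adding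
  integers \<open>d\<close> with \<open>n dvd 2 d\<close>.

  The pairs \<open>(q i, q (i + 1))\<close> form a chain in the plane, so the lifts are closed under pointwise
  minimum and maximum. For \<open>0 < r < m\<close> there is an equivariant monotone curve of lifts, and clamping
  \<open>q\<close> between two points of this curve that move together contracts the space of lifts onto it,
  equivariantly. Hence the component is homotopy equivalent to the quotient of the line by a
  translation, a circle. For \<open>r \<in> {0, m}\<close> the lifts are rigid and give isolated points.
\<close>

section \<open>Descending homotopies along compact quotients\<close>

text \<open>For the clamp to commute with the translations, its two bounds have to move with
  \<open>q\<close>; they are therefore the points of the curve at parameters computed from
  \<open>q 0\<close> alone. The translation of a lift by \<open>d\<close> is invisible in the
  complex exactly when \<open>n dvd 2 * d\<close>. For odd \<open>n\<close> the walk with steps of 2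
  runs through all residues, and each rotation number gives a single strand. For even
  \<open>n\<close> it stays in one parity class; the parity of the starting offset \<open>c\<close>
  is then an invariant, each rotation number gives two strands, and this is the origin of the upper
  index of the components. In \<open>C_4\<close> opposite vertices have two common neighbours and
  the lifting breaks down; that target is treated through its bipartition instead.\<close>

lemma Hausdorff_space_euclidean_t2: "Hausdorff_space (euclidean :: 'a::t2_space topology)"
  unfolding Hausdorff_space_def disjnt_def by (metis hausdorff open_openin)

text \<open>\<open>A\<close> is going to be a noncompact space of lifts, but the compact
  \<open>K\<close> already covers \<open>C\<close>. Restricted to \<open>K\<close>, the map \<pi>
  goes from a compact to a Hausdorff space, so it is closed and hence a quotient map, through which
  \<open>F\<close> factors.\<close>

lemma compact_quotient_lift:
  fixes \<pi> :: "'a::topological_space \<Rightarrow> 'b::t2_space" and F :: "'a \<Rightarrow> 'c::topological_space"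
  assumes \<pi>: "continuous_on A \<pi>" and K: "compact K" "K \<subseteq> A" "\<pi> ` K = C" and C: "\<pi> ` A = C"
    and F: "continuous_on A F"
    and fibre: "\<And>x y. \<lbrakk>x \<in> A; y \<in> A; \<pi> x = \<pi> y\<rbrakk> \<Longrightarrow> F x = F y"
  obtains G where "continuous_on C G" "\<And>x. x \<in> A \<Longrightarrow> G (\<pi> x) = F x"
proof -
  have \<pi>K: "continuous_map (top_of_set K) (top_of_set C) \<pi>"
    using \<pi> K by (auto intro: continuous_on_subset)
  have "closed_map (top_of_set K) (top_of_set C) \<pi>"
    using \<pi>K K(1) by (intro continuous_imp_closed_map)
      (auto simp: compact_space_subtopology intro: Hausdorff_space_subtopology Hausdorff_space_euclidean_t2)
  then have q: "quotient_map (top_of_set K) (top_of_set C) \<pi>"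
    using \<pi>K K(3) by (intro continuous_closed_imp_quotient_map) auto
  have "continuous_map (top_of_set K) euclidean F"
    using F K(2) by (auto intro: continuous_on_subset)
  then obtain G where G: "continuous_map (top_of_set C) euclidean G"
      "\<And>x. x \<in> K \<Longrightarrow> G (\<pi> x) = F x"
    using quotient_map_lift_exists[OF q, of euclidean F] fibre K(2)
    by (metis subsetD topspace_euclidean_subtopology)
  show thesis
  proof
    show "continuous_on C G" using G(1) by auto
    show "G (\<pi> x) = F x" if x: "x \<in> A" for x
    proof -
      obtain y where y: "y \<in> K" "\<pi> y = \<pi> x" using x K(3) C by (metis imageE imageI)
      then show ?thesis using G(2)[of y] fibre[of y x] x K(2) by auto
    qed
  qed
qed

text \<open>The previous factorization is applied to the product of the identity of
  \<open>{0..1}\<close> with \<pi>, with \<open>{0..1} \<times> K\<close> as compact piece. At time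
  1 the homotopy is compared with the identity only after applying \<pi>.\<close>

lemma homotopy_descends:
  fixes \<pi> :: "'a::topological_space \<Rightarrow> 'b::t2_space" and H :: "real \<times> 'a \<Rightarrow> 'a"
  assumes \<pi>: "continuous_on A \<pi>" and K: "compact K" "K \<subseteq> A" "\<pi> ` K = C" and C: "\<pi> ` A = C"
    and H: "continuous_on ({0..1} \<times> A) H" "H \<in> {0..1} \<times> A \<rightarrow> A"
    and fibre: "\<And>u x y. \<lbrakk>u \<in> {0..1}; x \<in> A; y \<in> A; \<pi> x = \<pi> y\<rbrakk> \<Longrightarrow> \<pi> (H (u, x)) = \<pi> (H (u, y))"
    and F: "\<And>x. x \<in> A \<Longrightarrow> F (\<pi> x) = \<pi> (H (0, x))"
    and H1: "\<And>x. x \<in> A \<Longrightarrow> \<pi> (H (1, x)) = \<pi> x"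
  shows "homotopic_with (\<lambda>x. True) (top_of_set C) (top_of_set C) F id"
proof -
  let ?P = "\<lambda>(u::real, x). (u, \<pi> x)"
  have c: "continuous_on ({0..1} \<times> A) ?P"
    unfolding case_prod_unfold
    by (intro continuous_intros continuous_on_compose2[OF \<pi>]) auto
  have cH: "continuous_on ({0..1} \<times> A) (\<lambda>z. \<pi> (H z))"
    by (intro continuous_on_compose2[OF \<pi>] H(1)) (use H(2) in auto)
  obtain G where G: "continuous_on ({0..1} \<times> C) G"
      "\<And>z. z \<in> {0..1} \<times> A \<Longrightarrow> G (?P z) = \<pi> (H z)"
  proof (rule compact_quotient_lift[where A="{0..1} \<times> A" and K="{0..1} \<times> K" and C="{0..1} \<times> C" and \<pi>="?P" and F="\<lambda>z. \<pi> (H z)"])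
    show "?P ` ({0..1} \<times> K) = {0..1} \<times> C"
      unfolding K(3)[symmetric] by (auto simp: image_def Bex_def)
    show "?P ` ({0..1} \<times> A) = {0..1} \<times> C"
      unfolding C[symmetric] by (auto simp: image_def Bex_def)
    show "compact ({0..1::real} \<times> K)" "{0..1::real} \<times> K \<subseteq> {0..1} \<times> A"
      using K by (auto intro: compact_Times)
    show "\<pi> (H y) = \<pi> (H z)" if "y \<in> {0..1} \<times> A" "z \<in> {0..1} \<times> A" "?P y = ?P z" for y z
      using that fibre[of "fst y" "snd y" "snd z"] by (auto simp: split_beta)
  qed (rule c cH that, assumption?)+
  have inC: "G (u, y) \<in> C" if "u \<in> {0..1}" and "y \<in> C" for u y
  proof -
    obtain x where "x \<in> A" "y = \<pi> x" using \<open>y \<in> C\<close> C by blast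
    then show ?thesis using G(2)[of "(u, x)"] H(2) that C by (auto simp: Pi_iff)
  qed
  have "continuous_map (prod_topology (top_of_set {0..1}) (top_of_set C)) (top_of_set C) G"
    using G(1) inC by (auto simp: prod_topology_subtopology_eu)
  moreover have "G (0, y) = F y \<and> G (1, y) = id y" if "y \<in> C" for y
  proof -
    obtain x where x: "x \<in> A" "y = \<pi> x" using \<open>y \<in> C\<close> C by auto
    then show ?thesis using G(2)[of "(0, x)"] G(2)[of "(1, x)"] F H1 by simp
  qed
  ultimately show ?thesis
    by (subst homotopic_with) (simp_all, blast)
qed

text \<open>The compact sets \<open>K\<close> and \<open>L\<close> play the role of fundamental domains and make covering space
  theory unnecessary.\<close>

lemma homotopy_eqv_descends:
  fixes \<pi> :: "'a::topological_space \<Rightarrow> 'b::t2_space" and \<rho> :: "'c::topological_space \<Rightarrow> 'd::t2_space"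
    and H :: "real \<times> 'a \<Rightarrow> 'a" and J :: "real \<times> 'c \<Rightarrow> 'c"
  assumes \<pi>: "continuous_on A \<pi>" and K: "compact K" "K \<subseteq> A" "\<pi> ` K = C" and C: "\<pi> ` A = C"
    and \<rho>: "continuous_on B \<rho>" and L: "compact L" "L \<subseteq> B" "\<rho> ` L = D" and D: "\<rho> ` B = D"
    and f: "continuous_on A f" "f \<in> A \<rightarrow> B"
    and ff: "\<And>x y. \<lbrakk>x \<in> A; y \<in> A; \<pi> x = \<pi> y\<rbrakk> \<Longrightarrow> \<rho> (f x) = \<rho> (f y)"
    and g: "continuous_on B g" "g \<in> B \<rightarrow> A"
    and gf: "\<And>x y. \<lbrakk>x \<in> B; y \<in> B; \<rho> x = \<rho> y\<rbrakk> \<Longrightarrow> \<pi> (g x) = \<pi> (g y)"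
    and H: "continuous_on ({0..1} \<times> A) H" "H \<in> {0..1} \<times> A \<rightarrow> A"
    and Hf: "\<And>u x y. \<lbrakk>u \<in> {0..1}; x \<in> A; y \<in> A; \<pi> x = \<pi> y\<rbrakk> \<Longrightarrow> \<pi> (H (u, x)) = \<pi> (H (u, y))"
    and H0: "\<And>x. x \<in> A \<Longrightarrow> H (0, x) = g (f x)" and H1: "\<And>x. x \<in> A \<Longrightarrow> \<pi> (H (1, x)) = \<pi> x"
    and J: "continuous_on ({0..1} \<times> B) J" "J \<in> {0..1} \<times> B \<rightarrow> B"
    and Jf: "\<And>u x y. \<lbrakk>u \<in> {0..1}; x \<in> B; y \<in> B; \<rho> x = \<rho> y\<rbrakk> \<Longrightarrow> \<rho> (J (u, x)) = \<rho> (J (u, y))"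
    and J0: "\<And>x. x \<in> B \<Longrightarrow> J (0, x) = f (g x)" and J1: "\<And>x. x \<in> B \<Longrightarrow> \<rho> (J (1, x)) = \<rho> x"
  shows "C homotopy_eqv D"
proof -
  have "continuous_on A (\<lambda>x. \<rho> (f x))"
    using f by (intro continuous_on_compose2[OF \<rho>]) auto
  from compact_quotient_lift[OF \<pi> K C this ff]
  obtain f' where f': "continuous_on C f'" "\<And>x. x \<in> A \<Longrightarrow> f' (\<pi> x) = \<rho> (f x)"
    by metis
  have "continuous_on B (\<lambda>x. \<pi> (g x))"
    using g by (intro continuous_on_compose2[OF \<pi>]) auto
  from compact_quotient_lift[OF \<rho> L D this gf]
  obtain g' where g': "continuous_on D g'" "\<And>x. x \<in> B \<Longrightarrow> g' (\<rho> x) = \<pi> (g x)"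
    by metis
  have "homotopic_with (\<lambda>x. True) (top_of_set C) (top_of_set C) (g' \<circ> f') id"
    by (rule homotopy_descends[OF \<pi> K C H Hf _ H1]) (use f' g' f H0 in auto)
  moreover have "homotopic_with (\<lambda>x. True) (top_of_set D) (top_of_set D) (f' \<circ> g') id"
    by (rule homotopy_descends[OF \<rho> L D J Jf _ J1]) (use f' g' g J0 in auto)
  moreover have "f' \<in> C \<rightarrow> D" "g' \<in> D \<rightarrow> C"
    using f'(2) g'(2) f(2) g(2) C D by (force simp: Pi_iff)+
  ultimately show ?thesis
    unfolding homotopy_equivalent_space_def using f'(1) g'(1) by auto
qed

text \<open>The track of \<open>H\<close>, pushed down by \<pi>, joins the image of each
  \<open>x\<close> to the connected image of \<open>g\<close>. The resulting sets \<open>T x\<close>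
  are connected, share a point and cover the image of \<open>A\<close>.\<close>

lemma connected_image_contracts:
  fixes \<pi> :: "'a::topological_space \<Rightarrow> 'b::topological_space" and H :: "real \<times> 'a \<Rightarrow> 'a"
  assumes \<pi>: "continuous_on A \<pi>" and B: "connected B"
    and g: "continuous_on B g" "g \<in> B \<rightarrow> A"
    and H: "continuous_on ({0..1} \<times> A) H" "H \<in> {0..1} \<times> A \<rightarrow> A"
    and H0: "\<And>x. x \<in> A \<Longrightarrow> H (0, x) \<in> g ` B" and H1: "\<And>x. x \<in> A \<Longrightarrow> \<pi> (H (1, x)) = \<pi> x"
  shows "connected (\<pi> ` A)"
proof -
  define T where "T x = (\<lambda>u. \<pi> (H (u, x))) ` {0..1::real} \<union> \<pi> ` g ` B" for x
  have cg: "connected (\<pi> ` g ` B)"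
    using g \<pi> B by (intro connected_continuous_image) (auto intro: continuous_on_subset)
  have T: "connected (T x)" if x: "x \<in> A" for x
  proof -
    have "continuous_on {0..1} (\<lambda>u. \<pi> (H (u, x)))"
      by (intro continuous_on_compose2[OF \<pi>] continuous_on_compose2[OF H(1)] continuous_intros)
        (use x H(2) in auto)
    then have "connected ((\<lambda>u. \<pi> (H (u, x))) ` {0..1::real})"
      by (rule connected_continuous_image) (rule convex_connected, simp)
    moreover have "\<pi> (H (0, x)) \<in> (\<lambda>u. \<pi> (H (u, x))) ` {0..1::real} \<inter> \<pi> ` g ` B"
      using H0[OF x] by auto
    ultimately show ?thesis unfolding T_def using cg by (metis connected_Un empty_iff)
  qed
  have eq: "\<pi> ` A = (\<Union>x\<in>A. T x)"
  proof (intro equalityI subsetI)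
    fix y assume "y \<in> \<pi> ` A"
    then obtain x where x: "x \<in> A" "y = \<pi> (H (1, x))" using H1 by auto
    then have "y \<in> T x" unfolding T_def by simp
    then show "y \<in> (\<Union>x\<in>A. T x)" using x(1) by blast
  next
    fix y assume "y \<in> (\<Union>x\<in>A. T x)"
    then obtain x where "x \<in> A" "y \<in> T x" by blast
    then show "y \<in> \<pi> ` A" unfolding T_def using H(2) g(2) by auto
  qed
  show ?thesis
  proof (cases "A = {} \<or> B = {}")
    case True
    then have "A = {}" using H0 by auto
    then show ?thesis by simp
  next
    case False
    then obtain b where "b \<in> B" by auto
    then have "\<pi> (g b) \<in> (\<Inter>x\<in>A. T x)" unfolding T_def by auto
    then show ?thesis unfolding eq using T by (intro connected_Union) auto
  qed
qed

text \<open>By finiteness the union of the remaining members is closed, so each member is clopen in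
  the whole, and a connected set that meets it cannot leave it.\<close>

lemma connected_components_of_finite_partition:
  fixes \<A> :: "'a::topological_space set set"
  assumes fin: "finite \<A>" and cl: "\<And>A. A \<in> \<A> \<Longrightarrow> closed A"
    and con: "\<And>A. A \<in> \<A> \<Longrightarrow> connected A" and ne: "{} \<notin> \<A>"
    and disj: "\<And>A B. \<lbrakk>A \<in> \<A>; B \<in> \<A>; A \<noteq> B\<rbrakk> \<Longrightarrow> A \<inter> B = {}"
  shows "connected_components_of (top_of_set (\<Union>\<A>)) = \<A>"
proof -
  have comp: "C \<subseteq> A" if C: "connected C" "C \<subseteq> \<Union>\<A>" and A: "A \<in> \<A>" "C \<inter> A \<noteq> {}" for C A
  proof -
    have "closed A" "closed (\<Union>(\<A> - {A}))" using fin cl A by (auto intro: closed_Union)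
    moreover have "C \<subseteq> A \<union> \<Union>(\<A> - {A})" using C by auto
    moreover have "A \<inter> \<Union>(\<A> - {A}) = {}" using disj A by blast
    ultimately have "C \<inter> \<Union>(\<A> - {A}) = {}"
      using connected_closedD[OF C(1), of A "\<Union>(\<A> - {A})"] A(2) by auto
    then show ?thesis using C(2) by blast
  qed
  let ?X = "top_of_set (\<Union>\<A>)"
  have A: "A \<in> connected_components_of ?X" if A: "A \<in> \<A>" for A
  proof -
    obtain x where x: "x \<in> A" using ne A by (metis ex_in_conv)
    have "connected_component_of_set ?X x = A"
    proof
      show "A \<subseteq> connected_component_of_set ?X x"
        using A x con[OF A] by (intro connected_component_of_maximal) (auto simp: connectedin_subtopology)
      have "connectedin ?X (connected_component_of_set ?X x)"
        by (rule connectedin_connected_component_of)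
      then have "connected (connected_component_of_set ?X x)" "connected_component_of_set ?X x \<subseteq> \<Union>\<A>"
        by (auto simp: connectedin_subtopology)
      moreover have "x \<in> connected_component_of_set ?X x"
        using x A by (auto simp: connected_component_of_refl)
      ultimately show "connected_component_of_set ?X x \<subseteq> A"
        using comp[OF _ _ A] x by blast
    qed
    then show ?thesis using x A by (auto simp: connected_components_of_def)
  qed
  moreover have "C \<in> \<A>" if C: "C \<in> connected_components_of ?X" for C
  proof -
    have "C \<noteq> {}" "C \<subseteq> \<Union>\<A>"
      using nonempty_connected_components_of[OF C] connected_components_of_subset[OF C] by auto
    then obtain B where B: "B \<in> \<A>" "C \<inter> B \<noteq> {}" by blast
    then have "C = B" using A[OF B(1)] C connected_components_of_disjoint[of C ?X B] by (auto simp: disjnt_def)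
    then show ?thesis using B by simp
  qed
  ultimately show ?thesis by blast
qed

section \<open>Piecewise linear interpolation\<close>

text \<open>Serves two constructions: barycentric coordinates along a closed walk
  (\<open>edge_point\<close>) and the staircase behind the curve of lifts
  (\<open>stairs\<close>).\<close>

definition interp :: "(int \<Rightarrow> real) \<Rightarrow> real \<Rightarrow> real" where
  "interp F y = (1 - frac y) * F \<lfloor>y\<rfloor> + frac y * F (\<lfloor>y\<rfloor> + 1)"

lemma interp_of_int [simp]: "interp F (of_int j) = F j"
  by (simp add: interp_def)

lemma interp_unit:
  assumes "of_int j \<le> y" "y \<le> of_int j + 1"
  shows "interp F y = (1 - (y - of_int j)) * F j + (y - of_int j) * F (j + 1)"
proof (cases "y = of_int j + 1")
  case True
  then have "y = of_int (j + 1)" by simp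
  then show ?thesis by (simp only: interp_of_int) simp
next
  case False
  then have "\<lfloor>y\<rfloor> = j" using assms by linarith
  then show ?thesis by (simp add: interp_def frac_def)
qed

lemma interp_shift: "interp F (y + of_int d) = interp (\<lambda>j. F (j + d)) y"
  by (simp add: interp_def frac_def algebra_simps)

lemma interp_add: "interp (\<lambda>j. F j + G j) y = interp F y + interp G y"
  by (simp add: interp_def algebra_simps)

lemma interp_diff: "interp (\<lambda>j. F j - G j) y = interp F y - interp G y"
  by (simp add: interp_def algebra_simps)

lemma interp_const [simp]: "interp (\<lambda>j. a) y = a"
  by (simp add: interp_def algebra_simps)

lemma interp_bounds:
  assumes "\<And>j. F j \<in> {a..b}"
  shows "interp F y \<in> {a..b}"
proof -
  have f: "0 \<le> frac y" "0 \<le> 1 - frac y" using frac_lt_1[of y] by auto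
  have "interp F y \<le> (1 - frac y) * b + frac y * b" "(1 - frac y) * a + frac y * a \<le> interp F y"
    unfolding interp_def using assms f by (auto intro!: add_mono mult_left_mono)
  then show ?thesis by (simp add: algebra_simps)
qed

lemma continuous_on_interp: "continuous_on UNIV (interp F)"
proof -
  have "isCont (interp F) y" for y
  proof -
    define j where "j = \<lfloor>y\<rfloor>"
    \<comment> \<open>\<open>max\<close> and \<open>min\<close> glue the two linear pieces that meet
      at \<open>j\<close> into one continuous formula, valid on an open interval around
      \<open>y\<close> even if \<open>y = j\<close>.\<close>
    let ?g = "\<lambda>y. F j + (F (j + 1) - F j) * max 0 (y - of_int j) + (F j - F (j - 1)) * min 0 (y - of_int j)"
    have eq: "interp F z = ?g z" if "z \<in> {of_int j - 1 <..< of_int j + 1}" for z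
    proof (cases "of_int j \<le> z")
      case True
      then show ?thesis using that interp_unit[of j z F] by (simp add: algebra_simps max_def min_def)
    next
      case False
      then show ?thesis using that interp_unit[of "j - 1" z F] by (simp add: algebra_simps max_def min_def)
    qed
    have "continuous_on {of_int j - 1 <..< of_int j + 1} (interp F)"
      by (rule continuous_on_cong[THEN iffD2, OF refl eq]) (auto intro!: continuous_intros)
    moreover have "y \<in> {of_int j - 1 <..< of_int j + 1}" unfolding j_def by (simp; linarith)
    ultimately show ?thesis by (simp add: continuous_on_eq_continuous_at)
  qed
  then show ?thesis by (simp add: continuous_on_eq_continuous_at)
qed

lemma continuous_on_interp_compose [continuous_intros]:
  "continuous_on S f \<Longrightarrow> continuous_on S (\<lambda>x. interp F (f x))"
  by (rule continuous_on_compose2[OF continuous_on_interp]) auto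

section \<open>Residues and cycles\<close>

lemma rep_range: "1 \<le> n \<Longrightarrow> rep n a \<in> {1..n}"
  using pos_mod_bound[of n "a - 1"] by (simp add: rep_eq del: pos_mod_bound)

lemma rep_cong: "1 \<le> n \<Longrightarrow> [rep n a = a] (mod n)"
  by (simp add: rep_eq cong_def mod_simps)

lemma rep_ident: "x \<in> {1..n} \<Longrightarrow> rep n x = x"
  by (simp add: rep_eq mod_pos_pos_trivial)

lemma rep_eq_iff: "1 \<le> n \<Longrightarrow> rep n a = rep n b \<longleftrightarrow> n dvd a - b"
  by (simp add: rep_eq mod_eq_dvd_iff)

lemma rep_eq_self_iff: "1 \<le> n \<Longrightarrow> v \<in> {1..n} \<Longrightarrow> v = rep n b \<longleftrightarrow> n dvd v - b"
  by (metis rep_eq_iff rep_ident)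

lemma parcs_cycle_iff:
  assumes "1 \<le> n"
  shows "(u, v) \<in> parcs (cycle_graph n) \<longleftrightarrow>
    u \<in> {1..n} \<and> v \<in> {1..n} \<and> (n dvd v - u - 1 \<or> n dvd u - v - 1)"
  using assms rep_range[OF assms] rep_eq_self_iff[OF assms, of v "u + 1"] rep_eq_self_iff[OF assms, of u "v + 1"]
  unfolding cycle_graph_def by (auto simp: algebra_simps)

text \<open>For \<open>d \<noteq> 0\<close> the number \<open>2 * d\<close> is 2 or 4 up to sign,
  and among the \<open>n \<ge> 3\<close> only 4 divides one of these. This is how
  \<open>n \<noteq> 4\<close> enters: vertices two steps apart have a unique common neighbour, and
  two lifts of one point cannot drift apart.\<close>

lemma two_dvd_small:
  fixes n d :: int
  assumes "3 \<le> n" "n \<noteq> 4" "n dvd 2 * d" "\<bar>d\<bar> \<le> 2"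
  shows "d = 0"
proof (rule ccontr)
  assume "d \<noteq> 0"
  then have "d \<in> {-2, -1, 1, 2}" using assms(4) by auto
  then have "n dvd 2 \<or> n dvd 4" using assms(3) by auto
  then have "n dvd 4" by (auto dest: dvd_trans[of n 2 4])
  then have "n \<le> 4" by (rule zdvd_imp_le) simp
  then have "n = 3" using assms by simp
  with \<open>n dvd 4\<close> show False by simp
qed

section \<open>Points of a Hom complex\<close>

text \<open>The smallest closed cell containing \<open>p\<close> is indexed by the supports of its
  coordinates, so lying in some cell becomes a condition on pairs of supports.\<close>

lemma hom_complex_point_iff:
  assumes fin: "finite (pverts H)" and arcs: "parcs G \<subseteq> pverts G \<times> pverts G"
  shows "p \<in> (\<Union>\<eta> \<in> hom_cells G H. closed_cell G \<eta>) \<longleftrightarrow>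
    (\<forall>x \<in> pverts G. p x \<in> vertex_simplex (pverts H)) \<and> (\<forall>x. x \<notin> pverts G \<longrightarrow> p x = (\<lambda>_. 0)) \<and>
    (\<forall>(x, y) \<in> parcs G. \<forall>u v. p x u \<noteq> 0 \<longrightarrow> p y v \<noteq> 0 \<longrightarrow> (u, v) \<in> parcs H)" (is "?L \<longleftrightarrow> ?R")
proof
  assume ?L
  then obtain \<eta> where \<eta>: "\<eta> \<in> hom_cells G H" and p: "p \<in> closed_cell G \<eta>" by blast
  have sub: "\<eta> x \<subseteq> pverts H" if "x \<in> pverts G" for x
    using \<eta> that by (auto simp: hom_cells_def PiE_iff)
  have "p x \<in> vertex_simplex (pverts H)" if x: "x \<in> pverts G" for x
  proof -
    have px: "p x \<in> vertex_simplex (\<eta> x)" using p x by (simp add: closed_cell_def)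
    then have "sum (p x) (pverts H) = sum (p x) (\<eta> x)"
      using sub[OF x] fin by (intro sum.mono_neutral_right) (auto simp: vertex_simplex_def)
    then show ?thesis using px sub[OF x] by (auto simp: vertex_simplex_def)
  qed
  moreover have "(u, v) \<in> parcs H"
    if "(x, y) \<in> parcs G" "p x u \<noteq> 0" "p y v \<noteq> 0" for x y u v
  proof -
    have "x \<in> pverts G" "y \<in> pverts G" using that(1) arcs by auto
    then have "p x \<in> vertex_simplex (\<eta> x)" "p y \<in> vertex_simplex (\<eta> y)"
      using p by (simp_all add: closed_cell_def)
    then have "u \<in> \<eta> x" "v \<in> \<eta> y" using that(2,3) unfolding vertex_simplex_def by blast+
    then show ?thesis using \<eta> that by (auto simp: hom_cells_def)
  qed
  ultimately show ?R using p by (auto simp: closed_cell_def)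
next
  assume R: ?R
  define \<eta> where "\<eta> = (\<lambda>x \<in> pverts G. {v. p x v \<noteq> 0})"
  have simp: "p x \<in> vertex_simplex (\<eta> x)" "\<eta> x \<in> Pow (pverts H) - {{}}" if x: "x \<in> pverts G" for x
  proof -
    have px: "p x \<in> vertex_simplex (pverts H)" using R x by auto
    then have sub: "\<eta> x \<subseteq> pverts H" using x by (auto simp: \<eta>_def vertex_simplex_def)
    have "sum (p x) (pverts H) = sum (p x) (\<eta> x)"
      using sub fin x by (intro sum.mono_neutral_right) (auto simp: \<eta>_def)
    then have "sum (p x) (\<eta> x) = 1" using px by (simp add: vertex_simplex_def)
    then show "p x \<in> vertex_simplex (\<eta> x)" using px x by (simp add: vertex_simplex_def \<eta>_def)
    have "\<eta> x \<noteq> {}" using \<open>sum (p x) (\<eta> x) = 1\<close> by auto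
    then show "\<eta> x \<in> Pow (pverts H) - {{}}" using sub by auto
  qed
  have "\<eta> \<in> hom_cells G H"
    using simp(2) R arcs by (fastforce simp: hom_cells_def \<eta>_def)
  moreover have "p \<in> closed_cell G \<eta>" using simp R by (auto simp: closed_cell_def)
  ultimately show ?L by blast
qed

section \<open>The lifting\<close>

text \<open>\<open>edge_point n c\<close> runs through the closed walk \<open>c, c - 2, c - 4, \<dots>\<close> in \<open>\<int>\<^sub>n\<close>, whose consecutive
  members span the one-dimensional simplices that occur in the cells.\<close>

definition edge_point :: "int \<Rightarrow> int \<Rightarrow> real \<Rightarrow> int \<Rightarrow> real" where
  "edge_point n c y v = interp (\<lambda>j. of_bool (v = rep n (c - 2 * j))) y"

definition lifts :: "int \<Rightarrow> int \<Rightarrow> (int \<Rightarrow> real) set" where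
  "lifts m r = {q. \<forall>i. 0 \<le> q (i + 1) - q i \<and> q (i + 1) - q i \<le> 1 \<and>
     (q i \<in> \<int> \<or> q (i + 1) \<in> \<int>) \<and> q (i + m) = q i + of_int r}"

text \<open>Coordinate \<open>x\<close> is read against the walk starting at \<open>c + x\<close>. A
  constant \<open>q\<close> then describes steps by 1, while a rise of \<open>q\<close> by 1 between
  \<open>x\<close> and \<open>x + 1\<close> turns that step into -1, that is, makes \<open>x\<close>
  a returning point.\<close>

definition project :: "int \<Rightarrow> int \<Rightarrow> int \<Rightarrow> (int \<Rightarrow> real) \<Rightarrow> int \<Rightarrow> int \<Rightarrow> real" where
  "project m n c q x v = (if x \<in> {1..m} then edge_point n (c + x) (q x) v else 0)"

definition strand :: "int \<Rightarrow> int \<Rightarrow> int \<Rightarrow> int \<Rightarrow> (int \<Rightarrow> int \<Rightarrow> real) set" where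
  "strand m n c r = project m n c ` lifts m r"

text \<open>Modulo \<open>n\<close>, the walk from \<open>c'\<close> reaches \<open>c\<close> after
  \<open>d\<close> steps. This is the source of the ambiguity of lifts.\<close>

lemma edge_point_cong:
  assumes "1 \<le> n" "n dvd c' - c - 2 * d"
  shows "edge_point n c' (y + of_int d) = edge_point n c y"
proof -
  have "rep n (c' - 2 * (j + d)) = rep n (c - 2 * j)" for j
    using assms by (simp add: rep_eq_iff algebra_simps)
  then show ?thesis
    unfolding edge_point_def interp_shift by simp
qed

lemma edge_point_frac:
  "edge_point n c y = (\<lambda>v. (1 - frac y) * of_bool (v = rep n (c - 2 * \<lfloor>y\<rfloor>)) +
     frac y * of_bool (v = rep n (c - 2 * \<lfloor>y\<rfloor> - 2)))"
  by (rule ext) (simp add: edge_point_def interp_def algebra_simps)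

lemma edge_point_of_int: "edge_point n c (of_int j) = (\<lambda>v. of_bool (v = rep n (c - 2 * j)))"
  by (rule ext) (simp add: edge_point_def)

lemma edge_point_simplex:
  assumes "1 \<le> n"
  shows "edge_point n c y \<in> vertex_simplex {1..n}"
proof -
  have f: "0 \<le> frac y" "0 \<le> 1 - frac y" using frac_lt_1[of y] by auto
  let ?a = "rep n (c - 2 * \<lfloor>y\<rfloor>)" and ?b = "rep n (c - 2 * \<lfloor>y\<rfloor> - 2)"
  have ab: "?a \<in> {1..n}" "?b \<in> {1..n}" using assms by (simp_all only: rep_range)
  have "(\<Sum>v\<in>{1..n}. (1 - frac y) * of_bool (v = ?a) + frac y * of_bool (v = ?b)) = 1"
    using ab by (simp add: sum.distrib sum_distrib_left[symmetric] of_bool_def sum.delta)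
  then show ?thesis
    unfolding vertex_simplex_def edge_point_frac using ab f by auto
qed

text \<open>The barycentric coordinates reveal the position on the walk unless an edge could also be
  traversed backwards; exchanging its two ends would give \<open>n dvd 4\<close>.\<close>

lemma edge_point_inj:
  assumes n: "3 \<le> n" "n \<noteq> 4" and eq: "edge_point n c y = edge_point n c' y'"
  obtains d where "y' = y + of_int d" "n dvd c' - c - 2 * d"
proof -
  define a b a' b' where "a = rep n (c - 2 * \<lfloor>y\<rfloor>)" and "b = rep n (c - 2 * \<lfloor>y\<rfloor> - 2)"
    and "a' = rep n (c' - 2 * \<lfloor>y'\<rfloor>)" and "b' = rep n (c' - 2 * \<lfloor>y'\<rfloor> - 2)"
  have n1: "1 \<le> n" using n by simp
  have n2: "\<not> n dvd 2" "\<not> n dvd 4"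
    using two_dvd_small[OF n, of 1] two_dvd_small[OF n, of 2] by auto
  have ne: "a \<noteq> b" "a' \<noteq> b'"
    using n2 by (auto simp: a_def b_def a'_def b'_def rep_eq_iff[OF n1])
  have no_swap: "\<not> (a = b' \<and> b = a')"
  proof
    assume "a = b' \<and> b = a'"
    then have "n dvd (c - 2 * \<lfloor>y\<rfloor>) - (c' - 2 * \<lfloor>y'\<rfloor> - 2)" "n dvd (c - 2 * \<lfloor>y\<rfloor> - 2) - (c' - 2 * \<lfloor>y'\<rfloor>)"
      by (simp_all add: a_def b_def a'_def b'_def rep_eq_iff[OF n1])
    from dvd_diff[OF this] show False using n2 by simp
  qed
  define t t' where "t = frac y" and "t' = frac y'"
  have t: "0 \<le> t" "t < 1" "0 \<le> t'" "t' < 1" by (simp_all add: t_def t'_def frac_lt_1)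
  have ev: "(1 - t) * of_bool (v = a) + t * of_bool (v = b) = (1 - t') * of_bool (v = a') + t' * of_bool (v = b')" for v
    using fun_cong[OF eq, of v] unfolding edge_point_frac a_def b_def a'_def b'_def t_def t'_def .
  \<comment> \<open>As \<open>frac\<close> is less than 1, the weight \<open>1 - t\<close> at
    \<open>a\<close> is positive, so \<open>a\<close> must occur in the other support, as
    \<open>a'\<close> or as \<open>b'\<close>; likewise for \<open>a'\<close>. If both primed
    alternatives fail, the ends are exchanged.\<close>
  have "a = a'"
  proof (rule ccontr)
    assume aa: "a \<noteq> a'"
    with ev[of a] ne(1) have "1 - t = t' * of_bool (a = b')" by simp
    then have "a = b'" using t by (cases "a = b'") auto
    moreover from ev[of a'] ne(2) aa have "1 - t' = t * of_bool (a' = b)" by auto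
    then have "a' = b" using t by (cases "a' = b") auto
    ultimately show False using no_swap by simp
  qed
  with ev[of a] ne have main: "a = a' \<and> t = t'" by auto
  define d where "d = \<lfloor>y'\<rfloor> - \<lfloor>y\<rfloor>"
  have "y' = y + of_int d" using main by (simp add: t_def t'_def d_def frac_def)
  moreover have "n dvd (c' - 2 * \<lfloor>y'\<rfloor>) - (c - 2 * \<lfloor>y\<rfloor>)"
    using main by (metis a_def a'_def rep_eq_iff[OF n1])
  then have "n dvd c' - c - 2 * d" by (simp add: d_def algebra_simps)
  ultimately show thesis by (rule that)
qed

text \<open>A vertex in the support at position \<open>y\<close> has an index \<open>j\<close> at
  distance less than 1 from \<open>y\<close>, and similarly \<open>k\<close> for \<open>y'\<close>.
  With \<open>y\<close> or \<open>y'\<close> an integer this leaves only \<open>k = j\<close> and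
  \<open>k = j + 1\<close>, which are the steps 1 and -1 from \<open>u\<close> to
  \<open>v\<close>.\<close>

lemma edge_point_adjacent:
  assumes n: "1 \<le> n" and q: "0 \<le> y' - y" "y' - y \<le> 1" "y \<in> \<int> \<or> y' \<in> \<int>"
    and u: "edge_point n c y u \<noteq> 0" and v: "edge_point n (c + 1) y' v \<noteq> 0"
  shows "(u, v) \<in> parcs (cycle_graph n)"
proof -
  obtain j where j: "u = rep n (c - 2 * j)" "\<bar>of_int j - y\<bar> < 1"
  proof (cases "u = rep n (c - 2 * \<lfloor>y\<rfloor>)")
    case True then show thesis by (rule that) linarith
  next
    case False
    then have *: "frac y \<noteq> 0" "u = rep n (c - 2 * (\<lfloor>y\<rfloor> + 1))" using u by (auto simp: edge_point_frac algebra_simps)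
    show thesis by (rule that[OF *(2)]) (use *(1) in \<open>simp add: frac_def; linarith\<close>)
  qed
  obtain k where k: "v = rep n (c + 1 - 2 * k)" "\<bar>of_int k - y'\<bar> < 1"
  proof (cases "v = rep n (c + 1 - 2 * \<lfloor>y'\<rfloor>)")
    case True then show thesis by (rule that) linarith
  next
    case False
    then have *: "frac y' \<noteq> 0" "v = rep n (c + 1 - 2 * (\<lfloor>y'\<rfloor> + 1))" using v by (auto simp: edge_point_frac algebra_simps)
    show thesis by (rule that[OF *(2)]) (use *(1) in \<open>simp add: frac_def; linarith\<close>)
  qed
  have "k = j \<or> k = j + 1"
    using q(3)
  proof
    assume "y \<in> \<int>"
    then obtain i where i: "y = of_int i" by (auto elim: Ints_cases)
    then have "i = j" using j(2) by linarith
    then have "j \<le> k" "k \<le> j + 1" using i k(2) q(1,2) by linarith+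
    then show ?thesis by auto
  next
    assume "y' \<in> \<int>"
    then obtain i where i: "y' = of_int i" by (auto elim: Ints_cases)
    then have "i = k" using k(2) by linarith
    then have "j \<le> k" "k \<le> j + 1" using i j(2) q(1,2) by linarith+
    then show ?thesis by auto
  qed
  then have "n dvd v - u - 1 \<or> n dvd u - v - 1"
  proof
    have eqs: "n dvd v - (c + 1 - 2 * k)" "n dvd u - (c - 2 * j)"
      using rep_cong[OF n] by (auto simp: j(1) k(1) cong_iff_dvd_diff)
    { assume "k = j"
      then show ?thesis using dvd_diff[OF eqs] by (simp add: algebra_simps) }
    { assume "k = j + 1"
      then show ?thesis using dvd_diff[OF eqs(2,1)] by (simp add: algebra_simps) }
  qed
  then show ?thesis
    using rep_range[OF n] by (auto simp: parcs_cycle_iff[OF n] j(1) k(1))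
qed

lemma simplex_two_points:
  fixes a b n :: int
  assumes w: "w \<in> vertex_simplex {1..n}" and supp: "\<And>v. w v \<noteq> 0 \<Longrightarrow> v = a \<or> v = b"
    and ab: "a \<noteq> b" "a \<in> {1..n}" "b \<in> {1..n}"
  shows "w = (\<lambda>v. (1 - w b) * of_bool (v = a) + w b * of_bool (v = b))" "w b \<in> {0..1}"
proof -
  have "sum w {1..n} = sum w {a, b}"
    using ab supp by (intro sum.mono_neutral_right) auto
  then have *: "w a + w b = 1" using w ab by (simp add: vertex_simplex_def)
  then show "w = (\<lambda>v. (1 - w b) * of_bool (v = a) + w b * of_bool (v = b))"
    using supp ab by (auto simp: fun_eq_iff)
  show "w b \<in> {0..1}" using * w by (auto simp: vertex_simplex_def) (smt (verit))
qed

lemma edge_point_between: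
  assumes n: "3 \<le> n" and w: "w \<in> vertex_simplex {1..n}"
    and supp: "\<And>v. w v \<noteq> 0 \<Longrightarrow> n dvd v - (c - 2 * j) \<or> n dvd v - (c - 2 * j - 2)"
  obtains q where "w = edge_point n c q" "of_int j \<le> q" "q \<le> of_int j + 1"
proof -
  have n1: "1 \<le> n" using n by simp
  define a b where "a = rep n (c - 2 * j)" and "b = rep n (c - 2 * j - 2)"
  have "a \<noteq> b" using n by (auto simp: a_def b_def rep_eq_iff zdvd_imp_le dest: zdvd_imp_le)
  moreover have ab: "a \<in> {1..n}" "b \<in> {1..n}" unfolding a_def b_def by (rule rep_range[OF n1])+
  moreover have "v = a \<or> v = b" if "w v \<noteq> 0" for v
  proof -
    have "v \<in> {1..n}" using w that by (auto simp: vertex_simplex_def)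
    then show ?thesis using supp[OF that] by (simp add: a_def b_def rep_eq_self_iff[OF n1])
  qed
  ultimately have *: "w = (\<lambda>v. (1 - w b) * of_bool (v = a) + w b * of_bool (v = b))" "w b \<in> {0..1}"
    using simplex_two_points[OF w] by blast+
  show thesis
  proof
    show "w = edge_point n c (of_int j + w b)"
    proof
      fix v
      have "edge_point n c (of_int j + w b) v = (1 - w b) * of_bool (v = a) + w b * of_bool (v = b)"
        unfolding edge_point_def using *(2)
        by (subst interp_unit[of j]) (auto simp: a_def b_def algebra_simps)
      then show "w v = edge_point n c (of_int j + w b) v" using *(1) by metis
    qed
  qed (use *(2) in auto)
qed

text \<open>If \<open>y\<close> is an integer, \<open>w\<close> is supported on the two neighbours
  of a single vertex, which are consecutive on the walk from \<open>c + 1\<close>. Otherwise the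
  support of \<open>w\<close> is adjacent to both ends of an edge; the common neighbour is unique
  because \<open>n\<close> does not divide 4, and \<open>y'\<close> is the next integer above
  \<open>y\<close>.\<close>

lemma edge_point_lift_step:
  assumes n: "3 \<le> n" "n \<noteq> 4" and w: "w \<in> vertex_simplex {1..n}"
    and adj: "\<And>u v. edge_point n c y u \<noteq> 0 \<Longrightarrow> w v \<noteq> 0 \<Longrightarrow> (u, v) \<in> parcs (cycle_graph n)"
  obtains y' where "w = edge_point n (c + 1) y'" "0 \<le> y' - y" "y' - y \<le> 1" "y \<in> \<int> \<or> y' \<in> \<int>"
proof (cases "y \<in> \<int>")
  case True
  then obtain j where j: "y = of_int j" by (auto elim: Ints_cases)
  have n1: "1 \<le> n" using n by simp
  define u where "u = rep n (c - 2 * j)"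
  have u: "n dvd u - (c - 2 * j)"
    using rep_cong[OF n1] by (auto simp: u_def cong_iff_dvd_diff)
  have "n dvd v - (c + 1 - 2 * j) \<or> n dvd v - (c + 1 - 2 * j - 2)" if "w v \<noteq> 0" for v
  proof -
    have "(u, v) \<in> parcs (cycle_graph n)" using adj[of u v] that by (simp add: j edge_point_of_int u_def)
    then have "n dvd v - u - 1 \<or> n dvd u - v - 1" by (simp add: parcs_cycle_iff[OF n1])
    then show ?thesis
    proof
      assume "n dvd v - u - 1"
      from dvd_add[OF this u] show ?thesis by (simp add: algebra_simps)
    next
      assume "n dvd u - v - 1"
      from dvd_diff[OF u this] show ?thesis by (simp add: algebra_simps)
    qed
  qed
  from edge_point_between[OF n(1) w this] obtain y' where
    "w = edge_point n (c + 1) y'" "of_int j \<le> y'" "y' \<le> of_int j + 1" by blast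
  then show thesis using that[of y'] j by auto
next
  case False
  have n1: "1 \<le> n" using n by simp
  define j where "j = \<lfloor>y\<rfloor>"
  have fr: "0 < frac y" "frac y < 1" using False by (simp_all add: frac_lt_1)
  define u u' where "u = rep n (c - 2 * j)" and "u' = rep n (c - 2 * j - 2)"
  have dv: "n dvd u - (c - 2 * j)" "n dvd u' - (c - 2 * j - 2)"
    using rep_cong[OF n1] by (auto simp: u_def u'_def cong_iff_dvd_diff)
  have n4: "\<not> n dvd 4" using two_dvd_small[OF n, of 2] by auto
  have pos: "edge_point n c y u \<noteq> 0" "edge_point n c y u' \<noteq> 0"
    using fr by (auto simp: edge_point_frac u_def u'_def j_def)
  have supp: "v = rep n (c + 1 - 2 * (j + 1))" if v: "w v \<noteq> 0" for v
  proof -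
    have "(u, v) \<in> parcs (cycle_graph n)" "(u', v) \<in> parcs (cycle_graph n)"
      using adj pos v by auto
    then have *: "v \<in> {1..n}" "n dvd v - u - 1 \<or> n dvd u - v - 1" "n dvd v - u' - 1 \<or> n dvd u' - v - 1"
      by (simp_all add: parcs_cycle_iff[OF n1])
    have "n dvd v - (c - 2 * j - 1)"
    proof (cases "n dvd u - v - 1")
      case True
      from dvd_diff[OF dv(1) True] show ?thesis by (simp add: algebra_simps)
    next
      case False
      then have 1: "n dvd v - u - 1" using * by simp
      show ?thesis
      proof (cases "n dvd v - u' - 1")
        case True
        from dvd_add[OF True dv(2)] show ?thesis by (simp add: algebra_simps)
      next
        case False
        then have 2: "n dvd u' - v - 1" using * by simp
        from dvd_add[OF dvd_add[OF 1 dv(1)] dvd_diff[OF 2 dv(2)]] have "n dvd 4" by simp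
        then show ?thesis using n4 by simp
      qed
    qed
    then show ?thesis using rep_eq_self_iff[OF n1 *(1)] by (simp add: algebra_simps)
  qed
  define z where "z = rep n (c + 1 - 2 * (j + 1))"
  have z: "z \<in> {1..n}" unfolding z_def by (rule rep_range[OF n1])
  have "sum w {1..n} = sum w {z}"
    using z supp by (intro sum.mono_neutral_right) (auto simp: z_def)
  then have "w z = 1" using w by (simp add: vertex_simplex_def)
  then have "w = edge_point n (c + 1) (of_int (j + 1))"
    using supp unfolding edge_point_of_int by (fastforce simp: fun_eq_iff z_def)
  then show thesis
    by (rule that) (use fr in \<open>auto simp: j_def frac_def\<close>)
qed

section \<open>The lattice of lifts\<close>

lemma liftsD:
  assumes "q \<in> lifts m r"
  shows "0 \<le> q (i + 1) - q i" "q (i + 1) - q i \<le> 1" "q i \<in> \<int> \<or> q (i + 1) \<in> \<int>"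
    "q (i + m) = q i + of_int r"
  using assms by (auto simp: lifts_def)

lemma lifts_period: "q \<in> lifts m r \<Longrightarrow> q (i + m * k) = q i + of_int (r * k)"
proof (induction k rule: int_induct[where k = 0])
  case (step1 k)
  then show ?case using liftsD(4)[of q m r "i + m * k"] by (simp add: algebra_simps)
next
  case (step2 k)
  then show ?case using liftsD(4)[of q m r "i + m * (k - 1)"] by (simp add: algebra_simps)
qed simp

lemma lifts_bounds:
  assumes "q \<in> lifts m r" "i \<le> j"
  shows "q i \<le> q j" "q j \<le> q i + of_int (j - i)"
proof -
  have "q i \<le> q j \<and> q j \<le> q i + of_int (j - i)"
    using assms(2)
  proof (induction j rule: int_ge_induct)
    case (step j)
    then show ?case using liftsD(1,2)[OF assms(1), of j] by simp
  qed simp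
  then show "q i \<le> q j" "q j \<le> q i + of_int (j - i)" by auto
qed

lemma lifts_rotation_bounds:
  assumes "q \<in> lifts m r" "0 \<le> m"
  shows "0 \<le> r" "r \<le> m"
  using lifts_bounds[OF assms(1), of 0 m] liftsD(4)[OF assms(1), of 0] assms(2) by auto

lemma lifts_add: "q \<in> lifts m r \<Longrightarrow> (\<lambda>i. q i + of_int d) \<in> lifts m r"
  by (auto simp: lifts_def)

text \<open>Otherwise \<open>x < x' \<le> y' < y \<le> x + 1\<close>. One of \<open>x'\<close> and
  \<open>y'\<close> is then an integer strictly between \<open>x\<close> and \<open>y\<close>, which
  is impossible in an interval of length at most 1 with an integer end.\<close>

lemma lattice_step:
  fixes x y x' y' :: real
  assumes "0 \<le> y - x" "y - x \<le> 1" "x \<in> \<int> \<or> y \<in> \<int>"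
    and "0 \<le> y' - x'" "y' - x' \<le> 1" "x' \<in> \<int> \<or> y' \<in> \<int>" and "x < x'"
  shows "y \<le> y'"
proof (rule ccontr)
  assume "\<not> y \<le> y'"
  then have lt: "x < x'" "x' \<le> y'" "y' < y" "y \<le> x + 1" using assms by auto
  obtain k where k: "x \<le> of_int k" "of_int k \<le> y" "of_int k = x \<or> of_int k = y"
    using assms by (auto elim!: Ints_cases)
  have "x < x' \<and> x' < y" "x < y' \<and> y' < y" using lt by auto
  with assms(6) obtain l where l: "x < of_int l" "of_int l < y"
    by (metis Ints_cases)
  show False using k(3)
  proof
    assume "of_int k = x"
    then have "k < l" "l < k + 1" using l lt(4) by linarith+
    then show False by simp
  next
    assume "of_int k = y"
    then have "l < k" "k < l + 1" using l lt(4) by linarith+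
    then show False by simp
  qed
qed

text \<open>The pairs \<open>(q i, q (i + 1))\<close> that can occur form a chain in the plane, so the minimum
  of two such pairs is one of them.\<close>

lemma lifts_min_max:
  assumes p: "p \<in> lifts m r" and q: "q \<in> lifts m r"
  shows "(\<lambda>i. min (p i) (q i)) \<in> lifts m r" "(\<lambda>i. max (p i) (q i)) \<in> lifts m r"
proof -
  have "(p i \<le> q i \<and> p (i + 1) \<le> q (i + 1)) \<or> (q i \<le> p i \<and> q (i + 1) \<le> p (i + 1))" for i
    using lattice_step[OF liftsD(1-3)[OF p, of i] liftsD(1-3)[OF q, of i]]
      lattice_step[OF liftsD(1-3)[OF q, of i] liftsD(1-3)[OF p, of i]] by linarith
  then have *: "(min (p i) (q i) = p i \<and> min (p (i + 1)) (q (i + 1)) = p (i + 1) \<and>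
       max (p i) (q i) = q i \<and> max (p (i + 1)) (q (i + 1)) = q (i + 1)) \<or>
      (min (p i) (q i) = q i \<and> min (p (i + 1)) (q (i + 1)) = q (i + 1) \<and>
       max (p i) (q i) = p i \<and> max (p (i + 1)) (q (i + 1)) = p (i + 1))" for i
    by (metis max_absorb1 max_absorb2 min_absorb1 min_absorb2)
  have "0 \<le> min (p (i + 1)) (q (i + 1)) - min (p i) (q i) \<and> min (p (i + 1)) (q (i + 1)) - min (p i) (q i) \<le> 1 \<and>
     (min (p i) (q i) \<in> \<int> \<or> min (p (i + 1)) (q (i + 1)) \<in> \<int>) \<and> min (p (i + m)) (q (i + m)) = min (p i) (q i) + of_int r" for i
    using *[of i] liftsD[OF p, of i] liftsD[OF q, of i] by auto
  then show "(\<lambda>i. min (p i) (q i)) \<in> lifts m r" unfolding lifts_def by blast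
  have "0 \<le> max (p (i + 1)) (q (i + 1)) - max (p i) (q i) \<and> max (p (i + 1)) (q (i + 1)) - max (p i) (q i) \<le> 1 \<and>
     (max (p i) (q i) \<in> \<int> \<or> max (p (i + 1)) (q (i + 1)) \<in> \<int>) \<and> max (p (i + m)) (q (i + m)) = max (p i) (q i) + of_int r" for i
    using *[of i] liftsD[OF p, of i] liftsD[OF q, of i] by auto
  then show "(\<lambda>i. max (p i) (q i)) \<in> lifts m r" unfolding lifts_def by blast
qed

text \<open>One turn around the source cycle adds \<open>m\<close> to the offset and
  \<open>r\<close> to the lift; the two effects cancel because \<open>n dvd m - 2 * r\<close>. This
  is the closing condition for a lift with rotation number \<open>r\<close>.\<close>

lemma project_rep:
  assumes mn: "1 \<le> m" "1 \<le> n" and q: "q \<in> lifts m r" and r: "n dvd m - 2 * r"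
  shows "project m n c q (rep m i) = edge_point n (c + i) (q i)"
proof -
  obtain k where k: "i - rep m i = m * k"
    using rep_cong[OF mn(1), of i] by (metis cong_iff_dvd_diff cong_sym dvd_def)
  then have i: "i = rep m i + m * k" by simp
  have "n dvd (c + i) - (c + rep m i) - 2 * (r * k)"
    using r by (simp add: k) (metis dvd_mult2 left_diff_distrib' mult.assoc)
  from edge_point_cong[OF mn(2) this, of "q (rep m i)"]
  have "edge_point n (c + i) (q i) = edge_point n (c + rep m i) (q (rep m i))"
    using lifts_period[OF q, of "rep m i" k] i by simp
  then show ?thesis using rep_range[OF mn(1), of i] by (simp add: project_def fun_eq_iff)
qed

section \<open>Existence and uniqueness of lifts of points\<close>

lemma Hom_cycles_point_iff:
  assumes mn: "1 \<le> m" "1 \<le> n"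
  shows "p \<in> topspace (Hom_cycles m n) \<longleftrightarrow>
    (\<forall>x \<in> {1..m}. p x \<in> vertex_simplex {1..n}) \<and> (\<forall>x. x \<notin> {1..m} \<longrightarrow> p x = (\<lambda>_. 0)) \<and>
    (\<forall>x \<in> {1..m}. \<forall>u v. p x u \<noteq> 0 \<longrightarrow> p (rep m (x + 1)) v \<noteq> 0 \<longrightarrow> (u, v) \<in> parcs (cycle_graph n))"
proof -
  have V: "pverts (cycle_graph k) = {1..k}" for k by (simp add: cycle_graph_def)
  have arcs: "parcs (cycle_graph m) \<subseteq> pverts (cycle_graph m) \<times> pverts (cycle_graph m)"
    using parcs_cycle_iff[OF mn(1)] by (auto simp: V)
  have sym: "(u, v) \<in> parcs (cycle_graph n) \<longleftrightarrow> (v, u) \<in> parcs (cycle_graph n)" for u v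
    using parcs_cycle_iff[OF mn(2)] by auto
  have "(\<forall>(x, y) \<in> parcs (cycle_graph m). \<forall>u v. p x u \<noteq> 0 \<longrightarrow> p y v \<noteq> 0 \<longrightarrow> (u, v) \<in> parcs (cycle_graph n)) \<longleftrightarrow>
    (\<forall>x \<in> {1..m}. \<forall>u v. p x u \<noteq> 0 \<longrightarrow> p (rep m (x + 1)) v \<noteq> 0 \<longrightarrow> (u, v) \<in> parcs (cycle_graph n))" (is "?L \<longleftrightarrow> ?R")
  proof
    assume L: ?L
    have "(x, rep m (x + 1)) \<in> parcs (cycle_graph m)" if "x \<in> {1..m}" for x
      using that by (auto simp: cycle_graph_def)
    with L show ?R by blast
  next
    assume R: ?R
    show ?L
    proof clarify
      fix x y u v assume xy: "(x, y) \<in> parcs (cycle_graph m)" and uv: "p x u \<noteq> 0" "p y v \<noteq> 0"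
      from xy consider "x \<in> {1..m}" "y = rep m (x + 1)" | "y \<in> {1..m}" "x = rep m (y + 1)"
        by (auto simp: cycle_graph_def)
      then show "(u, v) \<in> parcs (cycle_graph n)"
        using R uv sym by cases blast+
    qed
  qed
  then show ?thesis
    unfolding hom_complex_def topspace_euclidean_subtopology
    by (subst hom_complex_point_iff[OF _ arcs]) (simp_all add: V)
qed

lemma strand_subset:
  assumes mn: "1 \<le> m" "1 \<le> n" and r: "n dvd m - 2 * r"
  shows "strand m n c r \<subseteq> topspace (Hom_cycles m n)"
proof
  fix p assume "p \<in> strand m n c r"
  then obtain q where q: "q \<in> lifts m r" "p = project m n c q" by (auto simp: strand_def)
  have P: "p (rep m i) = edge_point n (c + i) (q i)" for i
    using project_rep[OF mn q(1) r] q(2) by simp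
  have Px: "p x = edge_point n (c + x) (q x)" if "x \<in> {1..m}" for x
    using P[of x] rep_ident[OF that] by simp
  show "p \<in> topspace (Hom_cycles m n)"
    unfolding Hom_cycles_point_iff[OF mn]
  proof (intro conjI ballI allI impI)
    fix x u v assume "x \<in> {1..m}" "p x u \<noteq> 0" "p (rep m (x + 1)) v \<noteq> 0"
    then show "(u, v) \<in> parcs (cycle_graph n)"
      using edge_point_adjacent[OF mn(2) liftsD(1-3)[OF q(1), of x], of "c + x" u v]
      by (simp add: P Px add.assoc)
  next
    show "p x \<in> vertex_simplex {1..n}" if "x \<in> {1..m}" for x
      unfolding Px[OF that] by (rule edge_point_simplex[OF mn(2)])
    show "p x = (\<lambda>_. 0)" if "x \<notin> {1..m}" for x
      using that by (auto simp: q(2) project_def)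
  qed
qed

lemma strand_eq:
  assumes "1 \<le> n" "n dvd c' - c - 2 * d"
  shows "strand m n c' r = strand m n c r"
proof -
  have "edge_point n (c' + x) (q x + of_int d) = edge_point n (c + x) (q x)" for q and x :: int
    using assms(2) by (intro edge_point_cong[OF assms(1)]) (simp add: algebra_simps)
  then have proj: "project m n c' (\<lambda>i. q i + of_int d) = project m n c q" for q
    by (intro ext) (simp add: project_def)
  have "(\<lambda>q i. q i + of_int d) ` lifts m r = lifts m r"
  proof (intro equalityI subsetI)
    fix q assume q: "q \<in> lifts m r"
    have "(\<lambda>i. q i + of_int (- d)) \<in> lifts m r" using lifts_add[OF q] .
    then show "q \<in> (\<lambda>q i. q i + of_int d) ` lifts m r" by (rule rev_image_eqI) auto
  qed (use lifts_add in auto)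
  then have "strand m n c' r = (\<lambda>q. project m n c' (\<lambda>i. q i + of_int d)) ` lifts m r"
    unfolding strand_def by (metis image_image)
  then show ?thesis using proj by (simp add: strand_def)
qed

text \<open>Each coordinate determines the lift up to an integer \<open>D i\<close>. Consecutive
  \<open>D i\<close> are congruent after doubling and differ little, as all increments lie in
  \<open>[0, 1]\<close>; by \<open>two_dvd_small\<close> they agree, so the two lifts differ by one
  global translation.\<close>

lemma project_eq_imp:
  assumes m: "1 \<le> m" and n: "3 \<le> n" "n \<noteq> 4" and q: "q \<in> lifts m r" "q' \<in> lifts m r'"
    and r: "n dvd m - 2 * r" "n dvd m - 2 * r'" and eq: "project m n c q = project m n c' q'"
  obtains d where "q' = (\<lambda>i. q i + of_int d)" "n dvd c' - c - 2 * d" "r' = r"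
proof -
  have n1: "1 \<le> n" using n by simp
  have "\<exists>d. q' i = q i + of_int d \<and> n dvd c' - c - 2 * d" for i
  proof -
    have "edge_point n (c + i) (q i) = edge_point n (c' + i) (q' i)"
      using project_rep[OF m n1 q(1) r(1)] project_rep[OF m n1 q(2) r(2)] eq by metis
    then show ?thesis using edge_point_inj[OF n] by (metis add_diff_cancel_right)
  qed
  then obtain D where D: "\<And>i. q' i = q i + of_int (D i)" "\<And>i. n dvd c' - c - 2 * D i" by metis
  have step: "D (i + 1) = D i" for i
  proof -
    have "n dvd 2 * (D (i + 1) - D i)" using dvd_diff[OF D(2)[of i] D(2)[of "i + 1"]] by (simp add: algebra_simps)
    moreover have "\<bar>D (i + 1) - D i\<bar> \<le> 2"
      using liftsD(1,2)[OF q(1), of i] liftsD(1,2)[OF q(2), of i] D(1)[of i] D(1)[of "i + 1"] by linarith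
    ultimately show ?thesis using two_dvd_small[OF n] by fastforce
  qed
  have const: "D i = D 0" for i
  proof (induction i rule: int_induct[where k = 0])
    case (step2 i) then show ?case using step[of "i - 1"] by simp
  qed (simp_all add: step)
  have "q' = (\<lambda>i. q i + of_int (D 0))" using D(1) const by metis
  moreover have "r' = r"
    using liftsD(4)[OF q(1), of 0] liftsD(4)[OF q(2), of 0] calculation by simp
  ultimately show thesis using that D(2) by blast
qed

lemma strand_disjoint:
  assumes m: "1 \<le> m" and n: "3 \<le> n" "n \<noteq> 4"
    and r: "n dvd m - 2 * r" "n dvd m - 2 * r'" and ne: "strand m n c r \<inter> strand m n c' r' \<noteq> {}"
  shows "r' = r" "\<exists>d. n dvd c' - c - 2 * d"
proof -
  obtain q q' where "q \<in> lifts m r" "q' \<in> lifts m r'" "project m n c q = project m n c' q'"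
    using ne by (auto simp: strand_def)
  from project_eq_imp[OF m n this(1,2) r this(3)]
  show "r' = r" "\<exists>d. n dvd c' - c - 2 * d" by blast+
qed

text \<open>The point is lifted coordinate by coordinate once around the cycle; the mismatch between
  the final and the initial position is the rotation number, and periodicity extends the lift to all
  integers.\<close>

lemma Hom_cycles_lift:
  assumes m: "1 \<le> m" and n: "3 \<le> n" "n \<noteq> 4" and p: "p \<in> topspace (Hom_cycles m n)"
  obtains c r where "n dvd m - 2 * r" "p \<in> strand m n c r"
proof -
  have n1: "1 \<le> n" using n by simp
  note pt = p[unfolded Hom_cycles_point_iff[OF m n1]]
  define P where "P i = p (rep m i)" for i
  have simplex: "P i \<in> vertex_simplex {1..n}" for i
    using pt rep_range[OF m] by (auto simp: P_def)
  have rep_step: "rep m (rep m i + 1) = rep m (i + 1)" for i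
    using rep_cong[OF m, of i] by (simp add: rep_eq_iff[OF m] cong_iff_dvd_diff)
  have adj: "(u, v) \<in> parcs (cycle_graph n)" if "P i u \<noteq> 0" "P (i + 1) v \<noteq> 0" for i u v
    using pt rep_range[OF m, of i] rep_step[of i] that unfolding P_def by metis
  obtain c where "\<exists>y. P 1 = edge_point n (c + 1) y"
  proof -
    \<comment> \<open>The support of coordinate 1 lies in \<open>{a + 1, a - 1}\<close> modulo
      \<open>n\<close>, the neighbours of any vertex \<open>a\<close> in the support of the
      preceding coordinate. Hence \<open>c = a\<close> is a valid offset.\<close>
    obtain a where a: "P 0 a \<noteq> 0"
      using simplex[of 0] by (force simp: vertex_simplex_def)
    have "n dvd v - (a + 1 - 2 * 0) \<or> n dvd v - (a + 1 - 2 * 0 - 2)" if "P 1 v \<noteq> 0" for v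
      using adj[of 0 a v] a that by (auto simp: parcs_cycle_iff[OF n1] algebra_simps dvd_diff_commute)
    from edge_point_between[OF n(1) simplex this] show thesis using that by metis
  qed note c = this
  have "\<exists>Q. \<forall>k. P (int k + 1) = edge_point n (c + (int k + 1)) (Q k) \<and>
    (0 \<le> Q (Suc k) - Q k \<and> Q (Suc k) - Q k \<le> 1 \<and> (Q k \<in> \<int> \<or> Q (Suc k) \<in> \<int>))"
  proof (rule dependent_nat_choice)
    show "\<exists>y. P (int 0 + 1) = edge_point n (c + (int 0 + 1)) y" using c by simp
    fix y k assume y: "P (int k + 1) = edge_point n (c + (int k + 1)) y"
    have "(u, v) \<in> parcs (cycle_graph n)"
      if "edge_point n (c + (int k + 1)) y u \<noteq> 0" "P (int (Suc k) + 1) v \<noteq> 0" for u v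
      using adj[of "int k + 1" u v] y that by (simp add: algebra_simps)
    from edge_point_lift_step[OF n simplex this] obtain y' where
      "P (int (Suc k) + 1) = edge_point n (c + (int k + 1) + 1) y'"
      "0 \<le> y' - y" "y' - y \<le> 1" "y \<in> \<int> \<or> y' \<in> \<int>" by blast
    moreover have "c + (int k + 1) + 1 = c + (int (Suc k) + 1)" by simp
    ultimately show "\<exists>y'. P (int (Suc k) + 1) = edge_point n (c + (int (Suc k) + 1)) y' \<and>
      (0 \<le> y' - y \<and> y' - y \<le> 1 \<and> (y \<in> \<int> \<or> y' \<in> \<int>))"
      by metis
  qed
  then obtain Q where Q: "\<And>k. P (int k + 1) = edge_point n (c + (int k + 1)) (Q k)"
    and Qs: "\<And>k. 0 \<le> Q (Suc k) - Q k" "\<And>k. Q (Suc k) - Q k \<le> 1" "\<And>k. Q k \<in> \<int> \<or> Q (Suc k) \<in> \<int>"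
    by blast
  define M where "M = nat m"
  have M: "int M = m" using m by (simp add: M_def)
  have "P (int M + 1) = P (int 0 + 1)"
    unfolding P_def by (intro arg_cong[where f = p]) (simp add: rep_eq_iff[OF m] M)
  then have "edge_point n (c + 1) (Q 0) = edge_point n (c + (m + 1)) (Q M)"
    using Q[of M] Q[of 0] M by simp
  \<comment> \<open>Both positions describe coordinate 1, so they differ by an integer
    \<open>r\<close>, and the shift of the offset by \<open>m\<close> yields the closing
    condition.\<close>
  from edge_point_inj[OF n this] obtain r
    where r: "Q M = Q 0 + of_int r" "n dvd (c + (m + 1)) - (c + 1) - 2 * r" by blast
  then have rn: "n dvd m - 2 * r" by simp
  \<comment> \<open>\<open>Q k\<close> belongs to coordinate \<open>k + 1\<close>, hence the
    division of \<open>i - 1\<close> rather than \<open>i\<close>: the remainder selects the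
    position within a turn, the quotient counts the turns.\<close>
  define q where "q i = Q (nat ((i - 1) mod m)) + of_int (r * ((i - 1) div m))" for i
  have "q \<in> lifts m r"
    unfolding lifts_def
  proof (intro CollectI allI)
    fix i
    have per: "q (i + m) = q i + of_int r"
    proof -
      have "(t + m) mod m = t mod m" "(t + m) div m = t div m + 1" for t
        using m by simp_all
      from this[of "i - 1"] show ?thesis by (simp add: q_def algebra_simps)
    qed
    define k where "k = nat ((i - 1) mod m)"
    have k: "int k = (i - 1) mod m" "k < M" using m by (simp_all add: k_def M_def)
    have "q (i + 1) = Q (Suc k) + of_int (r * ((i - 1) div m))"
    proof (cases "Suc k < M")
      case True
      have "i = (i - 1) div m * m + int (Suc k)" using k by (simp add: algebra_simps)
      moreover have "int (Suc k) < m" using True M by linarith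
      ultimately have "i div m = (i - 1) div m" "i mod m = int (Suc k)"
        by (metis add.commute div_pos_pos_trivial div_mult_self1 add.right_neutral of_nat_0_le_iff m not_one_le_zero add_0,
          metis mod_mult_self3 mod_pos_pos_trivial of_nat_0_le_iff)
      then show ?thesis by (simp add: q_def del: of_nat_Suc)
    next
      case False
      \<comment> \<open>At the seam the next index starts a new turn at \<open>Q 0\<close>, while
        the step estimates concern \<open>Q M\<close>; they match through
        \<open>Q M = Q 0 + of_int r\<close>.\<close>
      then have "int (Suc k) = m" using k M by simp
      define t where "t = (i - 1) div m"
      have "i - 1 = t * m + (m - 1)"
        using k(1) \<open>int (Suc k) = m\<close> div_mult_mod_eq[of "i - 1" m, folded t_def] by linarith
      then have "i = (t + 1) * m" by (simp add: algebra_simps)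
      then have "i div m = (i - 1) div m + 1" "i mod m = 0"
        unfolding t_def[symmetric] using m by simp_all
      moreover have "Suc k = M" using False k by simp
      ultimately show ?thesis using r(1) by (simp add: q_def algebra_simps)
    qed
    moreover have "q i = Q k + of_int (r * ((i - 1) div m))" by (simp add: q_def k_def)
    ultimately show "0 \<le> q (i + 1) - q i \<and> q (i + 1) - q i \<le> 1 \<and>
      (q i \<in> \<int> \<or> q (i + 1) \<in> \<int>) \<and> q (i + m) = q i + of_int r"
      using per Qs[of k] by (auto intro: Ints_add)
  qed
  moreover have "p = project m n c q"
  proof
    fix x
    show "p x = project m n c q x"
    proof (cases "x \<in> {1..m}")
      case True
      then have "P (int (nat (x - 1)) + 1) = p x" by (simp add: P_def rep_ident)
      moreover have "q x = Q (nat (x - 1))" using True by (simp add: q_def mod_pos_pos_trivial div_pos_pos_trivial)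
      ultimately show ?thesis using True Q[of "nat (x - 1)"] by (simp add: project_def fun_eq_iff)
    qed (use pt in \<open>auto simp: project_def\<close>)
  qed
  ultimately have "p \<in> strand m n c r" by (simp add: strand_def)
  with rn show thesis by (rule that)
qed

section \<open>Strands are circles\<close>

lemma continuous_on_project: "continuous_on UNIV (project m n c)"
proof (intro continuous_on_coordinatewise_then_product)
  fix x v
  show "continuous_on UNIV (\<lambda>q. project m n c q x v)"
    unfolding project_def edge_point_def
    by (cases "x \<in> {1..m}") (auto intro!: continuous_intros)
qed

lemma closed_lifts: "closed (lifts m r)"
proof -
  have Z: "closed {q :: int \<Rightarrow> real. q i \<in> \<int>}" for i
    using closed_vimage[OF closed_Ints, of "\<lambda>q :: int \<Rightarrow> real. q i"] by (simp add: vimage_def)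
  have "closed {q :: int \<Rightarrow> real. 0 \<le> q (i + 1) - q i \<and> q (i + 1) - q i \<le> 1 \<and>
     (q i \<in> \<int> \<or> q (i + 1) \<in> \<int>) \<and> q (i + m) = q i + of_int r}" for i
    by (intro closed_Collect_conj closed_Collect_disj closed_Collect_le closed_Collect_eq Z)
      (auto intro!: continuous_intros)
  then show ?thesis unfolding lifts_def by (intro closed_Collect_all)
qed

text \<open>Increments in \<open>[0, 1]\<close> keep \<open>q i\<close> within distance
  \<open>\<bar>i\<bar>\<close> of \<open>q 0\<close>, so the slice is a closed subset of a product
  of compact intervals.\<close>

lemma compact_lifts_slice: "compact {q \<in> lifts m r. q 0 \<in> {0..b}}"
proof -
  have "compactin (product_topology (\<lambda>i. euclidean) UNIV) (PiE UNIV (\<lambda>i::int. {- \<bar>of_int i\<bar> .. b + \<bar>of_int i\<bar> :: real}))"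
    by (subst compactin_PiE) auto
  then have "compact (PiE UNIV (\<lambda>i::int. {- \<bar>of_int i\<bar> .. b + \<bar>of_int i\<bar> :: real}))"
    by (simp add: euclidean_product_topology)
  moreover have "closed {q \<in> lifts m r. q 0 \<in> {0..b}}"
    unfolding Collect_conj_eq Collect_mem_eq atLeastAtMost_iff
    by (intro closed_Int closed_lifts closed_Collect_le) (auto intro!: continuous_intros)
  ultimately have "compact (PiE UNIV (\<lambda>i::int. {- \<bar>of_int i\<bar> .. b + \<bar>of_int i\<bar>}) \<inter> {q \<in> lifts m r. q 0 \<in> {0..b}})"
    by (rule compact_Int_closed)
  moreover have "q i \<in> {- \<bar>of_int i\<bar> .. b + \<bar>of_int i\<bar>}" if "q \<in> lifts m r" "q 0 \<in> {0..b}" for q i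
    using lifts_bounds[OF that(1), of 0 i] lifts_bounds[OF that(1), of i 0] that(2)
    by (cases "0 \<le> i") auto
  then have "{q \<in> lifts m r. q 0 \<in> {0..b}} \<subseteq> PiE UNIV (\<lambda>i::int. {- \<bar>of_int i\<bar> .. b + \<bar>of_int i\<bar>})"
    by blast
  ultimately show ?thesis by (simp only: Int_absorb1)
qed

text \<open>Sampling this staircase of slope \<open>1 / m\<close> at the points \<open>r i + x\<close> yields the curve of lifts
  onto which all lifts are contracted.\<close>

definition stairs :: "int \<Rightarrow> real \<Rightarrow> real" where
  "stairs m = interp (\<lambda>j. of_int (j div m))"

lemma interp_linear: "interp (\<lambda>j. of_int j / a) x = x / a"
proof -
  have "interp (\<lambda>j. of_int j / a) x = (of_int \<lfloor>x\<rfloor> + frac x) / a"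
  proof -
    have "interp (\<lambda>j. of_int j / a) x = ((1 - frac x) * of_int \<lfloor>x\<rfloor> + frac x * (of_int \<lfloor>x\<rfloor> + 1)) / a"
      unfolding interp_def by (simp add: add_divide_distrib[of "(1 - frac x) * _"])
    then show ?thesis by (simp add: algebra_simps)
  qed
  then show ?thesis by (simp add: frac_def)
qed

text \<open>At integers the deviation from slope \<open>1 / m\<close> is the rounding error of
  \<open>j div m\<close>, and interpolation preserves both its bounds and the linear
  function.\<close>

lemma stairs_bounds:
  assumes "0 < m"
  shows "x / of_int m - 1 \<le> stairs m x" "stairs m x \<le> x / of_int m"
proof -
  have "of_int (j div m) - of_int j / of_int m \<in> {- 1..0::real}" for j
    using floor_divide_of_int_eq[of j m, where ?'a = real] by simp linarith
  then have "interp (\<lambda>j. of_int (j div m) - of_int j / of_int m) x \<in> {- 1..0::real}"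
    by (rule interp_bounds)
  then have "stairs m x - x / of_int m \<in> {- 1..0}"
    unfolding interp_diff interp_linear stairs_def .
  then show "x / of_int m - 1 \<le> stairs m x" "stairs m x \<le> x / of_int m" by auto
qed

lemma stairs_period:
  assumes "0 < m"
  shows "stairs m (x + of_int (m * d)) = stairs m x + of_int d"
proof -
  have "(j + m * d) div m = j div m + d" for j using assms by simp
  then show ?thesis unfolding stairs_def interp_shift by (simp add: interp_add)
qed

text \<open>The staircase rises only over the unit intervals from \<open>k * m - 1\<close> to
  \<open>k * m\<close>. As \<open>0 < r < m\<close>, the points \<open>z\<close> and
  \<open>z + r\<close> cannot both be interior to such intervals, which gives the integrality;
  \<open>r < m\<close> also bounds the increment by 1.\<close>

lemma stairs_in_lifts:
  assumes r: "0 < r" "r < m"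
  shows "(\<lambda>i. stairs m (of_int (r * i) + x)) \<in> lifts m r"
  unfolding lifts_def
proof (intro CollectI allI)
  fix i
  define z where "z = of_int (r * i) + x"
  define j where "j = \<lfloor>z\<rfloor>"
  have next_z: "of_int (r * (i + 1)) + x = z + of_int r" by (simp add: z_def algebra_simps)
  have step: "of_int ((k + r) div m) - of_int (k div m) \<in> {0..1::real}" for k
  proof -
    have "k div m \<le> (k + r) div m" "(k + r) div m \<le> (k + m) div m"
      using r by (intro zdiv_mono1; simp)+
    moreover have "(k + m) div m = k div m + 1" using r by simp
    ultimately show ?thesis by (simp flip: of_int_diff)
  qed
  have "stairs m (z + of_int r) - stairs m z \<in> {0..1}"
    unfolding stairs_def interp_shift interp_diff[symmetric] by (intro interp_bounds step)
  moreover have "stairs m z \<in> \<int> \<or> stairs m (z + of_int r) \<in> \<int>"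
  proof -
    have flat: "stairs m w \<in> \<int>" if "(\<lfloor>w\<rfloor> + 1) div m = \<lfloor>w\<rfloor> div m" for w
      unfolding stairs_def interp_def that by (simp add: algebra_simps)
    define k s where "k = (j + 1) div m" and "s = (j + 1) mod m"
    have j1: "j + 1 = m * k + s" "0 \<le> s" "s < m" using r by (auto simp: k_def s_def)
    show ?thesis
    proof (cases "s = 0")
      case True
      have d: "(m * k + t) div m = k" if "0 \<le> t" "t < m" for t using that by simp
      have "j + r + 1 = m * k + r" "j + r = m * k + (r - 1)" using True j1(1) by simp_all
      moreover have "(m * k + r) div m = k" "(m * k + (r - 1)) div m = k" using r by (auto intro: d)
      ultimately have "(j + r + 1) div m = (j + r) div m" by metis
      then have "stairs m (z + of_int r) \<in> \<int>" by (intro flat) (simp add: j_def add.assoc)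
      then show ?thesis ..
    next
      case False
      have d: "(m * k + t) div m = k" if "0 \<le> t" "t < m" for t using that by simp
      have "j = m * k + (s - 1)" using j1(1) by simp
      moreover have "(m * k + s) div m = k" "(m * k + (s - 1)) div m = k" using j1 False by (auto intro: d)
      ultimately have "(j + 1) div m = j div m" using j1(1) by metis
      then have "stairs m z \<in> \<int>" by (intro flat) (simp add: j_def)
      then show ?thesis ..
    qed
  qed
  moreover have "stairs m (of_int (r * (i + m)) + x) = stairs m z + of_int r"
    using stairs_period[of m z r] r by (simp add: z_def algebra_simps)
  ultimately show "0 \<le> stairs m (of_int (r * (i + 1)) + x) - stairs m (of_int (r * i) + x) \<and>
    stairs m (of_int (r * (i + 1)) + x) - stairs m (of_int (r * i) + x) \<le> 1 \<and>
    (stairs m (of_int (r * i) + x) \<in> \<int> \<or> stairs m (of_int (r * (i + 1)) + x) \<in> \<int>) \<and>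
    stairs m (of_int (r * (i + m)) + x) = stairs m (of_int (r * i) + x) + of_int r"
    unfolding next_z z_def[symmetric] by auto
qed

section \<open>The circle as a quotient of the line\<close>

definition circle_map :: "real \<Rightarrow> real \<Rightarrow> nat \<Rightarrow> real" where
  "circle_map N y = (\<lambda>i. if i = 0 then cos (2 * pi * y / N) else if i = 1 then sin (2 * pi * y / N) else 0)"

lemma circle_map_eq_iff:
  assumes "0 < N"
  shows "circle_map N y = circle_map N z \<longleftrightarrow> (\<exists>k. y = z + N * of_int k)"
proof -
  have "circle_map N y = circle_map N z \<longleftrightarrow>
      sin (2 * pi * y / N) = sin (2 * pi * z / N) \<and> cos (2 * pi * y / N) = cos (2 * pi * z / N)"
    by (auto simp: circle_map_def fun_eq_iff dest: spec[of _ 0] spec[of _ 1])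
  also have "\<dots> \<longleftrightarrow> (\<exists>k::int. 2 * pi * y / N = 2 * pi * z / N + 2 * pi * k)"
    by (rule sin_cos_eq_iff)
  also have "\<dots> \<longleftrightarrow> (\<exists>k. y = z + N * of_int k)"
  proof -
    have "2 * pi * y / N = 2 * pi * z / N + 2 * pi * k \<longleftrightarrow> y = z + N * k" for k
    proof -
      have "2 * pi * y / N = 2 * pi * z / N + 2 * pi * k \<longleftrightarrow> (2 * pi) * y = (2 * pi) * (z + N * k)"
        using assms by (simp add: field_simps)
      then show ?thesis by simp
    qed
    then show ?thesis by simp
  qed
  finally show ?thesis .
qed

lemma continuous_on_circle_map: "continuous_on UNIV (circle_map N)"
proof (intro continuous_on_coordinatewise_then_product)
  show "continuous_on UNIV (\<lambda>y. circle_map N y i)" for i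
    unfolding circle_map_def divide_inverse
    by (cases "i = 0"; cases "i = 1") (auto intro!: continuous_intros)
qed

lemma nsphere_top_of_set: "nsphere k = top_of_set {x. (\<Sum>i\<le>k. x i ^ 2) = 1 \<and> (\<forall>i>k. x i = 0)}"
  by (simp add: nsphere euclidean_product_topology)

lemma circle_map_image:
  assumes "0 < N"
  shows "circle_map N ` {0..N} = {x. (\<Sum>i\<le>1. x i ^ 2) = 1 \<and> (\<forall>i>1. x i = 0)}"
    "circle_map N ` UNIV = {x. (\<Sum>i\<le>1. x i ^ 2) = 1 \<and> (\<forall>i>1. x i = 0)}"
proof -
  let ?D = "{x. (\<Sum>i\<le>1::nat. x i ^ 2) = 1 \<and> (\<forall>i>1. x i = (0::real))}"
  have 1: "circle_map N ` UNIV \<subseteq> ?D"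
    by (auto simp: circle_map_def)
  have 2: "?D \<subseteq> circle_map N ` {0..N}"
  proof
    fix x assume "x \<in> ?D"
    then have x: "(x 0)\<^sup>2 + (x 1)\<^sup>2 = 1" "\<And>i. i > 1 \<Longrightarrow> x i = 0" by auto
    obtain t where t: "0 \<le> t" "t < 2 * pi" "x 0 = cos t" "x 1 = sin t"
      using sincos_total_2pi[OF x(1)] by metis
    have "x = circle_map N (N * t / (2 * pi))"
    proof
      fix i
      show "x i = circle_map N (N * t / (2 * pi)) i"
        using t(3,4) x(2)[of i] assms by (cases "i = 0"; cases "i = 1") (auto simp: circle_map_def)
    qed
    moreover have "N * t / (2 * pi) \<in> {0..N}"
      using t(1,2) assms by (auto simp: field_simps)
    ultimately show "x \<in> circle_map N ` {0..N}" by blast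
  qed
  show "circle_map N ` {0..N} = ?D" "circle_map N ` UNIV = ?D"
    using 1 2 by blast+
qed

text \<open>Lifts lie over the strand as the line lies over the circle. Evaluation at 0 and the
  curve \<open>g\<close> are equivariant and inverse to each other up to the equivariant homotopies
  \<open>H\<close> and \<open>J\<close>, and everything descends.\<close>

lemma strand_circle:
  assumes m: "2 \<le> m" and n: "3 \<le> n" "n \<noteq> 4" and r: "0 < r" "r < m" "n dvd m - 2 * r"
  shows "homotopy_circle (top_of_set (strand m n c r))"
    and "connected (strand m n c r)" and "compact (strand m n c r)"
proof -
  have m1: "1 \<le> m" and n1: "1 \<le> n" using m n by auto
  \<comment> \<open>\<open>N\<close> is the length of the closed walk with steps of 2 in the
    residues modulo \<open>n\<close>; the translations that \<open>project\<close> does not see are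
    exactly the multiples of \<open>N\<close>.\<close>
  define N where "N = (if even n then n div 2 else n)"
  have N: "0 < N" using n by (auto simp: N_def)
  have N_dvd: "n dvd 2 * d \<longleftrightarrow> N dvd d" for d
  proof (cases "even n")
    case True
    then have "n = 2 * N" by (simp add: N_def)
    then show ?thesis by simp
  next
    case False
    then have "coprime n 2" by (simp add: coprime_right_2_iff_odd)
    then show ?thesis using False by (simp add: N_def coprime_dvd_mult_right_iff)
  qed
  let ?A = "lifts m r" and ?\<pi> = "project m n c" and ?C = "strand m n c r"
  let ?K = "{q \<in> ?A. q 0 \<in> {0..of_int N}}"
  let ?D = "{x. (\<Sum>i\<le>1::nat. x i ^ 2) = 1 \<and> (\<forall>i>1. x i = (0::real))}"
  \<comment> \<open>The factor \<open>m\<close> compensates the slope of the staircase, so that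
    shifting \<open>y\<close> by an integer \<open>d\<close> shifts the whole lift by
    \<open>d\<close>.\<close>
  define g where "g y = (\<lambda>i. stairs m (of_int (r * i) + of_int m * y))" for y
  \<comment> \<open>Divided by \<open>m\<close>, this widens the clamp by \<open>m + 1\<close> on
    either side: \<open>m\<close> covers the rise of \<open>q\<close> over one period, and 1 the
    rounding loss in the lower bound for \<open>stairs\<close>.\<close>
  define k :: real where "k = of_int (m * (m + 1))"
  \<comment> \<open>At \<open>u = 0\<close> both bounds coincide and the clamp collapses to
    \<open>g (q 0)\<close>; as \<open>u\<close> grows they separate. Both bounds are lifts
    themselves, so the result is one by closure under minimum and maximum.\<close>
  define H where "H = (\<lambda>(u, q) i. max (stairs m (of_int (r * i) + (of_int m * q 0 - k * u)))
      (min (q i) (stairs m (of_int (r * i) + (of_int m * q 0 + k * u)))))"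
  \<comment> \<open>On the line there is no integrality condition, so the straight-line homotopy to
    the identity is available; it commutes with integer shifts.\<close>
  define J where "J = (\<lambda>(u, y). (1 - u) * stairs m (of_int m * y) + u * y)"
  have \<pi>: "continuous_on ?A ?\<pi>" using continuous_on_project continuous_on_subset by blast
  have \<pi>_eq: "?\<pi> (\<lambda>i. q i + of_int d) = ?\<pi> q" if "N dvd d" for q d
  proof -
    have "edge_point n (c + x) (q x + of_int d) = edge_point n (c + x) (q x)" for x
      using that N_dvd by (intro edge_point_cong[OF n1]) simp
    then show ?thesis by (intro ext) (simp add: project_def)
  qed
  have \<pi>_eqD: "\<exists>d. q' = (\<lambda>i. q i + of_int d) \<and> N dvd d" if q: "q \<in> ?A" "q' \<in> ?A" "?\<pi> q = ?\<pi> q'" for q q'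
  proof -
    obtain d where d: "q' = (\<lambda>i. q i + of_int d)" "n dvd c - c - 2 * d"
      using project_eq_imp[OF m1 n q(1,2) r(3,3) q(3)] by metis
    then have "N dvd d" by (simp add: N_dvd[symmetric])
    with d(1) show ?thesis by blast
  qed
  have circ_eq: "circle_map N y = circle_map N (y + of_int d)" if "N dvd d" for y d
  proof -
    obtain e where "d = N * e" using \<open>N dvd d\<close> by (rule dvdE)
    then have "circle_map N (y + of_int d) = circle_map N y"
      using N circle_map_eq_iff[of N "y + of_int d" y] by auto
    then show ?thesis by simp
  qed
  have circ_eqD: "\<exists>d. y = x + of_int d \<and> N dvd d" if xy: "circle_map N x = circle_map N y" for x y
  proof -
    obtain e where "y = x + of_int N * of_int e"
      using xy[symmetric] N circle_map_eq_iff[of N y x] by auto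
    then have "y = x + of_int (N * e)" by simp
    then show ?thesis by (metis dvd_triv_left)
  qed
  have stairs_shift: "stairs m (a + (of_int m * (y + of_int d) + b)) = stairs m (a + (of_int m * y + b)) + of_int d" for a b y d
    using stairs_period[of m "a + (of_int m * y + b)" d] r by (simp add: algebra_simps)
  have g_shift: "g (y + of_int d) = (\<lambda>i. g y i + of_int d)" for y d
    unfolding g_def using stairs_shift[of _ y d 0] by (simp add: fun_eq_iff)
  have H_shift: "H (u, \<lambda>i. q i + of_int d) = (\<lambda>i. H (u, q) i + of_int d)" for u q d
    unfolding H_def using stairs_shift[of _ "q 0" d "- (k * u)"] stairs_shift[of _ "q 0" d "k * u"]
    by (auto simp: fun_eq_iff)
  have stairs_cont: "continuous_on S f \<Longrightarrow> continuous_on S (\<lambda>x. stairs m (f x))" for S :: "'z::topological_space set" and f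
    unfolding stairs_def by (rule continuous_on_interp_compose)
  have coord: "continuous_on S (\<lambda>z. f z i)" if "continuous_on S f" for S :: "'z::topological_space set" and f :: "'z \<Rightarrow> int \<Rightarrow> real" and i
    using that by (rule continuous_on_product_then_coordinatewise)
  have H: "continuous_on ({0..1} \<times> ?A) H"
    unfolding H_def case_prod_unfold
    by (intro continuous_on_coordinatewise_then_product continuous_on_max continuous_on_min stairs_cont
        continuous_on_add continuous_on_diff continuous_on_mult continuous_on_const continuous_on_fst
        continuous_on_id coord[OF continuous_on_snd[OF continuous_on_id]])
  have HA: "H \<in> {0..1} \<times> ?A \<rightarrow> ?A"
    unfolding H_def using stairs_in_lifts[OF r(1,2)] by (auto intro!: lifts_min_max)
  have g: "continuous_on UNIV g"
    unfolding g_def by (intro continuous_on_coordinatewise_then_product stairs_cont continuous_intros)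
  have gA: "g \<in> UNIV \<rightarrow> ?A"
    unfolding g_def using stairs_in_lifts[OF r(1,2)] by auto
  have H0: "H (0, q) = g (q 0)" for q
    by (auto simp: H_def g_def fun_eq_iff)
  \<comment> \<open>\<open>project\<close> reads only the coordinates in \<open>{1..m}\<close>, so
    it is enough that both bounds of the clamp are inactive there.\<close>
  have H1: "?\<pi> (H (1, q)) = ?\<pi> q" if q: "q \<in> ?A" for q
  proof -
    have "H (1, q) x = q x" if x: "x \<in> {1..m}" for x
    proof -
      have b: "q 0 \<le> q x" "q x \<le> q 0 + of_int m"
        using lifts_bounds[OF q, of 0 x] x by auto
      have "0 \<le> r * x" "r * x \<le> m * m" using r x by (auto intro!: mult_mono)
      then have rx: "0 \<le> (of_int (r * x) :: real)" "of_int (r * x) \<le> (of_int (m * m) :: real)"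
        unfolding of_int_0_le_iff of_int_le_iff .
      have mpos: "(0::real) < of_int m" using m by simp
      have "stairs m (of_int (r * x) + (of_int m * q 0 - k)) \<le> (of_int (r * x) + (of_int m * q 0 - k)) / of_int m"
        using m by (intro stairs_bounds) simp
      also have "\<dots> \<le> q 0"
        using rx mpos by (simp add: k_def field_simps)
      finally have lo: "stairs m (of_int (r * x) + (of_int m * q 0 - k)) \<le> q x" using b by simp
      have "q 0 + of_int m \<le> (of_int (r * x) + (of_int m * q 0 + k)) / of_int m - 1"
        using rx mpos by (simp add: k_def field_simps)
      also have "\<dots> \<le> stairs m (of_int (r * x) + (of_int m * q 0 + k))"
        using m by (intro stairs_bounds) simp
      finally have "q x \<le> stairs m (of_int (r * x) + (of_int m * q 0 + k))" using b by simp
      with lo show ?thesis by (simp add: H_def)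
    qed
    then show ?thesis by (intro ext) (simp add: project_def)
  qed
  have into_K: "\<exists>q' \<in> ?K. ?\<pi> q' = ?\<pi> q" if q: "q \<in> ?A" for q
  proof -
    define d where "d = - (N * \<lfloor>q 0 / of_int N\<rfloor>)"
    have "of_int \<lfloor>q 0 / of_int N\<rfloor> * of_int N \<le> q 0" "q 0 \<le> (of_int \<lfloor>q 0 / of_int N\<rfloor> + 1) * of_int N"
      using N by (simp_all flip: pos_le_divide_eq pos_divide_le_eq)
    then have "(\<lambda>i. q i + of_int d) \<in> ?K"
      using lifts_add[OF q, of d] by (simp add: d_def algebra_simps)
    moreover have "N dvd d" by (simp add: d_def)
    ultimately show ?thesis using \<pi>_eq by blast
  qed
  have \<pi>K: "?\<pi> ` ?K = ?C"
    unfolding strand_def using into_K by (auto simp: image_iff) metis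
  have K: "compact ?K" by (rule compact_lifts_slice)
  show "compact ?C"
    unfolding \<pi>K[symmetric] using continuous_on_subset[OF \<pi>] K by (intro compact_continuous_image) auto
  have "connected (?\<pi> ` ?A)"
    by (rule connected_image_contracts[OF \<pi> connected_UNIV g gA H HA]) (simp_all add: H0 H1)
  then show "connected ?C" by (simp add: strand_def)
  have "?C homotopy_eqv ?D"
  proof (rule homotopy_eqv_descends[where \<pi> = ?\<pi> and \<rho> = "circle_map N" and A = ?A and K = ?K and B = UNIV
        and L = "{0..of_int N}" and f = "\<lambda>q. q 0" and g = g and H = H and J = J])
    show "circle_map N ` {0..of_int N} = ?D" "circle_map N ` UNIV = ?D"
      using circle_map_image[of N] N by auto
    show "?\<pi> ` ?A = ?C" by (simp add: strand_def)
    show "continuous_on ?A (\<lambda>q. q 0)" by (intro coord continuous_on_id)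
    show "circle_map N (p 0) = circle_map N (q 0)" if "p \<in> ?A" "q \<in> ?A" "?\<pi> p = ?\<pi> q" for p q
      using \<pi>_eqD[OF that] circ_eq by auto
    show "?\<pi> (g x) = ?\<pi> (g y)" if "circle_map N x = circle_map N y" for x y
      using circ_eqD[OF that] \<pi>_eq g_shift by auto
    show "?\<pi> (H (u, p)) = ?\<pi> (H (u, q))" if "p \<in> ?A" "q \<in> ?A" "?\<pi> p = ?\<pi> q" for u p q
      using \<pi>_eqD[OF that] \<pi>_eq H_shift by auto
    show "continuous_on ({0..1} \<times> UNIV) J"
      unfolding J_def case_prod_unfold by (intro continuous_intros stairs_cont)
    show "circle_map N (J (u, x)) = circle_map N (J (u, y))" if xy: "circle_map N x = circle_map N y" for u x y
    proof -
      obtain d where d: "y = x + of_int d" "N dvd d" using circ_eqD[OF xy] by blast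
      have "J (u, y) = J (u, x) + of_int d"
        using stairs_shift[of 0 x d 0] by (simp add: J_def d(1) algebra_simps)
      then show ?thesis using circ_eq[OF d(2)] by simp
    qed
    show "J (0, x) = g x 0" "circle_map N (J (1, x)) = circle_map N x" for x
      by (simp_all add: J_def g_def)
  qed (use \<pi> K \<pi>K continuous_on_circle_map g gA H HA H0 H1 in \<open>auto simp del: atLeastAtMost_iff\<close>)
  then show "homotopy_circle (top_of_set ?C)"
    by (simp add: nsphere_top_of_set)
qed

section \<open>Vertices and rotations\<close>

definition vertex_point :: "int \<Rightarrow> (int \<Rightarrow> int) \<Rightarrow> int \<Rightarrow> int \<Rightarrow> real" where
  "vertex_point m a x v = (if x \<in> {1..m} then of_bool (v = a x) else 0)"

lemma vertex_simplex_singleton: "w \<in> vertex_simplex {b} \<longleftrightarrow> w = (\<lambda>v. of_bool (v = b))"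
  by (auto simp: vertex_simplex_def fun_eq_iff) (metis order_refl zero_le_one)

lemma vertices_in_cycle_iff:
  "a \<in> vertices_in (cycle_graph m) (cycle_graph n) C \<longleftrightarrow>
     a \<in> graph_homs (cycle_graph m) (cycle_graph n) \<and> vertex_point m a \<in> C"
proof -
  have V: "pverts (cycle_graph m) = {1..m}" by (simp add: cycle_graph_def)
  have "closed_cell (cycle_graph m) (\<lambda>x \<in> pverts (cycle_graph m). {a x}) = {vertex_point m a}"
  proof (intro equalityI subsetI)
    fix p assume "p \<in> closed_cell (cycle_graph m) (\<lambda>x \<in> pverts (cycle_graph m). {a x})"
    then have "p x = vertex_point m a x" for x
      by (cases "x \<in> {1..m}") (auto simp: closed_cell_def V vertex_simplex_singleton vertex_point_def fun_eq_iff)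
    then show "p \<in> {vertex_point m a}" by (simp add: fun_eq_iff)
  qed (auto simp: closed_cell_def V vertex_simplex_singleton vertex_point_def fun_eq_iff)
  then show ?thesis by (simp add: vertices_in_def)
qed

lemma graph_homs_if_vertex_point:
  assumes mn: "1 \<le> m" "1 \<le> n" and a: "a \<in> extensional {1..m}" "vertex_point m a \<in> topspace (Hom_cycles m n)"
  shows "a \<in> graph_homs (cycle_graph m) (cycle_graph n)"
proof -
  have V: "pverts (cycle_graph k) = {1..k}" for k by (simp add: cycle_graph_def)
  have arcs: "parcs (cycle_graph m) \<subseteq> pverts (cycle_graph m) \<times> pverts (cycle_graph m)"
    using parcs_cycle_iff[OF mn(1)] by (auto simp: V)
  note p = a(2)[unfolded hom_complex_def topspace_euclidean_subtopology, THEN hom_complex_point_iff[OF _ arcs, THEN iffD1, rotated]]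
  have p: "\<forall>x\<in>{1..m}. vertex_point m a x \<in> vertex_simplex {1..n}"
    "\<forall>(x, y) \<in> parcs (cycle_graph m). \<forall>u v. vertex_point m a x u \<noteq> 0 \<longrightarrow> vertex_point m a y v \<noteq> 0 \<longrightarrow> (u, v) \<in> parcs (cycle_graph n)"
    using p by (simp_all add: V)
  have one: "vertex_point m a x (a x) = 1" if "x \<in> {1..m}" for x using that by (simp add: vertex_point_def)
  have "a x \<in> {1..n}" if "x \<in> {1..m}" for x
    using p(1) that one[OF that] unfolding vertex_simplex_def by force
  moreover have "(a x, a y) \<in> parcs (cycle_graph n)" if "(x, y) \<in> parcs (cycle_graph m)" for x y
  proof -
    have "x \<in> {1..m}" "y \<in> {1..m}" using that arcs by (auto simp: V)
    then show ?thesis using p(2) that one by fastforce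
  qed
  ultimately show ?thesis using a(1) by (auto simp: graph_homs_def V PiE_iff)
qed

lemma card_unit_steps:
  fixes D :: "int \<Rightarrow> int"
  assumes "\<And>i. D (i + 1) - D i \<in> {0, 1}" "0 \<le> m"
  shows "int (card {i \<in> {1..m}. D (i + 1) - D i = 1}) = D (m + 1) - D 1"
  using assms(2)
proof (induction m rule: int_ge_induct)
  case (step m)
  let ?S = "\<lambda>m. {i \<in> {1..m}. D (i + 1) - D i = 1}"
  have fin: "finite (?S m)" by (rule finite_subset[of _ "{1..m}"]) auto
  show ?case
  proof (cases "D (m + 1 + 1) - D (m + 1) = 1")
    case True
    then have "?S (m + 1) = insert (m + 1) (?S m)" using step(1) by auto
    moreover have "card (insert (m + 1) (?S m)) = Suc (card (?S m))"
      by (rule card_insert_disjoint[OF fin]) simp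
    ultimately have "card (?S (m + 1)) = Suc (card (?S m))" by simp
    then show ?thesis using step.IH True by simp
  next
    case False
    then have "D (m + 1 + 1) = D (m + 1)" using assms(1)[of "m + 1"] by auto
    moreover have "?S (m + 1) = ?S m"
    proof (intro equalityI subsetI)
      fix i assume "i \<in> ?S (m + 1)"
      then show "i \<in> ?S m" using False by (cases "i = m + 1") auto
    qed auto
    ultimately show ?thesis using step.IH by simp
  qed
qed simp

text \<open>At a vertex the lift has integer values \<open>D i\<close> and \<open>a i\<close> is
  \<open>c + i - 2 * D i\<close> modulo \<open>n\<close>. So \<open>i\<close> is a returning point
  exactly when \<open>D\<close> rises at \<open>i\<close>, and \<open>D\<close> rises
  \<open>r\<close> times per period. The congruence for \<open>a 1\<close> later recovers the parity
  of \<open>c\<close> when \<open>n\<close> is even.\<close>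

lemma vertex_in_strand:
  assumes m: "1 \<le> m" and n: "3 \<le> n" and r: "n dvd m - 2 * r"
    and a: "vertex_point m a \<in> strand m n c r"
  shows "int (card (returning_points m n a)) = r" and "\<exists>d. n dvd a 1 - (c + 1 - 2 * d)"
proof -
  have n1: "1 \<le> n" using n by simp
  have n2: "\<not> n dvd 2" using n by (auto dest: zdvd_imp_le)
  obtain q where q: "q \<in> lifts m r" "vertex_point m a = project m n c q"
    using a by (auto simp: strand_def)
  have P: "(\<lambda>v. of_bool (v = a (rep m i))) = edge_point n (c + i) (q i)" for i
    using project_rep[OF m n1 q(1) r, of c i] rep_range[OF m, of i] unfolding q(2)[symmetric]
    by (simp add: vertex_point_def fun_eq_iff)
  have "\<exists>d. q i = of_int d \<and> a (rep m i) = rep n (c + i - 2 * d)" for i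
  proof -
    let ?u = "rep n (c + i - 2 * \<lfloor>q i\<rfloor>)" and ?v = "rep n (c + i - 2 * \<lfloor>q i\<rfloor> - 2)"
    have "?u \<noteq> ?v" using n2 by (simp add: rep_eq_iff[OF n1])
    then have *: "of_bool (?u = a (rep m i)) = 1 - frac (q i)" "of_bool (?v = a (rep m i)) = frac (q i)"
      using fun_cong[OF P[of i], of ?u] fun_cong[OF P[of i], of ?v] by (simp_all add: edge_point_frac)
    \<comment> \<open>The weights of a vertex are 0 or 1, and the weight
      \<open>1 - frac (q i)\<close> is positive.\<close>
    then have "frac (q i) = 0" using \<open>?u \<noteq> ?v\<close> frac_lt_1[of "q i"] by (auto split: if_splits simp: of_bool_def)
    then have "q i = of_int \<lfloor>q i\<rfloor>" "a (rep m i) = ?u" using * by (auto simp: frac_def of_bool_def split: if_splits)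
    then show ?thesis by blast
  qed
  then obtain D where D: "\<And>i. q i = of_int (D i)" "\<And>i. a (rep m i) = rep n (c + i - 2 * D i)"
    by metis
  have step: "D (i + 1) - D i \<in> {0, 1}" for i
    using liftsD(1,2)[OF q(1), of i] by (auto simp: D(1))
  have *: "n dvd 2 * \<delta> - 2 \<longleftrightarrow> \<delta> = 1" if "\<delta> \<in> {0, 1}" for \<delta>
    using that n2 by auto
  have "returning_points m n a = {i \<in> {1..m}. D (i + 1) - D i = 1}"
    unfolding returning_points_def
  proof (intro Collect_cong conj_cong refl)
    fix i assume i: "i \<in> {1..m}"
    have "rep n (a i - a (rep m (i + 1))) = 1 \<longleftrightarrow> n dvd (a i - a (rep m (i + 1))) - 1"
      using rep_eq_iff[OF n1, of _ 1] rep_ident[of 1 n] n1 by simp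
    also have "n dvd (a i - a (rep m (i + 1))) - 1 \<longleftrightarrow> n dvd 2 * (D (i + 1) - D i) - 2"
    proof -
      have e: "n dvd a i - (c + i - 2 * D i)" "n dvd a (rep m (i + 1)) - (c + (i + 1) - 2 * D (i + 1))"
        using rep_cong[OF n1] D(2)[of i] D(2)[of "i + 1"] by (auto simp: rep_ident[OF i] cong_iff_dvd_diff)
      from dvd_diff[OF e] have "n dvd ((a i - a (rep m (i + 1))) - 1) - (2 * (D (i + 1) - D i) - 2)"
        by (simp add: algebra_simps)
      then show ?thesis by (metis mod_eq_dvd_iff dvd_eq_mod_eq_0)
    qed
    also have "\<dots> \<longleftrightarrow> D (i + 1) - D i = 1"
      by (rule *[OF step])
    finally show "rep n (a i - a (rep m (i + 1))) = 1 \<longleftrightarrow> D (i + 1) - D i = 1" .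
  qed
  moreover have "D (m + 1) - D 1 = r"
    using liftsD(4)[OF q(1), of 1] by (simp add: D(1) add.commute flip: of_int_add)
  ultimately show "int (card (returning_points m n a)) = r"
    using card_unit_steps[where D = D, OF step, of m] m by simp
  have "n dvd a 1 - (c + 1 - 2 * D 1)"
    using D(2)[of 1] rep_cong[OF n1, of "c + 1 - 2 * D 1"] rep_ident[of 1 m] m by (simp add: cong_iff_dvd_diff)
  then show "\<exists>d. n dvd a 1 - (c + 1 - 2 * d)" ..
qed

lemma project_of_int:
  "project m n c (\<lambda>i. of_int (D i)) = vertex_point m (\<lambda>x \<in> {1..m}. rep n (c + x - 2 * D x))"
  by (intro ext) (simp add: project_def vertex_point_def edge_point_of_int)

lemma strand_vertex_exists:
  assumes m: "1 \<le> m" and n: "1 \<le> n" and r: "n dvd m - 2 * r" and D: "(\<lambda>i. of_int (D i)) \<in> lifts m r"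
  shows "(\<lambda>x \<in> {1..m}. rep n (c + x - 2 * D x)) \<in> vertices_in (cycle_graph m) (cycle_graph n) (strand m n c r)"
proof -
  have "vertex_point m (\<lambda>x \<in> {1..m}. rep n (c + x - 2 * D x)) \<in> strand m n c r"
    unfolding strand_def using D project_of_int by (metis imageI)
  moreover from this have "(\<lambda>x \<in> {1..m}. rep n (c + x - 2 * D x)) \<in> graph_homs (cycle_graph m) (cycle_graph n)"
    using strand_subset[OF m n r] by (intro graph_homs_if_vertex_point[OF m n]) auto
  ultimately show ?thesis by (simp add: vertices_in_cycle_iff)
qed

text \<open>These vertices wind steadily in one direction: \<open>\<sigma> = 1\<close> has no
  returning points, \<open>\<sigma> = - 1\<close> has only returning points. They are the isolated
  points of the complex.\<close>

definition rotation :: "int \<Rightarrow> int \<Rightarrow> int \<times> int \<Rightarrow> int \<Rightarrow> int \<Rightarrow> real" where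
  "rotation m n = (\<lambda>(e, \<sigma>). vertex_point m (\<lambda>x \<in> {1..m}. rep n (e + \<sigma> * x)))"

text \<open>A steady walk closes up only if \<open>n dvd m\<close>. The members are singletons
  because they are compared with connected components.\<close>

definition rotations :: "int \<Rightarrow> int \<Rightarrow> (int \<Rightarrow> int \<Rightarrow> real) set set" where
  "rotations m n = (if n dvd m then (\<lambda>z. {rotation m n z}) ` ({1..n} \<times> {1, - 1}) else {})"

lemma rotation_eqD:
  assumes m: "2 \<le> m" and n: "3 \<le> n" and eq: "rotation m n (e, \<sigma>) = rotation m n (e', \<sigma>')"
    and \<sigma>: "\<sigma> \<in> {1, - 1}" "\<sigma>' \<in> {1, - 1}"
  shows "\<sigma> = \<sigma>' \<and> n dvd e - e'"
proof -
  have n1: "1 \<le> n" using n by simp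
  have eqr: "rep n (e + \<sigma> * x) = rep n (e' + \<sigma>' * x)" if "x \<in> {1..m}" for x
    using fun_cong[OF fun_cong[OF eq, of x], of "rep n (e + \<sigma> * x)"] that
    by (auto simp: rotation_def vertex_point_def)
  \<comment> \<open>Coordinates 1 and 2 suffice: their difference isolates the direction, and the
    first one then gives the starting point.\<close>
  have 1: "n dvd (e + \<sigma> * 1) - (e' + \<sigma>' * 1)" and 2: "n dvd (e + \<sigma> * 2) - (e' + \<sigma>' * 2)"
    using eqr[of 1] eqr[of 2] m by (simp_all add: rep_eq_iff[OF n1])
  have "n dvd \<sigma> - \<sigma>'" using dvd_diff[OF 2 1] by (simp add: algebra_simps)
  moreover have "\<not> n dvd 2" using n by (auto dest: zdvd_imp_le)
  ultimately have "\<sigma> = \<sigma>'" using \<sigma> by auto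
  then show ?thesis using 1 by simp
qed

lemma card_rotations:
  assumes "2 \<le> m" "3 \<le> n" "n dvd m"
  shows "int (card (rotations m n)) = 2 * n"
proof -
  have "inj_on (\<lambda>z. {rotation m n z}) ({1..n} \<times> {1, - 1})"
  proof (intro inj_onI)
    fix z z' assume z: "z \<in> {1..n} \<times> {1, - 1}" "z' \<in> {1..n} \<times> {1, - 1}" "{rotation m n z} = {rotation m n z'}"
    obtain e \<sigma> e' \<sigma>' where s: "z = (e, \<sigma>)" "z' = (e', \<sigma>')" by fastforce
    have *: "\<sigma> = \<sigma>' \<and> n dvd e - e'" using rotation_eqD[of m n e \<sigma> e' \<sigma>'] assms z by (auto simp: s)
    have "\<bar>e - e'\<bar> < n" using z by (auto simp: s)
    then have "e = e'" using * dvd_imp_le_int[of "e - e'" n] by (cases "e = e'") auto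
    with * show "z = z'" by (simp add: s)
  qed
  then have "card (rotations m n) = card ({1..n} \<times> {1, - 1 :: int})"
    using assms(3) by (simp only: rotations_def card_image if_True)
  then show ?thesis using assms by (simp add: card_cartesian_product)
qed

text \<open>Rigidity at rotation number 0: the increments of one period are nonnegative with sum
  zero.\<close>

lemma lifts_zero: "1 \<le> m \<Longrightarrow> q \<in> lifts m 0 \<Longrightarrow> \<exists>d. q = (\<lambda>i. of_int d)"
proof -
  assume m: "1 \<le> m" and q: "q \<in> lifts m 0"
  have step: "q (i + 1) = q i" for i
    using lifts_bounds(1)[OF q, of "i + 1" "i + m"] liftsD(1,4)[OF q, of i] m by auto
  have const: "q i = q 0" for i
  proof (induction i rule: int_induct[where k = 0])
    case (step2 i) then show ?case using step[of "i - 1"] by simp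
  qed (simp_all add: step)
  have "q 0 \<in> \<int>" using liftsD(3)[OF q, of 0] step[of 0] by simp
  then obtain d where "q 0 = of_int d" by (auto elim: Ints_cases)
  then show ?thesis using const by metis
qed

text \<open>Rigidity at the other end: the \<open>m\<close> increments of a period are at most 1 and
  sum to \<open>m\<close>.\<close>

lemma lifts_full: "1 \<le> m \<Longrightarrow> q \<in> lifts m m \<Longrightarrow> \<exists>d. q = (\<lambda>i. of_int (d + i))"
proof -
  assume m: "1 \<le> m" and q: "q \<in> lifts m m"
  have step: "q (i + 1) = q i + 1" for i
    using lifts_bounds(2)[OF q, of "i + 1" "i + m"] liftsD(2,4)[OF q, of i] m by auto
  have lin: "q i = q 0 + of_int i" for i
  proof (induction i rule: int_induct[where k = 0])
    case (step2 i) then show ?case using step[of "i - 1"] by simp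
  qed (simp_all add: step)
  have "q 0 \<in> \<int>" using liftsD(3)[OF q, of 0] step[of 0] Ints_diff[of "q 0 + 1" 1] by auto
  then obtain d where "q 0 = of_int d" by (auto elim: Ints_cases)
  then have "q i = of_int (d + i)" for i using lin[of i] by simp
  then have "q = (\<lambda>i. of_int (d + i))" by (rule ext)
  then show ?thesis ..
qed

lemma rotation_rep: "1 \<le> n \<Longrightarrow> rotation m n (rep n e, \<sigma>) = rotation m n (e, \<sigma>)"
proof -
  assume n: "1 \<le> n"
  have "n dvd rep n e - e" using rep_cong[OF n] by (simp add: cong_iff_dvd_diff)
  then have "rep n (rep n e + \<sigma> * x) = rep n (e + \<sigma> * x)" for x by (simp add: rep_eq_iff[OF n])
  then show ?thesis by (simp add: rotation_def)
qed

lemma rotation_in_strand: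
  "rotation m n (e, 1) \<in> strand m n e 0" "rotation m n (e, - 1) \<in> strand m n e m"
proof -
  have "(\<lambda>i. of_int 0) \<in> lifts m 0" "(\<lambda>i. of_int i) \<in> lifts m m" by (auto simp: lifts_def)
  then have "project m n e (\<lambda>i. of_int 0) \<in> strand m n e 0" "project m n e (\<lambda>i. of_int i) \<in> strand m n e m"
    unfolding strand_def by blast+
  then show "rotation m n (e, 1) \<in> strand m n e 0" "rotation m n (e, - 1) \<in> strand m n e m"
    unfolding project_of_int by (simp_all add: rotation_def)
qed

lemma strand_extreme_rotations:
  assumes m: "1 \<le> m" and n: "1 \<le> n" and r: "r = 0 \<or> r = m" "n dvd m" and p: "p \<in> strand m n c r"
  shows "{p} \<in> rotations m n"
proof -
  obtain q where q: "q \<in> lifts m r" "p = project m n c q" using p by (auto simp: strand_def)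
  obtain e \<sigma> where e: "p = rotation m n (e, \<sigma>)" "\<sigma> \<in> {1, - 1}"
    using r(1)
  proof
    assume "r = 0"
    then obtain d where "q = (\<lambda>i. of_int d)" using lifts_zero[OF m] q by blast
    then have "p = rotation m n (c - 2 * d, 1)"
      unfolding q(2) by (simp only: project_of_int) (simp add: rotation_def algebra_simps cong: restrict_cong)
    then show thesis using that by simp
  next
    assume "r = m"
    then obtain d where "q = (\<lambda>i. of_int (d + i))" using lifts_full[OF m] q by blast
    then have "p = rotation m n (c - 2 * d, - 1)"
      unfolding q(2) by (simp only: project_of_int) (simp add: rotation_def algebra_simps cong: restrict_cong)
    then show thesis using that by simp
  qed
  have "p = rotation m n (rep n e, \<sigma>)" using e rotation_rep[OF n] by simp
  moreover have "(rep n e, \<sigma>) \<in> {1..n} \<times> {1, - 1}" using rep_range[OF n, of e] e(2) by auto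
  ultimately show ?thesis using r(2) by (auto simp: rotations_def)
qed

section \<open>The components\<close>

definition inner_rotation_numbers :: "int \<Rightarrow> int \<Rightarrow> int set" where
  "inner_rotation_numbers m n = {r. 0 < r \<and> r < m \<and> n dvd m - 2 * r}"

text \<open>Only the residue of \<open>c\<close> modulo \<open>gcd 2 n\<close> matters for \<open>strand m n c r\<close>.\<close>

definition offsets :: "int \<Rightarrow> int set" where
  "offsets n = (if even n then {0, 1} else {0})"

lemma offset_exists: "\<exists>c0 \<in> offsets n. \<exists>d. n dvd c - c0 - 2 * d"
proof (cases "even n")
  case True
  have "c - c mod 2 - 2 * (c div 2) = 0" by (simp add: minus_mod_eq_mult_div)
  then have "n dvd c - c mod 2 - 2 * (c div 2)" by simp
  moreover have "c mod 2 \<in> offsets n" using True by (auto simp: offsets_def)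
  ultimately show ?thesis by blast
next
  case False
  then obtain k where k: "n = 2 * k + 1" by (rule oddE)
  \<comment> \<open>\<open>k + 1\<close> is the inverse of 2 modulo \<open>n = 2 * k + 1\<close>, so
    for odd \<open>n\<close> every offset can be shifted to 0.\<close>
  have "c - 0 - 2 * (c * (k + 1)) = - c * n" by (simp add: k algebra_simps)
  then have "n dvd c - 0 - 2 * (c * (k + 1))" by (metis dvd_triv_right)
  then show ?thesis using False by (auto simp: offsets_def)
qed

lemma offset_unique:
  assumes "c \<in> offsets n" "c' \<in> offsets n" "n dvd c' - c - 2 * d"
  shows "c' = c"
proof (cases "even n")
  case True
  then have "even (c' - c - 2 * d)" using assms(3) by (rule dvd_trans)
  then show ?thesis using assms(1,2) True by (auto simp: offsets_def)
qed (use assms in \<open>simp add: offsets_def\<close>)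

definition strands :: "int \<Rightarrow> int \<Rightarrow> (int \<Rightarrow> int \<Rightarrow> real) set set" where
  "strands m n = (\<lambda>(c, r). strand m n c r) ` (offsets n \<times> inner_rotation_numbers m n)"

lemma staircase_in_lifts: "0 < r \<Longrightarrow> r < m \<Longrightarrow> (\<lambda>i. of_int (r * i div m)) \<in> lifts m r"
  using stairs_in_lifts[of r m 0] by (simp add: stairs_def flip: of_int_mult)

lemma strand_vertex:
  assumes "1 \<le> m" "1 \<le> n" "r \<in> inner_rotation_numbers m n"
  obtains a where "a \<in> vertices_in (cycle_graph m) (cycle_graph n) (strand m n c r)" "a 1 = rep n (c + 1)"
proof
  have r: "0 < r" "r < m" "n dvd m - 2 * r" using assms(3) by (auto simp: inner_rotation_numbers_def)
  \<comment> \<open>The integer staircase \<open>r * x div m\<close> is a lift with rotation number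
    \<open>r\<close>. It vanishes at \<open>x = 1\<close> because \<open>r < m\<close>, which gives
    the prescribed value of \<open>a 1\<close>.\<close>
  show "(\<lambda>x \<in> {1..m}. rep n (c + x - 2 * (r * x div m))) \<in> vertices_in (cycle_graph m) (cycle_graph n) (strand m n c r)"
    by (rule strand_vertex_exists[OF assms(1,2) r(3) staircase_in_lifts[OF r(1,2)]])
  show "(\<lambda>x \<in> {1..m}. rep n (c + x - 2 * (r * x div m))) 1 = rep n (c + 1)"
    using assms(1) r by simp
qed

lemma strand_inject:
  assumes m: "2 \<le> m" and n: "3 \<le> n" "n \<noteq> 4"
    and "c \<in> offsets n" "c' \<in> offsets n" "r \<in> inner_rotation_numbers m n" "n dvd m - 2 * r'"
    and "strand m n c r \<inter> strand m n c' r' \<noteq> {}"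
  shows "c' = c \<and> r' = r"
proof -
  have m1: "1 \<le> m" and r: "n dvd m - 2 * r" using assms by (auto simp: inner_rotation_numbers_def)
  show ?thesis
    using strand_disjoint[OF m1 n r assms(7,8)] offset_unique[OF assms(4,5)] by blast
qed

lemma strand_nonempty:
  assumes "1 \<le> m" "1 \<le> n" "r \<in> inner_rotation_numbers m n"
  shows "strand m n c r \<noteq> {}"
  using strand_vertex[OF assms] by (metis empty_iff vertices_in_cycle_iff)

lemma rotations_cases:
  assumes "X \<in> rotations m n"
  obtains p c r where "X = {p}" "p \<in> strand m n c r" "n dvd m - 2 * r" "r = 0 \<or> r = m" "n dvd m"
    "\<exists>a. p = vertex_point m a \<and> a \<in> extensional {1..m}"
proof -
  have dvd: "n dvd m" using assms by (auto simp: rotations_def split: if_splits)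
  obtain e \<sigma> where e: "X = {rotation m n (e, \<sigma>)}" "\<sigma> \<in> {1, - 1}"
    using assms dvd by (auto simp: rotations_def)
  have a: "\<exists>a. rotation m n (e, \<sigma>) = vertex_point m a \<and> a \<in> extensional {1..m}"
    unfolding rotation_def prod.case by (intro exI conjI) (rule refl, simp)
  have "n dvd m - 2 * 0" "n dvd m - 2 * m" using dvd by simp_all
  then show thesis using that[OF e(1) _ _ _ dvd a, of e 0] that[OF e(1) _ _ _ dvd a, of e m] e(2) rotation_in_strand
    by auto
qed

lemma Hom_cycles_decomposition:
  assumes m: "2 \<le> m" and n: "3 \<le> n" "n \<noteq> 4"
  shows "topspace (Hom_cycles m n) = \<Union>(rotations m n \<union> strands m n)" (is "?X = ?Y")
proof
  have m1: "1 \<le> m" and n1: "1 \<le> n" using m n by auto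
  show "?X \<subseteq> ?Y"
  proof
    fix p assume "p \<in> ?X"
    then obtain c r where r: "n dvd m - 2 * r" "p \<in> strand m n c r" using Hom_cycles_lift[OF m1 n] by metis
    then obtain q where q: "q \<in> lifts m r" by (auto simp: strand_def)
    have r0: "0 \<le> r" "r \<le> m" using lifts_rotation_bounds[OF q] m by auto
    show "p \<in> ?Y"
    proof (cases "r = 0 \<or> r = m")
      case True
      then have "n dvd m" using r(1) by (auto simp: dvd_minus_iff[of n m] simp flip: mult_2 dest: dvd_minus_iff[THEN iffD1])
      then have "{p} \<in> rotations m n" by (rule strand_extreme_rotations[OF m1 n1 True _ r(2)])
      then show ?thesis by blast
    next
      case False
      then have "r \<in> inner_rotation_numbers m n" using r0 r(1) by (simp add: inner_rotation_numbers_def)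
      moreover obtain c0 d where "c0 \<in> offsets n" "n dvd c - c0 - 2 * d" using offset_exists by blast
      moreover from this have "strand m n c r = strand m n c0 r" by (intro strand_eq[OF n1])
      ultimately show ?thesis using r(2) by (auto simp: strands_def)
    qed
  qed
  show "?Y \<subseteq> ?X"
  proof
    fix p assume "p \<in> ?Y"
    then obtain X where X: "p \<in> X" "X \<in> rotations m n \<union> strands m n" by blast
    have "\<exists>c r. X \<subseteq> strand m n c r \<and> n dvd m - 2 * r"
      using X(2)
    proof
      assume "X \<in> rotations m n" then show ?thesis by (rule rotations_cases) blast
    next
      assume "X \<in> strands m n" then show ?thesis by (auto simp: strands_def inner_rotation_numbers_def)
    qed
    then show "p \<in> ?X" using X(1) strand_subset[OF m1 n1] by blast
  qed
qed

text \<open>Distinct pieces are disjoint, since a point determines its rotation number and the class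
  of its offset. The finitely many pieces are compact and connected, so they are the
  components.\<close>

lemma Hom_cycles_components:
  assumes m: "2 \<le> m" and n: "3 \<le> n" "n \<noteq> 4"
  shows "connected_components_of (Hom_cycles m n) = rotations m n \<union> strands m n"
    and "rotations m n \<inter> strands m n = {}"
proof -
  have m1: "1 \<le> m" and n1: "1 \<le> n" using m n by auto
  have disj: "X \<inter> strand m n c r = {}"
    if X: "X \<in> rotations m n" and c: "c \<in> offsets n" and r: "r \<in> inner_rotation_numbers m n" for X c r
  proof (rule ccontr)
    assume ne: "X \<inter> strand m n c r \<noteq> {}"
    obtain p c' r' where p: "X = {p}" "p \<in> strand m n c' r'" "n dvd m - 2 * r'" "r' = 0 \<or> r' = m"
      using X by (rule rotations_cases) blast
    then have "strand m n c r \<inter> strand m n c' r' \<noteq> {}" using ne by auto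
    then have "r' = r" using strand_disjoint(1)[OF m1 n _ p(3)] r by (auto simp: inner_rotation_numbers_def)
    then show False using p(4) r by (auto simp: inner_rotation_numbers_def)
  qed
  have ne: "strand m n c r \<noteq> {}" if "r \<in> inner_rotation_numbers m n" for c r
    using strand_nonempty[OF m1 n1 that] .
  have disjoint: "A \<inter> B = {}" if AB: "A \<in> rotations m n \<union> strands m n" "B \<in> rotations m n \<union> strands m n" "A \<noteq> B" for A B
  proof -
    consider "A \<in> rotations m n" "B \<in> rotations m n" | "A \<in> rotations m n" "B \<in> strands m n"
      | "A \<in> strands m n" "B \<in> rotations m n" | "A \<in> strands m n" "B \<in> strands m n"
      using AB by blast
    then show ?thesis
    proof cases
      case 1 then show ?thesis using AB(3) by (auto simp: rotations_def split: if_splits)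
    next
      case 2 then show ?thesis using disj by (auto simp: strands_def)
    next
      case 3 then show ?thesis using disj by (auto simp: strands_def)
    next
      case 4
      then obtain c r c' r' where s: "A = strand m n c r" "B = strand m n c' r'"
        "c \<in> offsets n" "c' \<in> offsets n" "r \<in> inner_rotation_numbers m n" "r' \<in> inner_rotation_numbers m n"
        by (auto simp: strands_def)
      then show ?thesis using strand_inject[OF m n s(3-5), of r'] AB(3)
        by (auto simp: inner_rotation_numbers_def)
    qed
  qed
  have "finite (inner_rotation_numbers m n)"
    by (rule finite_subset[of _ "{0..m}"]) (auto simp: inner_rotation_numbers_def)
  then have fin: "finite (rotations m n \<union> strands m n)"
    by (auto simp: rotations_def strands_def offsets_def)
  have strand: "connected X \<and> compact X" if "X \<in> strands m n" for X
    using that strand_circle(2,3)[OF m n] by (auto simp: strands_def inner_rotation_numbers_def)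
  have rot: "connected X \<and> compact X" if "X \<in> rotations m n" for X
    using that by (auto simp: rotations_def split: if_splits)
  have ne': "{} \<notin> rotations m n \<union> strands m n"
    using ne by (auto simp: rotations_def strands_def split: if_splits)
  have "Hom_cycles m n = top_of_set (\<Union>(rotations m n \<union> strands m n))"
    using Hom_cycles_decomposition[OF m n] by (simp add: hom_complex_def)
  also have "connected_components_of \<dots> = rotations m n \<union> strands m n"
    using fin ne' disjoint strand rot
    by (intro connected_components_of_finite_partition) (auto intro: compact_imp_closed)
  finally show "connected_components_of (Hom_cycles m n) = rotations m n \<union> strands m n" .
  show "rotations m n \<inter> strands m n = {}"
    using disj ne by (fastforce simp: strands_def)
qed

lemma strands_homotopy_circle:
  assumes m: "2 \<le> m" and n: "3 \<le> n" "n \<noteq> 4" and C: "C \<in> strands m n"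
  shows "homotopy_circle (subtopology (Hom_cycles m n) C)"
proof -
  obtain c r where cr: "C = strand m n c r" "r \<in> inner_rotation_numbers m n" using C by (auto simp: strands_def)
  have "C \<subseteq> topspace (Hom_cycles m n)"
    using Hom_cycles_decomposition[OF m n] C by blast
  then have "subtopology (Hom_cycles m n) C = top_of_set C"
    by (simp add: hom_complex_def subtopology_subtopology Int_absorb1)
  then show ?thesis using cr strand_circle(1)[OF m n] by (auto simp: inner_rotation_numbers_def)
qed

text \<open>\<open>all_returning\<close> would hold vacuously for a set without vertices. Every
  component contains a vertex, whose number of returning points is the rotation number of the
  strand; rotations have number 0 or \<open>m\<close> and are excluded.\<close>

lemma component_all_returning:
  assumes m: "2 \<le> m" and n: "3 \<le> n" "n \<noteq> 4" and r: "r \<in> inner_rotation_numbers m n"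
    and C: "C \<in> connected_components_of (Hom_cycles m n)"
  shows "all_returning m n r C \<longleftrightarrow> (\<exists>c \<in> offsets n. C = strand m n c r)"
proof
  have m1: "1 \<le> m" and n1: "1 \<le> n" using m n by auto
  assume all: "all_returning m n r C"
  from C consider "C \<in> rotations m n" | "C \<in> strands m n" using Hom_cycles_components(1)[OF m n] by blast
  then show "\<exists>c \<in> offsets n. C = strand m n c r"
  proof cases
    case 1
    then obtain p c r' a where p: "C = {p}" "p \<in> strand m n c r'" "n dvd m - 2 * r'" "r' = 0 \<or> r' = m"
      "p = vertex_point m a" "a \<in> extensional {1..m}"
      by (rule rotations_cases) blast
    have "vertex_point m a \<in> topspace (Hom_cycles m n)" using strand_subset[OF m1 n1 p(3)] p(2,5) by blast
    then have "a \<in> vertices_in (cycle_graph m) (cycle_graph n) C"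
      using graph_homs_if_vertex_point[OF m1 n1 p(6)] p by (simp add: vertices_in_cycle_iff)
    then have "int (card (returning_points m n a)) = r" using all by (simp add: all_returning_def)
    then have "r' = r" using vertex_in_strand(1)[OF m1 n(1) p(3)] p(2,5) by metis
    then show ?thesis using p(4) r by (auto simp: inner_rotation_numbers_def)
  next
    case 2
    then obtain c r' where s: "C = strand m n c r'" "c \<in> offsets n" "r' \<in> inner_rotation_numbers m n"
      by (auto simp: strands_def)
    obtain a where a: "a \<in> vertices_in (cycle_graph m) (cycle_graph n) C"
      using strand_vertex[OF m1 n1 s(3)] s(1) by metis
    then have "int (card (returning_points m n a)) = r" using all by (simp add: all_returning_def)
    moreover have "int (card (returning_points m n a)) = r'"
      using a s by (intro vertex_in_strand(1)[OF m1 n(1)]) (auto simp: vertices_in_cycle_iff inner_rotation_numbers_def)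
    ultimately show ?thesis using s by blast
  qed
next
  assume "\<exists>c \<in> offsets n. C = strand m n c r"
  then show "all_returning m n r C"
    using vertex_in_strand(1)[of m n r] m n r
    by (auto simp: all_returning_def vertices_in_cycle_iff inner_rotation_numbers_def)
qed

section \<open>Identification of the named components\<close>

lemma is_Delta_odd_iff:
  assumes m: "2 \<le> m" and n: "3 \<le> n" "odd n" and r: "r \<in> inner_rotation_numbers m n"
  shows "is_Delta_odd m n r C \<longleftrightarrow> C = strand m n 0 r"
proof -
  have n4: "n \<noteq> 4" using n by auto
  have "strand m n 0 r \<in> connected_components_of (Hom_cycles m n)"
    using r n(2) unfolding Hom_cycles_components(1)[OF m n(1) n4] by (auto simp: strands_def offsets_def)
  then show ?thesis
    using component_all_returning[OF m n(1) n4 r] n(2) unfolding is_Delta_odd_def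
    by (auto simp: offsets_def)
qed

text \<open>For even \<open>n\<close> the parity of \<open>a 1\<close> is constant on a strand and
  equals that of \<open>c + 1\<close>, so the values 1 and 2 of \<open>i\<close> select the offsets
  0 and 1.\<close>

lemma is_Delta_even_iff:
  assumes m: "2 \<le> m" and n: "3 \<le> n" "n \<noteq> 4" "even n" and r: "r \<in> inner_rotation_numbers m n"
    and i: "i \<in> {1, 2}"
  shows "is_Delta_even m n r i C \<longleftrightarrow> C = strand m n (i - 1) r"
proof
  have m1: "1 \<le> m" and n1: "1 \<le> n" using m n by auto
  have off: "offsets n = {0, 1}" using n by (simp add: offsets_def)
  { assume D: "is_Delta_even m n r i C"
    then obtain c where c: "c \<in> offsets n" "C = strand m n c r"
      using component_all_returning[OF m n(1,2) r] by (auto simp: is_Delta_even_def)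
    obtain a where a: "a \<in> vertices_in (cycle_graph m) (cycle_graph n) C" "a 1 = i"
      using D by (auto simp: is_Delta_even_def)
    obtain d where "n dvd i - (c + 1 - 2 * d)"
      using vertex_in_strand(2)[OF m1 n(1), of r a c] a c r
      by (auto simp: vertices_in_cycle_iff inner_rotation_numbers_def)
    then have "even (i - (c + 1 - 2 * d))" using n(3) dvd_trans by blast
    then have "c = i - 1" using c(1) i unfolding off by auto
    then show "C = strand m n (i - 1) r" using c(2) by simp }
  { assume C: "C = strand m n (i - 1) r"
    have io: "i - 1 \<in> offsets n" using i unfolding off by auto
    then have comp: "C \<in> connected_components_of (Hom_cycles m n)"
      using r unfolding C Hom_cycles_components(1)[OF m n(1,2)] by (auto simp: strands_def)
    obtain a where "a \<in> vertices_in (cycle_graph m) (cycle_graph n) C" "a 1 = rep n (i - 1 + 1)"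
      using strand_vertex[OF m1 n1 r] C by metis
    moreover have "rep n (i - 1 + 1) = i" using i n(1) rep_ident[of i n] by auto
    ultimately show "is_Delta_even m n r i C"
      using comp component_all_returning[OF m n(1,2) r comp] io C by (auto simp: is_Delta_even_def) }
qed

lemma strand_inj_on:
  assumes m: "2 \<le> m" and n: "3 \<le> n" "n \<noteq> 4"
  shows "inj_on (\<lambda>(c, r). strand m n c r) (offsets n \<times> inner_rotation_numbers m n)"
proof (intro inj_onI)
  fix z z' assume z: "z \<in> offsets n \<times> inner_rotation_numbers m n" "z' \<in> offsets n \<times> inner_rotation_numbers m n"
    "(case z of (c, r) \<Rightarrow> strand m n c r) = (case z' of (c, r) \<Rightarrow> strand m n c r)"
  obtain c r c' r' where s: "z = (c, r)" "z' = (c', r')" by fastforce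
  have "strand m n c r \<inter> strand m n c' r' \<noteq> {}"
    using z strand_nonempty[of m n r c] m n by (auto simp: s)
  then have "c' = c \<and> r' = r"
    using z strand_inject[OF m n, of c c' r r'] by (auto simp: s inner_rotation_numbers_def)
  then show "z = z'" by (simp add: s)
qed

text \<open>\<open>R\<close> and \<open>D\<close> are given by equations so that the differently
  written index sets of the individual cases can be substituted.\<close>

lemma Delta_even_components:
  assumes m: "2 \<le> m" and n: "3 \<le> n" "n \<noteq> 4" "even n" and R: "R = inner_rotation_numbers m n"
    and D: "D = {Delta_even m n r i | r i. r \<in> R \<and> i \<in> {1, 2}}"
  shows "\<forall>r \<in> R. \<forall>i \<in> {1, 2}. \<exists>!C. is_Delta_even m n r i C"
    "D = strands m n" "card D = 2 * card R"
proof -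
  note iff = is_Delta_even_iff[OF m n]
  show "\<forall>r \<in> R. \<forall>i \<in> {1, 2}. \<exists>!C. is_Delta_even m n r i C" using iff by (simp add: R)
  have Delta: "Delta_even m n r i = strand m n (i - 1) r" if "r \<in> R" "i \<in> {1, 2}" for r i
    using that by (simp add: Delta_even_def iff R)
  have off: "offsets n = {0, 1}" using n by (simp add: offsets_def)
  show eq: "D = strands m n"
  proof (intro equalityI subsetI)
    fix C assume "C \<in> D"
    then show "C \<in> strands m n" using Delta unfolding D strands_def off R by force
  next
    fix C assume "C \<in> strands m n"
    then obtain c r where c: "C = strand m n c r" "c \<in> {0, 1}" "r \<in> R"
      unfolding strands_def off R by auto
    then have "C = Delta_even m n r (c + 1)" "c + 1 \<in> {1, 2}" using Delta[of r "c + 1"] by auto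
    then show "C \<in> D" using c(3) unfolding D by blast
  qed
  have "card D = card ({0, 1 :: int} \<times> R)"
    unfolding eq strands_def using card_image[OF strand_inj_on[OF m n(1,2)]] by (simp add: off R)
  then show "card D = 2 * card R" by (simp add: card_cartesian_product)
qed

lemma Delta_odd_components:
  assumes m: "2 \<le> m" and n: "3 \<le> n" "odd n" and R: "R = inner_rotation_numbers m n"
    and D: "D = {Delta_odd m n r | r. r \<in> R}"
  shows "\<forall>r \<in> R. \<exists>!C. is_Delta_odd m n r C" "D = strands m n" "card D = card R"
proof -
  have n4: "n \<noteq> 4" using n by auto
  note iff = is_Delta_odd_iff[OF m n]
  show "\<forall>r \<in> R. \<exists>!C. is_Delta_odd m n r C" using iff by (simp add: R)
  have Delta: "Delta_odd m n r = strand m n 0 r" if "r \<in> R" for r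
    using that by (simp add: Delta_odd_def iff R)
  have off: "offsets n = {0}" using n by (simp add: offsets_def)
  show eq: "D = strands m n"
    using Delta unfolding D strands_def off R by auto
  have "card D = card ({0 :: int} \<times> R)"
    unfolding eq strands_def using card_image[OF strand_inj_on[OF m n(1) n4]] by (simp add: off R)
  then show "card D = card R" by (simp add: card_cartesian_product)
qed

section \<open>Bipartite targets\<close>

lemma support_exists: "w \<in> vertex_simplex A \<Longrightarrow> \<exists>v. w v \<noteq> 0"
  by (rule ccontr) (auto simp: vertex_simplex_def)

lemma odd_arc_cycle: "1 \<le> n \<Longrightarrow> even n \<Longrightarrow> (u, v) \<in> parcs (cycle_graph n) \<Longrightarrow> odd (v - u)"
  using dvd_trans[of 2 n "v - u - 1"] dvd_trans[of 2 n "u - v - 1"] by (auto simp: parcs_cycle_iff)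

text \<open>Arcs of an even cycle change the parity, so along the source cycle the parity in the
  support alternates.\<close>

lemma support_parity:
  assumes m: "2 \<le> m" and n: "2 \<le> n" "even n" and p: "p \<in> topspace (Hom_cycles m n)"
    and w: "p 1 w \<noteq> 0" and x: "x \<in> {1..m}" "p x v \<noteq> 0"
  shows "even (v - w - (x - 1))"
proof -
  have m1: "1 \<le> m" and n1: "1 \<le> n" using m n by auto
  note pt = p[unfolded Hom_cycles_point_iff[OF m1 n1]]
  have odd_step: "odd (v - u)" if "y \<in> {1..m}" "p y u \<noteq> 0" "p (rep m (y + 1)) v \<noteq> 0" for y u v
    using pt that odd_arc_cycle[OF n1 n(2)] by blast
  have "1 \<le> x" using x by simp
  then have "x \<le> m \<longrightarrow> (\<forall>v. p x v \<noteq> 0 \<longrightarrow> even (v - w - (x - 1)))"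
  proof (induction x rule: int_ge_induct)
    case base
    \<comment> \<open>Two vertices in the support of the same coordinate 1 are compared through a
      common neighbour in the support of coordinate 2.\<close>
    have r2: "rep m (1 + 1) = 2" using m rep_ident[of 2 m] by simp
    have "p 2 \<in> vertex_simplex {1..n}" using pt m by auto
    then obtain z where "p 2 z \<noteq> 0" using support_exists by blast
    then have "odd (z - w)" "p 1 v \<noteq> 0 \<Longrightarrow> odd (z - v)" for v
      using odd_step[of 1] w m r2 by auto
    then show ?case by auto
  next
    case (step x)
    show ?case
    proof (intro impI allI)
      fix v assume x: "x + 1 \<le> m" and v: "p (x + 1) v \<noteq> 0"
      have "p x \<in> vertex_simplex {1..n}" using pt x step(1) by auto
      then obtain u where u: "p x u \<noteq> 0" using support_exists by blast
      then have "odd (v - u)" using odd_step[of x u v] v x step(1) rep_ident[of "x + 1" m] by simp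
      moreover have "even (u - w - (x - 1))" using step x u by simp
      ultimately show "even (v - w - (x + 1 - 1))" by presburger
    qed
  qed
  then show ?thesis using x by simp
qed

text \<open>From coordinate 1 to \<open>m\<close> the parity changes \<open>m - 1\<close> times, and
  the closing arc changes it once more; the total has to be even.\<close>

lemma Hom_odd_even_empty:
  assumes m: "2 \<le> m" "odd m" and n: "2 \<le> n" "even n"
  shows "topspace (Hom_cycles m n) = {}"
proof (rule ccontr)
  assume "\<not> ?thesis"
  then obtain p where p: "p \<in> topspace (Hom_cycles m n)" by blast
  have m1: "1 \<le> m" and n1: "1 \<le> n" using m n by auto
  note pt = p[unfolded Hom_cycles_point_iff[OF m1 n1]]
  have "p 1 \<in> vertex_simplex {1..n}" "p m \<in> vertex_simplex {1..n}" using pt m1 by auto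
  then obtain w v where wv: "p 1 w \<noteq> 0" "p m v \<noteq> 0" using support_exists by metis
  have "rep m (m + 1) = 1" using rep_eq_iff[OF m1, of "m + 1" 1] rep_ident[of 1 m] m1 by simp
  then have "(v, w) \<in> parcs (cycle_graph n)"
    using pt wv m1 by (metis atLeastAtMost_iff order_refl)
  then have "odd (w - v)" using odd_arc_cycle[OF n1 n(2)] by blast
  moreover have "even (v - w - (m - 1))" using support_parity[OF m(1) n p wv(1) _ wv(2)] m1 by simp
  ultimately show False using m(2) by presburger
qed

text \<open>\<open>C\<^sub>4\<close> is complete bipartite, so that \<open>Hom(C\<^sub>m, C\<^sub>4)\<close> consists of two convex cells, told apart
  by the parity \<open>b\<close>.\<close>

definition C4_cell :: "int \<Rightarrow> int \<Rightarrow> (int \<Rightarrow> int \<Rightarrow> real) set" where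
  "C4_cell m b = {p. (\<forall>x \<in> {1..m}. p x \<in> vertex_simplex {1..4} \<and> (\<forall>v. p x v \<noteq> 0 \<longrightarrow> even (v - x - b))) \<and>
     (\<forall>x. x \<notin> {1..m} \<longrightarrow> p x = (\<lambda>_. 0))}"

lemma parcs_C4:
  assumes "u \<in> {1..4}" "v \<in> {1..4}" "odd (v - u)"
  shows "(u, v) \<in> parcs (cycle_graph 4)"
proof -
  have "u \<in> {1, 2, 3, 4}" "v \<in> {1, 2, 3, 4}" using assms by auto
  then show ?thesis using assms(3) by (auto simp: parcs_cycle_iff)
qed

lemma topspace_Hom_C4:
  assumes m: "2 \<le> m" "even m"
  shows "topspace (Hom_cycles m 4) = C4_cell m 0 \<union> C4_cell m 1"
proof (intro equalityI subsetI)
  have m1: "1 \<le> m" using m by simp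
  note iff = Hom_cycles_point_iff[OF m1, of 4, simplified]
  fix p
  { assume p: "p \<in> topspace (Hom_cycles m 4)"
    then have "p 1 \<in> vertex_simplex {1..4}" using iff m1 by auto
    then obtain w where w: "p 1 w \<noteq> 0" using support_exists by blast
    have ev: "even (v - x - b)" if "x \<in> {1..m}" "p x v \<noteq> 0" "even (w - 1 - b)" for x v b
    proof -
      have "even (v - w - (x - 1))" using support_parity[OF m(1) _ _ p w that(1,2)] by simp
      then show ?thesis using that(3) by presburger
    qed
    have "p \<in> C4_cell m b" if "even (w - 1 - b)" for b
      unfolding C4_cell_def
    proof (intro CollectI conjI ballI allI impI)
      show "even (v - x - b)" if "x \<in> {1..m}" "p x v \<noteq> 0" for x v
        using ev that \<open>even (w - 1 - b)\<close> by blast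
    qed (use iff[THEN iffD1, OF p] in auto)
    moreover have "even (w - 1 - 0) \<or> even (w - 1 - 1)" by simp
    ultimately show "p \<in> C4_cell m 0 \<union> C4_cell m 1" by blast }
  { assume "p \<in> C4_cell m 0 \<union> C4_cell m 1"
    then obtain b where p: "p \<in> C4_cell m b" by blast
    have "(u, v) \<in> parcs (cycle_graph 4)" if x: "x \<in> {1..m}" "p x u \<noteq> 0" "p (rep m (x + 1)) v \<noteq> 0" for x u v
    proof (rule parcs_C4)
      have y: "rep m (x + 1) \<in> {1..m}" by (rule rep_range[OF m1])
      show "u \<in> {1..4}" "v \<in> {1..4}"
        using p x y unfolding C4_cell_def vertex_simplex_def by blast+
      \<comment> \<open>Evenness of \<open>m\<close> lets the alternating pattern survive the
        passage from \<open>m\<close> back to 1.\<close>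
      have "m dvd rep m (x + 1) - (x + 1)" using rep_cong[OF m1] by (simp add: cong_iff_dvd_diff)
      then have "even (rep m (x + 1) - (x + 1))" using m(2) dvd_trans by blast
      moreover have "even (u - x - b)" "even (v - rep m (x + 1) - b)"
        using p x y unfolding C4_cell_def by blast+
      ultimately show "odd (v - u)" by auto
    qed
    then show "p \<in> topspace (Hom_cycles m 4)" using p iff by (auto simp: C4_cell_def) }
qed

lemma C4_cell_convex:
  assumes p: "p \<in> C4_cell m b" and q: "q \<in> C4_cell m b" and t: "t \<in> {0..1}"
  shows "(\<lambda>x v. (1 - t) * p x v + t * q x v) \<in> C4_cell m b"
proof -
  have "(\<lambda>v. (1 - t) * p x v + t * q x v) \<in> vertex_simplex {1..4}" if "x \<in> {1..m}" for x
    using p q t that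
    by (auto simp: C4_cell_def vertex_simplex_def sum.distrib simp flip: sum_distrib_left)
  moreover have "even (v - x - b)" if "x \<in> {1..m}" "(1 - t) * p x v + t * q x v \<noteq> 0" for x v
  proof -
    have "p x v \<noteq> 0 \<or> q x v \<noteq> 0" using that(2) by auto
    then show ?thesis using p q that(1) unfolding C4_cell_def by blast
  qed
  ultimately show ?thesis using p q unfolding C4_cell_def by auto
qed

lemma C4_cell_vertex: "vertex_point m (\<lambda>x. rep 4 (x + b)) \<in> C4_cell m b"
proof -
  have "even (rep 4 (x + b) - x - b)" for x
  proof -
    have "4 dvd rep 4 (x + b) - (x + b)" using rep_cong[of 4 "x + b"] by (simp add: cong_iff_dvd_diff)
    then have "even (rep 4 (x + b) - (x + b))" by (rule dvd_trans[rotated]) simp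
    then show ?thesis by (simp add: algebra_simps)
  qed
  moreover have "(\<lambda>v. of_bool (v = rep 4 (x + b))) \<in> vertex_simplex {1..4}" for x
    using rep_range[of 4 "x + b"] by (auto simp: vertex_simplex_def of_bool_def)
  moreover have "vertex_point m (\<lambda>x. rep 4 (x + b)) x = (\<lambda>v. of_bool (v = rep 4 (x + b)))" if "x \<in> {1..m}" for x
    using that by (auto simp: vertex_point_def)
  ultimately show ?thesis
    unfolding C4_cell_def by (auto simp: vertex_point_def)
qed

text \<open>The mass that coordinate 1 puts on odd vertices is a continuous function separating the
  two cells; it supplies the map to the 0-sphere.\<close>

lemma C4_cell_mass:
  assumes m: "1 \<le> m" and p: "p \<in> C4_cell m b" and b: "b \<in> {0, 1}"
  shows "p 1 1 + p 1 3 = 1 - of_int b"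
proof -
  have s: "p 1 \<in> vertex_simplex {1..4}" and e: "\<And>v. p 1 v \<noteq> 0 \<Longrightarrow> even (v - 1 - b)"
  proof -
    have "1 \<in> {1..m}" using m by simp
    then show "p 1 \<in> vertex_simplex {1..4}" "\<And>v. p 1 v \<noteq> 0 \<Longrightarrow> even (v - 1 - b)"
      using p unfolding C4_cell_def by blast+
  qed
  have "{1..4} = {1, 2, 3, 4 :: int}" by auto
  then have "p 1 1 + p 1 2 + p 1 3 + p 1 4 = 1" using s by (simp add: vertex_simplex_def)
  then show ?thesis using b e[of 1] e[of 2] e[of 3] e[of 4]
    by (cases "p 1 1 = 0"; cases "p 1 2 = 0"; cases "p 1 3 = 0"; cases "p 1 4 = 0") auto
qed

lemma Hom_C4_homotopy_S0:
  assumes m: "2 \<le> m" "even m"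
  shows "Hom_cycles m 4 homotopy_equivalent_space nsphere 0"
proof -
  have m1: "1 \<le> m" using m by simp
  let ?X = "C4_cell m 0 \<union> C4_cell m 1"
  let ?D = "{x. (\<Sum>i\<le>0::nat. x i ^ 2) = 1 \<and> (\<forall>i>0. x i = (0::real))}"
  have X: "Hom_cycles m 4 = top_of_set ?X"
    using topspace_Hom_C4[OF m] by (simp add: hom_complex_def)
  define V where "V b = vertex_point m (\<lambda>x. rep 4 (x + b))" for b
  have V: "V b \<in> C4_cell m b" for b unfolding V_def by (rule C4_cell_vertex)
  \<comment> \<open>The affine rescaling sends the masses 1 and 0 to the points 1 and -1 of the
    0-sphere.\<close>
  define f where "f p = (\<lambda>i::nat. if i = 0 then 2 * (p 1 1 + p 1 3) - 1 else 0)" for p :: "int \<Rightarrow> int \<Rightarrow> real"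
  \<comment> \<open>The affine formula takes the value \<open>V 0\<close> at 1 and
    \<open>V 1\<close> at -1; it makes \<open>g\<close> continuous without a case
    distinction.\<close>
  define g where "g y = (\<lambda>x v. (1 + y 0) / 2 * V 0 x v + (1 - y 0) / 2 * V 1 x v)" for y :: "nat \<Rightarrow> real"
  \<comment> \<open>Each cell contracts along straight lines to its base vertex, as
    \<open>g (f p)\<close> lies in the convex cell of \<open>p\<close>.\<close>
  define h where "h = (\<lambda>(t, p) x v. (1 - t) * g (f p) x v + t * p x v)"
  have f_cell: "f p = (\<lambda>i. if i = 0 then 1 - 2 * of_int b else 0)" if "p \<in> C4_cell m b" "b \<in> {0, 1}" for p b
    using C4_cell_mass[OF m1 that] by (auto simp: f_def)
  have g_cell: "g (\<lambda>i. if i = 0 then 1 - 2 * of_int b else 0) = V b" if "b \<in> {0, 1}" for b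
    using that by (auto simp: g_def)
  have D: "y \<in> ?D \<longleftrightarrow> (\<exists>b \<in> {0, 1 :: int}. y = (\<lambda>i. if i = 0 then 1 - 2 * of_int b else 0))" for y
    by (auto simp: power2_eq_1_iff fun_eq_iff)
  have cc: "continuous_on S (\<lambda>z. F z x v)" if "continuous_on S F"
    for S :: "'z::topological_space set" and F :: "'z \<Rightarrow> int \<Rightarrow> int \<Rightarrow> real" and x v
    using continuous_on_product_then_coordinatewise[OF continuous_on_product_then_coordinatewise[OF that]] .
  have cf: "continuous_on S f" for S
  proof (intro continuous_on_coordinatewise_then_product)
    have "continuous_on S (\<lambda>p :: int \<Rightarrow> int \<Rightarrow> real. 2 * (p 1 1 + p 1 3) - 1)"
      by (intro continuous_on_diff continuous_on_mult continuous_on_add continuous_on_const cc[OF continuous_on_id])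
    then show "continuous_on S (\<lambda>p. f p i)" for i
      by (cases "i = 0") (simp_all add: f_def)
  qed
  have cg: "continuous_on S g" for S
    unfolding g_def divide_inverse
    by (intro continuous_on_coordinatewise_then_product continuous_on_add continuous_on_mult continuous_on_diff
        continuous_on_const continuous_on_product_then_coordinatewise[OF continuous_on_id])
  have cgf: "continuous_on S (\<lambda>z. g (f (snd z)))" for S :: "(real \<times> (int \<Rightarrow> int \<Rightarrow> real)) set"
    by (intro continuous_on_compose2[OF cg[of UNIV]] continuous_on_compose2[OF cf[of UNIV]]
        continuous_on_snd continuous_on_id) auto
  have ch: "continuous_on S h" for S
    unfolding h_def case_prod_unfold
    by (intro continuous_on_coordinatewise_then_product continuous_on_add continuous_on_mult continuous_on_diff
        continuous_on_const continuous_on_fst continuous_on_id cc[OF cgf]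
        cc[OF continuous_on_snd[OF continuous_on_id]])
  have fD: "f p \<in> ?D" if "p \<in> ?X" for p
    using that f_cell unfolding D by blast
  have gX: "g y \<in> ?X" if "y \<in> ?D" for y
    using that g_cell V unfolding D by fastforce
  have hX: "h (t, p) \<in> ?X" if t: "t \<in> {0..1}" and "p \<in> ?X" for t p
  proof -
    obtain b where b: "p \<in> C4_cell m b" "b \<in> {0, 1}" using \<open>p \<in> ?X\<close> by auto
    then have "g (f p) = V b" using f_cell g_cell by simp
    then have "h (t, p) \<in> C4_cell m b" using C4_cell_convex[OF V b(1) t] by (simp add: h_def)
    then show ?thesis using b(2) by auto
  qed
  have hX': "h ` ({0..1} \<times> ?X) \<subseteq> ?X"
  proof
    fix y assume "y \<in> h ` ({0..1} \<times> ?X)"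
    then obtain t p where "t \<in> {0..1}" "p \<in> ?X" "y = h (t, p)" by blast
    then show "y \<in> ?X" using hX by metis
  qed
  have "homotopic_with (\<lambda>x. True) (top_of_set ?X) (top_of_set ?X) (g \<circ> f) id"
    unfolding homotopic_with_def
  proof (intro exI conjI)
    show "continuous_map (prod_topology (top_of_set {0..1}) (top_of_set ?X)) (top_of_set ?X) h"
      unfolding prod_topology_subtopology_eu continuous_map_subtopology_eu
      using ch hX' by (simp only: image_subset_iff_funcset)
  qed (auto simp: h_def)
  moreover have "homotopic_with (\<lambda>x. True) (top_of_set ?D) (top_of_set ?D) (f \<circ> g) id"
  proof (rule homotopic_with_equal)
    show "(f \<circ> g) y = id y" if "y \<in> topspace (top_of_set ?D)" for y
    proof -
      have "y \<in> ?D" using that by simp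
      then obtain b :: int where b: "b \<in> {0, 1}" "y = (\<lambda>i. if i = 0 then 1 - 2 * of_int b else 0)"
        unfolding D by blast
      then show ?thesis using f_cell[OF V b(1)] g_cell[OF b(1)] by simp
    qed
    show "continuous_map (top_of_set ?D) (top_of_set ?D) (f \<circ> g)"
      using continuous_on_compose[OF cg cf] fD gX by auto
  qed auto
  moreover have "continuous_map (top_of_set ?X) (top_of_set ?D) f" using fD cf by auto
  moreover have "continuous_map (top_of_set ?D) (top_of_set ?X) g" using gX cg by auto
  ultimately show ?thesis
    unfolding homotopy_equivalent_space_def X nsphere_top_of_set by blast
qed

section \<open>Counting rotation numbers\<close>

lemma odd_floor_eq: "odd_floor x = (if odd \<lfloor>x\<rfloor> then \<lfloor>x\<rfloor> else \<lfloor>x\<rfloor> - 1)"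
  unfolding odd_floor_def
proof (rule Greatest_equality)
  fix j :: int assume "odd j \<and> of_int j \<le> x"
  then have "odd j" "j \<le> \<lfloor>x\<rfloor>" by (auto simp: le_floor_iff)
  then show "j \<le> (if odd \<lfloor>x\<rfloor> then \<lfloor>x\<rfloor> else \<lfloor>x\<rfloor> - 1)" by (cases "j = \<lfloor>x\<rfloor>") auto
qed (auto, linarith)

lemma even_floor_eq: "even_floor x = (if even \<lfloor>x\<rfloor> then \<lfloor>x\<rfloor> else \<lfloor>x\<rfloor> - 1)"
  unfolding even_floor_def
proof (rule Greatest_equality)
  fix j :: int assume "even j \<and> of_int j \<le> x"
  then have "even j" "j \<le> \<lfloor>x\<rfloor>" by (auto simp: le_floor_iff)
  then show "j \<le> (if even \<lfloor>x\<rfloor> then \<lfloor>x\<rfloor> else \<lfloor>x\<rfloor> - 1)" by (cases "j = \<lfloor>x\<rfloor>") auto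
qed (auto, linarith)

lemma le_floor_divide_iff: "0 < n \<Longrightarrow> t \<le> \<lfloor>real_of_int m / real_of_int n\<rfloor> \<longleftrightarrow> t * n \<le> m"
  by (simp add: le_floor_iff pos_le_divide_eq flip: of_int_mult)

lemma card_image_interval:
  fixes a b :: int
  assumes "inj_on f {a..b}" "a \<le> b + 1"
  shows "int (card (f ` {a..b})) = b - a + 1"
  using assms by (simp add: card_image)

text \<open>As \<open>n\<close> is odd, \<open>m + t * n\<close> is even exactly when
  \<open>t\<close> has the parity of \<open>m\<close>. Odd and even \<open>m\<close> are thus
  treated together, \<open>T\<close> standing for \<open>odd_floor\<close> or
  \<open>even_floor\<close> of \<open>m / n\<close>. The value \<open>T = - 1\<close> occurs for odd
  \<open>m < n\<close>, where the set is empty.\<close>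

lemma inner_rotation_numbers_odd:
  assumes n: "3 \<le> n" "odd n" and m: "2 \<le> m" "\<not> n dvd m" and T: "even (T - m)" "- 1 \<le> T"
    and T_iff: "\<And>t. even (t - m) \<Longrightarrow> t \<le> T \<longleftrightarrow> t * n \<le> m"
  shows "{(m + t * n) div 2 | t. even (t - m) \<and> \<bar>t\<bar> \<le> T} = inner_rotation_numbers m n"
    and "int (card (inner_rotation_numbers m n)) = T + 1"
proof -
  have strict: "\<bar>t\<bar> \<le> T \<longleftrightarrow> - m < t * n \<and> t * n < m" if "even (t - m)" for t
  proof -
    \<comment> \<open>As \<open>n\<close> does not divide \<open>m\<close>, the extreme values are
      not attained and \<open>r\<close> stays strictly between 0 and \<open>m\<close>.\<close>
    have ne: "t * n \<noteq> m" "- t * n \<noteq> m" using m(2) by (metis dvd_triv_right)+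
    have "\<bar>t\<bar> \<le> T \<longleftrightarrow> t \<le> T \<and> - t \<le> T" by auto
    also have "\<dots> \<longleftrightarrow> t * n \<le> m \<and> - t * n \<le> m"
      using T_iff[of t] T_iff[of "- t"] that by (simp add: even_diff_iff)
    finally show ?thesis using ne by auto
  qed
  have half: "2 * ((m + t * n) div 2) = m + t * n" if "even (t - m)" for t
    using that n(2) by (auto intro!: dvd_mult_div_cancel)
  show eq: "{(m + t * n) div 2 | t. even (t - m) \<and> \<bar>t\<bar> \<le> T} = inner_rotation_numbers m n"
  proof (intro equalityI subsetI)
    fix r assume "r \<in> {(m + t * n) div 2 | t. even (t - m) \<and> \<bar>t\<bar> \<le> T}"
    then obtain t where t: "r = (m + t * n) div 2" "even (t - m)" "\<bar>t\<bar> \<le> T" by blast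
    then have "2 * r = m + t * n" "- m < t * n" "t * n < m" using half strict by auto
    moreover from this have "m - 2 * r = n * (- t)" by (simp add: algebra_simps)
    then have "n dvd m - 2 * r" by (metis dvd_triv_left)
    ultimately show "r \<in> inner_rotation_numbers m n" by (simp add: inner_rotation_numbers_def)
  next
    fix r assume "r \<in> inner_rotation_numbers m n"
    then have r: "0 < r" "r < m" "n dvd m - 2 * r" by (auto simp: inner_rotation_numbers_def)
    then obtain k where k: "m - 2 * r = n * k" by (auto elim: dvdE)
    then have rk: "2 * r = m + (- k) * n" by (simp add: algebra_simps)
    have "even (m - n * k)" using k by (metis dvd_triv_left diff_diff_eq2 add_diff_cancel_left' diff_add_cancel)
    then have e: "even (- k - m)" using n(2) by auto
    moreover have "\<bar>- k\<bar> \<le> T" using strict[OF e] rk r by simp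
    moreover have "r = (m + (- k) * n) div 2" using rk by simp
    ultimately show "r \<in> {(m + t * n) div 2 | t. even (t - m) \<and> \<bar>t\<bar> \<le> T}" by blast
  qed
  \<comment> \<open>\<open>t = 2 * j - T\<close> enumerates the integers between \<open>- T\<close>
    and \<open>T\<close> with the parity of \<open>T\<close>.\<close>
  have "inner_rotation_numbers m n = (\<lambda>j. (m + (2 * j - T) * n) div 2) ` {0..T}"
    unfolding eq[symmetric]
  proof (intro equalityI subsetI)
    fix r assume "r \<in> {(m + t * n) div 2 | t. even (t - m) \<and> \<bar>t\<bar> \<le> T}"
    then obtain t where t: "r = (m + t * n) div 2" "even (t - m)" "\<bar>t\<bar> \<le> T" by blast
    then have "even (t + T)" using T(1) by auto
    then obtain j where "t + T = 2 * j" by (rule evenE)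
    then have "t = 2 * j - T" "j \<in> {0..T}" using t(3) by auto
    then show "r \<in> (\<lambda>j. (m + (2 * j - T) * n) div 2) ` {0..T}" using t(1) by blast
  next
    fix r assume "r \<in> (\<lambda>j. (m + (2 * j - T) * n) div 2) ` {0..T}"
    then obtain j where "r = (m + (2 * j - T) * n) div 2" "j \<in> {0..T}" by blast
    moreover from this have "even (2 * j - T - m)" "\<bar>2 * j - T\<bar> \<le> T" using T(1) by auto
    ultimately show "r \<in> {(m + t * n) div 2 | t. even (t - m) \<and> \<bar>t\<bar> \<le> T}" by blast
  qed
  moreover have "inj_on (\<lambda>j. (m + (2 * j - T) * n) div 2) {0..T}"
  proof (rule inj_onI)
    fix i j assume "(m + (2 * i - T) * n) div 2 = (m + (2 * j - T) * n) div 2"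
    moreover have "even (2 * i - T - m)" "even (2 * j - T - m)" using T(1) by auto
    ultimately have "m + (2 * i - T) * n = m + (2 * j - T) * n" using half by metis
    then show "i = j" using n(1) by simp
  qed
  ultimately show "int (card (inner_rotation_numbers m n)) = T + 1"
    using T(2) card_image_interval[of "\<lambda>j. (m + (2 * j - T) * n) div 2" 0 T] by simp
qed

text \<open>Halving turns the closing condition into \<open>l dvd r - k\<close>, so \<open>r\<close>
  runs through an arithmetic progression around \<open>k\<close>; the bounds are strict because
  \<open>l\<close> does not divide \<open>k\<close>.\<close>

lemma inner_rotation_numbers_even:
  assumes l: "0 < l" "\<not> l dvd k" and k: "0 < k"
  shows "{k + t * l | t. \<bar>t\<bar> \<le> \<lfloor>real_of_int k / real_of_int l\<rfloor>} = inner_rotation_numbers (2 * k) (2 * l)"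
    and "int (card (inner_rotation_numbers (2 * k) (2 * l))) = 2 * \<lfloor>real_of_int k / real_of_int l\<rfloor> + 1"
proof -
  let ?F = "\<lfloor>real_of_int k / real_of_int l\<rfloor>"
  have strict: "\<bar>t\<bar> \<le> ?F \<longleftrightarrow> - k < t * l \<and> t * l < k" for t
  proof -
    have ne: "t * l \<noteq> k" "- t * l \<noteq> k" using l(2) by (metis dvd_triv_right)+
    have "\<bar>t\<bar> \<le> ?F \<longleftrightarrow> t \<le> ?F \<and> - t \<le> ?F" by auto
    also have "\<dots> \<longleftrightarrow> t * l \<le> k \<and> - t * l \<le> k"
      using le_floor_divide_iff[OF l(1)] by metis
    finally show ?thesis using ne by auto
  qed
  have dvd: "2 * l dvd 2 * k - 2 * r \<longleftrightarrow> l dvd r - k" for r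
  proof -
    have "2 * k - 2 * r = 2 * (k - r)" by simp
    then show ?thesis by (metis dvd_diff_commute dvd_mult_cancel_left zero_neq_numeral)
  qed
  show eq: "{k + t * l | t. \<bar>t\<bar> \<le> ?F} = inner_rotation_numbers (2 * k) (2 * l)"
  proof (intro equalityI subsetI)
    fix r assume "r \<in> {k + t * l | t. \<bar>t\<bar> \<le> ?F}"
    then show "r \<in> inner_rotation_numbers (2 * k) (2 * l)"
      unfolding inner_rotation_numbers_def dvd by (auto simp: strict)
  next
    fix r assume r: "r \<in> inner_rotation_numbers (2 * k) (2 * l)"
    then obtain t where t: "r - k = l * t" unfolding inner_rotation_numbers_def dvd by (auto elim: dvdE)
    then have "r = k + t * l" by (simp add: algebra_simps)
    moreover from this have "\<bar>t\<bar> \<le> ?F" using r by (auto simp: strict inner_rotation_numbers_def)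
    ultimately show "r \<in> {k + t * l | t. \<bar>t\<bar> \<le> ?F}" by blast
  qed
  have "{k + t * l | t. \<bar>t\<bar> \<le> ?F} = (\<lambda>t. k + t * l) ` {- ?F..?F}" by (auto simp: abs_le_iff)
  moreover have "inj_on (\<lambda>t. k + t * l) {- ?F..?F}" using l(1) by (auto intro: inj_onI)
  moreover have "0 \<le> ?F" using strict[of 0] k by simp
  ultimately show "int (card (inner_rotation_numbers (2 * k) (2 * l))) = 2 * ?F + 1"
    using card_image_interval[of "\<lambda>t. k + t * l" "- ?F" ?F] unfolding eq[symmetric] by simp
qed

text \<open>Serves both cases in which isolated points occur: even \<open>n = 2 * l\<close> with
  \<open>e = l\<close> and \<open>2 * s\<close> in place of \<open>s\<close>, and odd
  \<open>n\<close> with \<open>e = n\<close>.\<close>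

lemma inner_rotation_numbers_multiples:
  assumes e: "0 < e" and s: "1 \<le> s" and dvd: "\<And>r. n dvd s * e - 2 * r \<longleftrightarrow> e dvd r"
  shows "{j * e | j. 1 \<le> j \<and> j \<le> s - 1} = inner_rotation_numbers (s * e) n"
    and "int (card (inner_rotation_numbers (s * e) n)) = s - 1"
proof -
  show eq: "{j * e | j. 1 \<le> j \<and> j \<le> s - 1} = inner_rotation_numbers (s * e) n"
  proof (intro equalityI subsetI)
    fix r assume "r \<in> {j * e | j. 1 \<le> j \<and> j \<le> s - 1}"
    then show "r \<in> inner_rotation_numbers (s * e) n"
      using e by (auto simp: inner_rotation_numbers_def dvd)
  next
    fix r assume "r \<in> inner_rotation_numbers (s * e) n"
    then have r: "0 < r" "r < s * e" "e dvd r" by (auto simp: inner_rotation_numbers_def dvd)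
    then obtain j where j: "r = j * e" by (metis dvdE mult.commute)
    then have "0 < j" "j < s" using r e by (auto simp: zero_less_mult_iff)
    then show "r \<in> {j * e | j. 1 \<le> j \<and> j \<le> s - 1}" using j by auto
  qed
  have "{j * e | j. 1 \<le> j \<and> j \<le> s - 1} = (\<lambda>j. j * e) ` {1..s - 1}" by auto
  moreover have "inj_on (\<lambda>j. j * e) {1..s - 1}" using e by (auto intro: inj_onI)
  ultimately show "int (card (inner_rotation_numbers (s * e) n)) = s - 1"
    using card_image_interval[of "\<lambda>j. j * e" 1 "s - 1"] s unfolding eq[symmetric] by simp
qed

text \<open>For \<open>n \<ge> 3\<close>, \<open>n \<noteq> 4\<close> it remains to compute
  \<open>inner_rotation_numbers m n\<close>: each member gives one circle for odd \<open>n\<close>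
  and two for even \<open>n\<close>, and the \<open>2 * n\<close> rotations appear exactly when
  \<open>n dvd m\<close>. The target \<open>C_4\<close> and the case of odd \<open>m\<close> with
  even \<open>n\<close> are settled by parity.\<close>

theorem mainTheorem3:
  fixes m n :: int
  assumes "2 \<le> m" and "2 \<le> n"
  shows
    "(\<forall>k. n = 4 \<and> m = 2 * k \<longrightarrow>
        Hom_cycles m n homotopy_equivalent_space nsphere 0) \<and>
     (\<forall>l s. n = 2 * l \<and> l \<noteq> 2 \<and> l \<noteq> 1 \<and> m = 2 * s * l \<and> 1 \<le> s \<longrightarrow>
        (let R = {j * l | j. 1 \<le> j \<and> j \<le> 2 * s - 1};
             D = {Delta_even m n r i | r i. r \<in> R \<and> i \<in> {1, 2}}
         in (\<forall>r \<in> R. \<forall>i \<in> {1, 2}. \<exists>!C. is_Delta_even m n r i C) \<and>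
            (\<exists>P. connected_components_of (Hom_cycles m n) = P \<union> D \<and> P \<inter> D = {} \<and>
               int (card P) = 2 * n \<and> (\<forall>C \<in> P. \<exists>p. C = {p}) \<and>
               int (card D) = 4 * s - 2 \<and>
               (\<forall>C \<in> D. homotopy_circle (subtopology (Hom_cycles m n) C))))) \<and>
     (\<forall>l k. n = 2 * l \<and> l \<noteq> 2 \<and> m = 2 * k \<and> \<not> l dvd k \<longrightarrow>
        (let R = {k + t * l | t. \<bar>t\<bar> \<le> \<lfloor>real_of_int k / real_of_int l\<rfloor>};
             D = {Delta_even m n r i | r i. r \<in> R \<and> i \<in> {1, 2}}
         in (\<forall>r \<in> R. \<forall>i \<in> {1, 2}. \<exists>!C. is_Delta_even m n r i C) \<and>
            connected_components_of (Hom_cycles m n) = D \<and>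
            int (card D) = 2 * (2 * \<lfloor>real_of_int k / real_of_int l\<rfloor> + 1) \<and>
            (\<forall>C \<in> D. homotopy_circle (subtopology (Hom_cycles m n) C)))) \<and>
     (\<forall>l k. n = 2 * l \<and> m = 2 * k + 1 \<longrightarrow>
        topspace (Hom_cycles m n) = {}) \<and>
     (\<forall>l s. n = 2 * l + 1 \<and> m = s * n \<and> 1 \<le> s \<longrightarrow>
        (let R = {j * n | j. 1 \<le> j \<and> j \<le> s - 1};
             D = {Delta_odd m n r | r. r \<in> R}
         in (\<forall>r \<in> R. \<exists>!C. is_Delta_odd m n r C) \<and>
            (\<exists>P. connected_components_of (Hom_cycles m n) = P \<union> D \<and> P \<inter> D = {} \<and>
               int (card P) = 2 * n \<and> (\<forall>C \<in> P. \<exists>p. C = {p}) \<and>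
               int (card D) = s - 1 \<and>
               (\<forall>C \<in> D. homotopy_circle (subtopology (Hom_cycles m n) C))))) \<and>
     (\<forall>l k. n = 2 * l + 1 \<and> m = 2 * k + 1 \<and> \<not> n dvd m \<longrightarrow>
        (let R = {(m + t * n) div 2 | t. odd t \<and> \<bar>t\<bar> \<le> odd_floor (real_of_int m / real_of_int n)};
             D = {Delta_odd m n r | r. r \<in> R}
         in (\<forall>r \<in> R. \<exists>!C. is_Delta_odd m n r C) \<and>
            connected_components_of (Hom_cycles m n) = D \<and>
            int (card D) = odd_floor (real_of_int m / real_of_int n) + 1 \<and>
            (\<forall>C \<in> D. homotopy_circle (subtopology (Hom_cycles m n) C)))) \<and>
     (\<forall>l k. n = 2 * l + 1 \<and> m = 2 * k \<and> \<not> n dvd m \<longrightarrow>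
        (let R = {k + (t * n) div 2 | t. even t \<and> \<bar>t\<bar> \<le> even_floor (real_of_int m / real_of_int n)};
             D = {Delta_odd m n r | r. r \<in> R}
         in (\<forall>r \<in> R. \<exists>!C. is_Delta_odd m n r C) \<and>
            connected_components_of (Hom_cycles m n) = D \<and>
            int (card D) = even_floor (real_of_int m / real_of_int n) + 1 \<and>
            (\<forall>C \<in> D. homotopy_circle (subtopology (Hom_cycles m n) C))))"
proof (intro conjI allI impI)
  fix k assume "n = 4 \<and> m = 2 * k"
  then show "Hom_cycles m n homotopy_equivalent_space nsphere 0"
    using Hom_C4_homotopy_S0[of m] assms(1) by simp
next
  fix l s assume h: "n = 2 * l \<and> l \<noteq> 2 \<and> l \<noteq> 1 \<and> m = 2 * s * l \<and> 1 \<le> s"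
  then have n: "3 \<le> n" "n \<noteq> 4" "even n" using assms(2) by auto
  have l: "0 < l" using n(1) h by simp
  define R where "R = {j * l | j. 1 \<le> j \<and> j \<le> 2 * s - 1}"
  define D where "D = {Delta_even m n r i | r i. r \<in> R \<and> i \<in> {1, 2}}"
  have dvd: "n dvd (2 * s) * l - 2 * r \<longleftrightarrow> l dvd r" for r
  proof -
    have "(2 * s) * l - 2 * r = 2 * (l * s - r)" by (simp add: algebra_simps)
    moreover have "2 * l dvd 2 * x \<longleftrightarrow> l dvd x" for x by simp
    ultimately have "n dvd (2 * s) * l - 2 * r \<longleftrightarrow> l dvd l * s - r" using h by metis
    then show ?thesis by (simp add: dvd_diff_right_iff)
  qed
  have "1 \<le> 2 * s" using h by simp
  note R = inner_rotation_numbers_multiples[OF l this dvd, folded R_def]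
  have R_eq: "R = inner_rotation_numbers m n" using R(1) h by simp
  note DD = Delta_even_components[OF assms(1) n R_eq D_def]
  note comps = Hom_cycles_components[OF assms(1) n(1,2), folded DD(2)]
  have "n dvd m" using h by simp
  then have "int (card (rotations m n)) = 2 * n" by (rule card_rotations[OF assms(1) n(1)])
  moreover have "int (card D) = 4 * s - 2" using DD(3) R(2) h R_eq by simp
  moreover have "\<forall>C \<in> rotations m n. \<exists>p. C = {p}" by (auto simp: rotations_def)
  moreover have "\<forall>C \<in> D. homotopy_circle (subtopology (Hom_cycles m n) C)"
    using strands_homotopy_circle[OF assms(1) n(1,2)] DD(2) by simp
  ultimately show "let R = {j * l | j. 1 \<le> j \<and> j \<le> 2 * s - 1};
             D = {Delta_even m n r i | r i. r \<in> R \<and> i \<in> {1, 2}}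
         in (\<forall>r \<in> R. \<forall>i \<in> {1, 2}. \<exists>!C. is_Delta_even m n r i C) \<and>
            (\<exists>P. connected_components_of (Hom_cycles m n) = P \<union> D \<and> P \<inter> D = {} \<and>
               int (card P) = 2 * n \<and> (\<forall>C \<in> P. \<exists>p. C = {p}) \<and>
               int (card D) = 4 * s - 2 \<and>
               (\<forall>C \<in> D. homotopy_circle (subtopology (Hom_cycles m n) C)))"
    unfolding Let_def R_def[symmetric] D_def[symmetric] using DD(1) comps by blast
next
  fix l k assume h: "n = 2 * l \<and> l \<noteq> 2 \<and> m = 2 * k \<and> \<not> l dvd k"
  \<comment> \<open>1 divides \<open>k\<close>; this excludes \<open>n = 2\<close>.\<close>
  then have "l \<noteq> 1" by auto
  then have n: "3 \<le> n" "n \<noteq> 4" "even n" using assms(2) h by auto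
  define R where "R = {k + t * l | t. \<bar>t\<bar> \<le> \<lfloor>real_of_int k / real_of_int l\<rfloor>}"
  define D where "D = {Delta_even m n r i | r i. r \<in> R \<and> i \<in> {1, 2}}"
  have lk: "0 < l" "\<not> l dvd k" "0 < k" using n(1) h assms(1) by auto
  note R = inner_rotation_numbers_even[OF lk, folded R_def]
  have R_eq: "R = inner_rotation_numbers m n" using R(1) h by simp
  note DD = Delta_even_components[OF assms(1) n R_eq D_def]
  note comps = Hom_cycles_components[OF assms(1) n(1,2), folded DD(2)]
  have "\<not> n dvd m" using h by simp
  then have "rotations m n = {}" by (simp add: rotations_def)
  then have "connected_components_of (Hom_cycles m n) = D" using comps by simp
  moreover have "int (card D) = 2 * (2 * \<lfloor>real_of_int k / real_of_int l\<rfloor> + 1)"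
    using DD(3) R(2) h R_eq by simp
  moreover have "\<forall>C \<in> D. homotopy_circle (subtopology (Hom_cycles m n) C)"
    using strands_homotopy_circle[OF assms(1) n(1,2)] DD(2) by simp
  ultimately show "let R = {k + t * l | t. \<bar>t\<bar> \<le> \<lfloor>real_of_int k / real_of_int l\<rfloor>};
             D = {Delta_even m n r i | r i. r \<in> R \<and> i \<in> {1, 2}}
         in (\<forall>r \<in> R. \<forall>i \<in> {1, 2}. \<exists>!C. is_Delta_even m n r i C) \<and>
            connected_components_of (Hom_cycles m n) = D \<and>
            int (card D) = 2 * (2 * \<lfloor>real_of_int k / real_of_int l\<rfloor> + 1) \<and>
            (\<forall>C \<in> D. homotopy_circle (subtopology (Hom_cycles m n) C))"
    unfolding Let_def R_def[symmetric] D_def[symmetric] using DD(1) by blast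
next
  fix l k assume "n = 2 * l \<and> m = 2 * k + 1"
  then show "topspace (Hom_cycles m n) = {}"
    using Hom_odd_even_empty[OF assms(1) _ assms(2)] by simp
next
  fix l s assume h: "n = 2 * l + 1 \<and> m = s * n \<and> 1 \<le> s"
  then have n: "3 \<le> n" "odd n" using assms(2) by auto
  have n4: "n \<noteq> 4" using n(2) by auto
  define R where "R = {j * n | j. 1 \<le> j \<and> j \<le> s - 1}"
  define D where "D = {Delta_odd m n r | r. r \<in> R}"
  have dvd: "n dvd s * n - 2 * r \<longleftrightarrow> n dvd r" for r
  proof -
    have "n dvd s * n - 2 * r \<longleftrightarrow> n dvd 2 * r" by (simp add: dvd_diff_right_iff)
    then show ?thesis using n(2) by (simp add: coprime_dvd_mult_right_iff coprime_right_2_iff_odd)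
  qed
  have "0 < n" "1 \<le> s" using n h by auto
  note R = inner_rotation_numbers_multiples[OF this dvd, folded R_def]
  have R_eq: "R = inner_rotation_numbers m n" using R(1) h by simp
  note DD = Delta_odd_components[OF assms(1) n R_eq D_def]
  note comps = Hom_cycles_components[OF assms(1) n(1) n4, folded DD(2)]
  have "n dvd m" using h by simp
  then have "int (card (rotations m n)) = 2 * n" by (rule card_rotations[OF assms(1) n(1)])
  moreover have "int (card D) = s - 1" using DD(3) R(2) h R_eq by simp
  moreover have "\<forall>C \<in> rotations m n. \<exists>p. C = {p}" by (auto simp: rotations_def)
  moreover have "\<forall>C \<in> D. homotopy_circle (subtopology (Hom_cycles m n) C)"
    using strands_homotopy_circle[OF assms(1) n(1) n4] DD(2) by simp
  ultimately show "let R = {j * n | j. 1 \<le> j \<and> j \<le> s - 1};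
             D = {Delta_odd m n r | r. r \<in> R}
         in (\<forall>r \<in> R. \<exists>!C. is_Delta_odd m n r C) \<and>
            (\<exists>P. connected_components_of (Hom_cycles m n) = P \<union> D \<and> P \<inter> D = {} \<and>
               int (card P) = 2 * n \<and> (\<forall>C \<in> P. \<exists>p. C = {p}) \<and>
               int (card D) = s - 1 \<and>
               (\<forall>C \<in> D. homotopy_circle (subtopology (Hom_cycles m n) C)))"
    unfolding Let_def R_def[symmetric] D_def[symmetric] using DD(1) comps by blast
next
  fix l k assume h: "n = 2 * l + 1 \<and> m = 2 * k + 1 \<and> \<not> n dvd m"
  then have n: "3 \<le> n" "odd n" using assms(2) by auto
  let ?T = "odd_floor (real_of_int m / real_of_int n)"
  have par: "even (t - m) \<longleftrightarrow> odd t" for t using h by simp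
  have T: "even (?T - m)" "- 1 \<le> ?T" "\<And>t. even (t - m) \<Longrightarrow> t \<le> ?T \<longleftrightarrow> t * n \<le> m"
  proof -
    have F: "t \<le> \<lfloor>real_of_int m / real_of_int n\<rfloor> \<longleftrightarrow> t * n \<le> m" for t
      using n(1) by (intro le_floor_divide_iff) simp
    show "even (?T - m)" unfolding par by (simp add: odd_floor_eq)
    have "0 \<le> \<lfloor>real_of_int m / real_of_int n\<rfloor>" unfolding F using assms(1) by simp
    then show "- 1 \<le> ?T" unfolding odd_floor_eq by (simp del: zero_le_floor split: if_split)
    show "t \<le> ?T \<longleftrightarrow> t * n \<le> m" if "even (t - m)" for t
      unfolding F[symmetric] using that unfolding par by (cases "t = \<lfloor>real_of_int m / real_of_int n\<rfloor>") (auto simp: odd_floor_eq)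
  qed
  define R where "R = {(m + t * n) div 2 | t. odd t \<and> \<bar>t\<bar> \<le> ?T}"
  define D where "D = {Delta_odd m n r | r. r \<in> R}"
  have "\<not> n dvd m" using h by blast
  then have R: "R = inner_rotation_numbers m n" "int (card (inner_rotation_numbers m n)) = ?T + 1"
    using inner_rotation_numbers_odd[OF n assms(1) _ T] unfolding R_def par by simp_all
  note DD = Delta_odd_components[OF assms(1) n R(1) D_def]
  have n4: "n \<noteq> 4" using n(2) by auto
  note comps = Hom_cycles_components[OF assms(1) n(1) n4, folded DD(2)]
  have "rotations m n = {}" using \<open>\<not> n dvd m\<close> by (simp add: rotations_def)
  then have "connected_components_of (Hom_cycles m n) = D" using comps by simp
  moreover have "int (card D) = ?T + 1" using DD(3) R by simp
  moreover have "\<forall>C \<in> D. homotopy_circle (subtopology (Hom_cycles m n) C)"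
    using strands_homotopy_circle[OF assms(1) n(1) n4] DD(2) by simp
  ultimately show "let R = {(m + t * n) div 2 | t. odd t \<and> \<bar>t\<bar> \<le> odd_floor (real_of_int m / real_of_int n)};
             D = {Delta_odd m n r | r. r \<in> R}
         in (\<forall>r \<in> R. \<exists>!C. is_Delta_odd m n r C) \<and>
            connected_components_of (Hom_cycles m n) = D \<and>
            int (card D) = odd_floor (real_of_int m / real_of_int n) + 1 \<and>
            (\<forall>C \<in> D. homotopy_circle (subtopology (Hom_cycles m n) C))"
    unfolding Let_def R_def[symmetric] D_def[symmetric] using DD(1) by blast
next
  fix l k assume h: "n = 2 * l + 1 \<and> m = 2 * k \<and> \<not> n dvd m"
  then have n: "3 \<le> n" "odd n" using assms(2) by auto
  let ?T = "even_floor (real_of_int m / real_of_int n)"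
  have par: "even (t - m) \<longleftrightarrow> even t" for t using h by simp
  have T: "even (?T - m)" "- 1 \<le> ?T" "\<And>t. even (t - m) \<Longrightarrow> t \<le> ?T \<longleftrightarrow> t * n \<le> m"
  proof -
    have F: "t \<le> \<lfloor>real_of_int m / real_of_int n\<rfloor> \<longleftrightarrow> t * n \<le> m" for t
      using n(1) by (intro le_floor_divide_iff) simp
    show "even (?T - m)" unfolding par by (simp add: even_floor_eq)
    have "0 \<le> \<lfloor>real_of_int m / real_of_int n\<rfloor>" unfolding F using assms(1) by simp
    then show "- 1 \<le> ?T" unfolding even_floor_eq by (simp del: zero_le_floor split: if_split)
    show "t \<le> ?T \<longleftrightarrow> t * n \<le> m" if "even (t - m)" for t
      unfolding F[symmetric] using that unfolding par by (cases "t = \<lfloor>real_of_int m / real_of_int n\<rfloor>") (auto simp: even_floor_eq)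
  qed
  define R where "R = {k + (t * n) div 2 | t. even t \<and> \<bar>t\<bar> \<le> ?T}"
  define D where "D = {Delta_odd m n r | r. r \<in> R}"
  have "\<not> n dvd m" using h by blast
  then have R': "{(m + t * n) div 2 | t. even t \<and> \<bar>t\<bar> \<le> ?T} = inner_rotation_numbers m n"
      "int (card (inner_rotation_numbers m n)) = ?T + 1"
    using inner_rotation_numbers_odd[OF n assms(1) _ T] unfolding par by simp_all
  \<comment> \<open>As \<open>m = 2 * k\<close> is even, it can be taken out of the integer
    division.\<close>
  have "(m + t * n) div 2 = k + (t * n) div 2" for t using h by simp
  then have R_eq: "R = inner_rotation_numbers m n" using R'(1) unfolding R_def by simp
  note DD = Delta_odd_components[OF assms(1) n R_eq D_def]
  have n4: "n \<noteq> 4" using n(2) by auto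
  note comps = Hom_cycles_components[OF assms(1) n(1) n4, folded DD(2)]
  have "rotations m n = {}" using \<open>\<not> n dvd m\<close> by (simp add: rotations_def)
  then have "connected_components_of (Hom_cycles m n) = D" using comps by simp
  moreover have "int (card D) = ?T + 1" using DD(3) R'(2) R_eq by simp
  moreover have "\<forall>C \<in> D. homotopy_circle (subtopology (Hom_cycles m n) C)"
    using strands_homotopy_circle[OF assms(1) n(1) n4] DD(2) by simp
  ultimately show "let R = {k + (t * n) div 2 | t. even t \<and> \<bar>t\<bar> \<le> even_floor (real_of_int m / real_of_int n)};
             D = {Delta_odd m n r | r. r \<in> R}
         in (\<forall>r \<in> R. \<exists>!C. is_Delta_odd m n r C) \<and>
            connected_components_of (Hom_cycles m n) = D \<and>
            int (card D) = even_floor (real_of_int m / real_of_int n) + 1 \<and>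
            (\<forall>C \<in> D. homotopy_circle (subtopology (Hom_cycles m n) C))"
    unfolding Let_def R_def[symmetric] D_def[symmetric] using DD(1) by blast
qed
end
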